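(* Consider the local-to-global rewiring with parameter $\alpha_n$. Suppose that $\lim_{n\to\infty}\alpha_n=0$ and that the times $t$ considered below satisfy $t=O(\log n)$. Suppose that $|H|=\Theta(n)$, that the condition (Additional regularity of degrees) stated in the context holds, and that $\lim_{n\to\infty}c_n^{\mathrm{stat}}=c_*\in(0,\infty)$, where $1/c_n^{\mathrm{stat}}=\frac1{|H|}\sum_{z\in H}\log(\deg_H(z))$. Then the following hold whp in $x$ and $\xi$. (1) If $\lim_{n\to\infty}\alpha_n\log n=\infty$, then $$\mathcal{D}^{\mathrm{dyn}}_{x,\xi}(\lfloor c/\alpha_n\rfloor)=o_{\mathbb{P}}(1)+e^{-c},\qquad c\in[0,\infty).$$ (2) If $\lim_{n\to\infty}\alpha_n\log n=\gamma\in(0,\infty)$, then $$\mathcal{D}^{\mathrm{dyn}}_{x,\xi}(\lfloor c\log n\rfloor)=o_{\mathbb{P}}(1)+\begin{cases}e^{-\gamma c},&c\in[0,c_* ),\\0,&c\in(c_*,\infty).\end{cases}$$ (3) If $\lim_{n\to\infty}\alpha_n\log n=0$, then $$\mathcal{D}^{\mathrm{dyn}}_{x,\xi}(\lfloor c\log n\rfloor)=o_{\mathbb{P}}(1)+\begin{cases}1,&c\in[0,c_* ),\\0,&c\in(c_*,\infty).\end{cases}$$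
   Context: **Graphs and half-edges.** For each $n$, $V$ is a vertex set with $|V|=n$ and prescribed degrees $\deg(v)$, $v\in V$. All quantities depend on $n$, and asymptotics are as $n\to\infty$. Each $v\in V$ carries a set $H_v$ of $\deg(v)$ half-edges, and $H=\bigsqcup_{v\in V}H_v$ ($|H|$ is even). For $h\in H$, $v(h)$ is the vertex with $h\in H_{v(h)}$. Two distinct half-edges $x,y$ of the same vertex are called siblings, written $x\sim y$. Put $\deg_H(h)=\deg(v(h))-1$. A configuration is a map $\xi:H\to H$ with $\xi(h)\ne h$ and $\xi(\xi(h))=h$ for all $h$ (a pairing of half-edges, identified with its set of pairs, called edges). $\mathrm{Conf}_H$ is the set of configurations. $U_H$ and $U_{\mathrm{Conf}_H}$ are the uniform distributions on $H$ and $\mathrm{Conf}_H$. **Non-backtracking walk.** For a configuration $\xi$, $P_\xi(x,y)=1/\deg_H(y)$ if $\xi(x)\sim y$ and $\xi(x)\neq y$, and $P_\xi(x,y)=0$ otherwise. **Local-to-global rewiring.** $(X_t,C_t)_{t\ge0}$ is a Markov chain on $H\times\mathrm{Conf}_H$, with law $\mathbb{P}_{x,\xi}$ when started from $(X_0,C_0)=(x,\xi)$. At each time $t\in\mathbb{N}$: with probability $1-\alpha_n$, $C_t=C_{t-1}$; with probability $\alpha_n$, the edge $e=\{X_{t-1},C_{t-1}(X_{t-1})\}$ is rewired, i.e. an edge $e'\in C_{t-1}\setminus\{e\}$ is chosen uniformly at random, $e$ and $e'$ are broken into half-edges, and the two half-edges of $e$ are paired with the two half-edges of $e'$ in a uniformly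 random way (the two possibilities having probability $1/2$ each), all other pairs being kept, which gives $C_t$. Then $X_t$ is drawn from $P_{C_t}(X_{t-1},\cdot)$. **Distance.** $\|\mu-\nu\|_{\mathrm{TV}}=\sup_A[\mu(A)-\nu(A)]$. $\mathcal{D}^{\mathrm{dyn}}_{x,\xi}(t)=\|\mathbb{P}_{x,\xi}(X_t\in\cdot)-U_H\|_{\mathrm{TV}}$. **Additional regularity of degrees.** As $n\to\infty$: $\max_{v\in V}\deg(v)=n^{o(1)}$; $\deg(v)\ge3$ for all $v\in V$; and $$\frac{\lambda_2}{\lambda_1^3}=\omega\Big(\frac{(\log\log|H|)^2}{\log|H|}\Big),\qquad\frac{\lambda_2^{3/2}}{\lambda_3\sqrt{\lambda_1}}=\omega\Big(\frac1{\sqrt{\log|H|}}\Big),$$ where $\lambda_1=\frac1{|H|}\sum_{z\in H}\log(\deg_H(z))$ and $\lambda_m=\frac1{|H|}\sum_{z\in H}|\log(\deg_H(z))-\lambda_1|^m$ for $m=2,3$. **Probabilistic conventions.** Let $\mu=U_H\times U_{\mathrm{Conf}_H}$. A statement depending on $(x,\xi)$ holds whp if the $\mu$-measure of the set of pairs for which it holds tends to $1$ as $n\to\infty$. $o_{\mathbb{P}}(1)$ denotes a function of $(x,\xi)$ tending to $0$ in $\mu$-probability. The constant $c$ is fixed, independent of $n$. *)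

theory Defs
  imports "HOL-Probability.Probability" "HOL-Library.Landau_Symbols"
begin

section \<open>Half-edges and configurations\<close>

text \<open>
  The half-edges of a vertex \<open>v\<close> are the pairs \<open>(v, 0), \<dots>, (v, d v - 1)\<close>, so the sets
  \<open>H\<^sub>v\<close> are disjoint by construction and the vertex of a half-edge \<open>h\<close> is \<open>fst h\<close>.
\<close>

definition half_edges :: "'v set \<Rightarrow> ('v \<Rightarrow> nat) \<Rightarrow> ('v \<times> nat) set" where
  "half_edges V d = (SIGMA v:V. {..<d v})"

definition siblings :: "'v \<times> nat \<Rightarrow> 'v \<times> nat \<Rightarrow> bool" where
  "siblings x y \<longleftrightarrow> x \<noteq> y \<and> fst x = fst y"

definition deg_H :: "('v \<Rightarrow> nat) \<Rightarrow> 'v \<times> nat \<Rightarrow> real" where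
  "deg_H d h = real (d (fst h)) - 1"

text \<open>
  Configurations are extensional functions on \<open>H\<close>, so that each pairing of \<open>H\<close> is
  represented by exactly one HOL function.
\<close>

definition conf :: "'h set \<Rightarrow> ('h \<Rightarrow> 'h) set" where
  "conf H = {\<xi> \<in> H \<rightarrow>\<^sub>E H. \<forall>h\<in>H. \<xi> h \<noteq> h \<and> \<xi> (\<xi> h) = h}"

definition conf_edges :: "'h set \<Rightarrow> ('h \<Rightarrow> 'h) \<Rightarrow> 'h set set" where
  "conf_edges H \<xi> = (\<lambda>h. {h, \<xi> h}) ` H"


section \<open>Non-backtracking walk with local-to-global rewiring\<close>

definition nb_prob :: "'v set \<Rightarrow> ('v \<Rightarrow> nat) \<Rightarrow> ('v \<times> nat \<Rightarrow> 'v \<times> nat) \<Rightarrow>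
    'v \<times> nat \<Rightarrow> 'v \<times> nat \<Rightarrow> real" where
  "nb_prob V d \<xi> x y =
     (if y \<in> half_edges V d \<and> siblings (\<xi> x) y \<and> \<xi> x \<noteq> y then 1 / deg_H d y else 0)"

definition nb_step :: "'v set \<Rightarrow> ('v \<Rightarrow> nat) \<Rightarrow> ('v \<times> nat \<Rightarrow> 'v \<times> nat) \<Rightarrow>
    'v \<times> nat \<Rightarrow> ('v \<times> nat) pmf" where
  "nb_step V d \<xi> x = embed_pmf (nb_prob V d \<xi> x)"

text \<open>
  Choosing \<open>y\<close> uniformly among the two half-edges of \<open>e'\<close> as the new partner of \<open>x\<close>
  chooses uniformly between the two ways of pairing \<open>{x, \<xi> x}\<close> with \<open>e' = {y, \<xi> y}\<close>.
\<close>

definition rewire :: "'h set \<Rightarrow> 'h \<Rightarrow> ('h \<Rightarrow> 'h) \<Rightarrow> ('h \<Rightarrow> 'h) pmf" where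
  "rewire H x \<xi> =
     do {
       e' \<leftarrow> pmf_of_set (conf_edges H \<xi> - {{x, \<xi> x}});
       y \<leftarrow> pmf_of_set e';
       return_pmf (\<xi>(x := y, y := x, \<xi> x := \<xi> y, \<xi> y := \<xi> x))
     }"

definition dyn_step :: "'v set \<Rightarrow> ('v \<Rightarrow> nat) \<Rightarrow> real \<Rightarrow>
    ('v \<times> nat) \<times> ('v \<times> nat \<Rightarrow> 'v \<times> nat) \<Rightarrow>
    (('v \<times> nat) \<times> ('v \<times> nat \<Rightarrow> 'v \<times> nat)) pmf" where
  "dyn_step V d \<alpha> = (\<lambda>(x, \<xi>).
     do {
       b \<leftarrow> bernoulli_pmf \<alpha>;
       \<xi>' \<leftarrow> (if b then rewire (half_edges V d) x \<xi> else return_pmf \<xi>);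
       x' \<leftarrow> nb_step V d \<xi>' x;
       return_pmf (x', \<xi>')
     })"

text \<open>The law of \<open>(X\<^sub>t, C\<^sub>t)\<close> for the chain started from a given state.\<close>

primrec dyn_law :: "'v set \<Rightarrow> ('v \<Rightarrow> nat) \<Rightarrow> real \<Rightarrow>
    ('v \<times> nat) \<times> ('v \<times> nat \<Rightarrow> 'v \<times> nat) \<Rightarrow> nat \<Rightarrow>
    (('v \<times> nat) \<times> ('v \<times> nat \<Rightarrow> 'v \<times> nat)) pmf" where
  "dyn_law V d \<alpha> s 0 = return_pmf s"
| "dyn_law V d \<alpha> s (Suc t) = bind_pmf (dyn_law V d \<alpha> s t) (dyn_step V d \<alpha>)"

definition tv_dist :: "'a pmf \<Rightarrow> 'a pmf \<Rightarrow> real" where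
  "tv_dist p q = (SUP A. measure_pmf.prob p A - measure_pmf.prob q A)"

definition dyn_dist :: "'v set \<Rightarrow> ('v \<Rightarrow> nat) \<Rightarrow> real \<Rightarrow>
    ('v \<times> nat) \<times> ('v \<times> nat \<Rightarrow> 'v \<times> nat) \<Rightarrow> nat \<Rightarrow> real" where
  "dyn_dist V d \<alpha> s t =
     tv_dist (map_pmf fst (dyn_law V d \<alpha> s t)) (pmf_of_set (half_edges V d))"


section \<open>Degree statistics\<close>

definition lam1 :: "'v set \<Rightarrow> ('v \<Rightarrow> nat) \<Rightarrow> real" where
  "lam1 V d = (\<Sum>z\<in>half_edges V d. ln (deg_H d z)) / real (card (half_edges V d))"

definition lam :: "nat \<Rightarrow> 'v set \<Rightarrow> ('v \<Rightarrow> nat) \<Rightarrow> real" where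
  "lam m V d =
     (\<Sum>z\<in>half_edges V d. \<bar>ln (deg_H d z) - lam1 V d\<bar> ^ m) / real (card (half_edges V d))"

definition c_stat :: "'v set \<Rightarrow> ('v \<Rightarrow> nat) \<Rightarrow> real" where
  "c_stat V d = 1 / lam1 V d"


section \<open>Probabilistic asymptotics\<close>

definition unif_start :: "'v set \<Rightarrow> ('v \<Rightarrow> nat) \<Rightarrow>
    (('v \<times> nat) \<times> ('v \<times> nat \<Rightarrow> 'v \<times> nat)) pmf" where
  "unif_start V d =
     pair_pmf (pmf_of_set (half_edges V d)) (pmf_of_set (conf (half_edges V d)))"

definition whp :: "(nat \<Rightarrow> 'a pmf) \<Rightarrow> (nat \<Rightarrow> 'a \<Rightarrow> bool) \<Rightarrow> bool" where
  "whp \<mu> P \<longleftrightarrow> (\<lambda>n. measure_pmf.prob (\<mu> n) {s. P n s}) \<longlonglongrightarrow> 1"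

definition little_oP :: "(nat \<Rightarrow> 'a pmf) \<Rightarrow> (nat \<Rightarrow> 'a \<Rightarrow> real) \<Rightarrow> bool" where
  "little_oP \<mu> R \<longleftrightarrow>
     (\<forall>\<epsilon>>0. (\<lambda>n. measure_pmf.prob (\<mu> n) {s. \<bar>R n s\<bar> > \<epsilon>}) \<longlonglongrightarrow> 0)"

text \<open>With high probability, \<open>F = o\<^sub>P(1) + a\<close>.\<close>

definition whp_eq_oP :: "(nat \<Rightarrow> 'a pmf) \<Rightarrow> (nat \<Rightarrow> 'a \<Rightarrow> real) \<Rightarrow> real \<Rightarrow> bool" where
  "whp_eq_oP \<mu> F a \<longleftrightarrow> (\<exists>R. little_oP \<mu> R \<and> whp \<mu> (\<lambda>n s. F n s = R n s + a))"


section \<open>Well-definedness\<close>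

lemma finite_half_edges: "finite V \<Longrightarrow> finite (half_edges V d)"
  by (simp add: half_edges_def)

lemma confD:
  assumes "\<xi> \<in> conf H" "h \<in> H"
  shows "\<xi> h \<in> H" "\<xi> h \<noteq> h" "\<xi> (\<xi> h) = h"
  using assms by (auto simp: conf_def)

text \<open>The transition probabilities sum to one, so \<^const>\<open>embed_pmf\<close> is applied properly.\<close>

lemma nb_prob_eq_pmf_of_set:
  assumes "\<xi> x \<in> half_edges V d" "d (fst (\<xi> x)) \<ge> 2"
  defines "S \<equiv> {y \<in> half_edges V d. siblings (\<xi> x) y}"
  shows "nb_prob V d \<xi> x = pmf (pmf_of_set S)" "finite S" "S \<noteq> {}"
proof -
  obtain v i where vi: "\<xi> x = (v, i)" by (cases "\<xi> x")
  have v: "v \<in> V" "i < d v" "d v \<ge> 2"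
    using assms by (auto simp: vi half_edges_def)
  have S: "S = Pair v ` ({..<d v} - {i})"
    using v by (auto simp: S_def half_edges_def siblings_def vi)
  have card: "card S = d v - 1"
    unfolding S using v by (subst card_image) (auto simp: inj_on_def)
  show fin: "finite S" unfolding S by simp
  show ne: "S \<noteq> {}" using card v by auto
  show "nb_prob V d \<xi> x = pmf (pmf_of_set S)"
  proof
    fix y
    have "deg_H d y = real (card S)" if "y \<in> S"
      using that card v by (auto simp: S deg_H_def)
    moreover have "siblings (\<xi> x) y \<Longrightarrow> \<xi> x \<noteq> y"
      by (simp add: siblings_def)
    ultimately show "nb_prob V d \<xi> x y = pmf (pmf_of_set S) y"
      using fin ne by (auto simp: nb_prob_def S_def indicator_def)
  qed
qed

lemma nb_step_eq_pmf_of_set: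
  assumes "\<xi> x \<in> half_edges V d" "d (fst (\<xi> x)) \<ge> 2"
  shows "nb_step V d \<xi> x = pmf_of_set {y \<in> half_edges V d. siblings (\<xi> x) y}"
  unfolding nb_step_def nb_prob_eq_pmf_of_set(1)[of \<xi> x V d, OF assms]
  by (rule type_definition.Rep_inverse[OF td_pmf_embed_pmf])

lemma pmf_nb_step:
  assumes "\<xi> x \<in> half_edges V d" "d (fst (\<xi> x)) \<ge> 2"
  shows "pmf (nb_step V d \<xi> x) = nb_prob V d \<xi> x"
  using nb_step_eq_pmf_of_set[of \<xi> x V d, OF assms] nb_prob_eq_pmf_of_set(1)[of \<xi> x V d, OF assms]
  by simp

text \<open>Rewiring is well defined as soon as there is a second edge, and preserves \<^const>\<open>conf\<close>.\<close>

lemma rewire_edges_nonempty: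
  assumes "finite H" "card H \<ge> 3" "\<xi> \<in> conf H" "x \<in> H"
  shows "finite (conf_edges H \<xi> - {{x, \<xi> x}})" "conf_edges H \<xi> - {{x, \<xi> x}} \<noteq> {}"
proof -
  show "finite (conf_edges H \<xi> - {{x, \<xi> x}})"
    using assms by (simp add: conf_edges_def)
  have "card {x, \<xi> x} \<le> 2" by (simp add: card_insert_if)
  then have "\<not> H \<subseteq> {x, \<xi> x}"
    using assms card_mono[of "{x, \<xi> x}" H] by auto
  then show "conf_edges H \<xi> - {{x, \<xi> x}} \<noteq> {}"
    by (auto simp: conf_edges_def)
qed

lemma set_rewire_subset:
  assumes "finite H" "card H \<ge> 3" "\<xi> \<in> conf H" "x \<in> H"
  shows "set_pmf (rewire H x \<xi>) \<subseteq> conf H"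
proof
  fix \<zeta> assume "\<zeta> \<in> set_pmf (rewire H x \<xi>)"
  then obtain e' y where e': "e' \<in> conf_edges H \<xi>" "e' \<noteq> {x, \<xi> x}" and y: "y \<in> set_pmf (pmf_of_set e')"
    and \<zeta>: "\<zeta> = \<xi>(x := y, y := x, \<xi> x := \<xi> y, \<xi> y := \<xi> x)"
    using rewire_edges_nonempty[OF assms] by (auto simp: rewire_def)
  note c = confD[OF assms(3)]
  obtain h where h: "h \<in> H" "e' = {h, \<xi> h}" using e' by (auto simp: conf_edges_def)
  then have "y \<in> {h, \<xi> h}" using y by (subst (asm) set_pmf_of_set) auto
  then have yH: "y \<in> H" and e'y: "e' = {y, \<xi> y}" using h c by auto
  have "y \<noteq> x" "y \<noteq> \<xi> x" using e' e'y c[OF assms(4)] by auto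
  moreover from this have "\<xi> y \<noteq> x" "\<xi> y \<noteq> \<xi> x" using c yH assms(4) by metis+
  ultimately show "\<zeta> \<in> conf H"
    using assms(3,4) yH c unfolding \<zeta> conf_def
    by (auto simp: PiE_iff extensional_def) (metis c(3))+
qed

lemma set_dyn_step_subset:
  assumes "finite V" "\<forall>v\<in>V. d v \<ge> 3" "x \<in> half_edges V d" "\<xi> \<in> conf (half_edges V d)"
  shows "set_pmf (dyn_step V d \<alpha> (x, \<xi>)) \<subseteq> half_edges V d \<times> conf (half_edges V d)"
proof -
  let ?H = "half_edges V d"
  have fin: "finite ?H" using assms(1) by (rule finite_half_edges)
  have "Pair (fst x) ` {..<d (fst x)} \<subseteq> ?H" using assms(3) by (auto simp: half_edges_def)
  then have "card (Pair (fst x) ` {..<d (fst x)}) \<le> card ?H" by (rule card_mono[OF fin])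
  moreover have "card (Pair (fst x) ` {..<d (fst x)}) = d (fst x)"
    by (simp add: card_image inj_on_def)
  moreover have "d (fst x) \<ge> 3" using assms(2,3) by (auto simp: half_edges_def)
  ultimately have card: "card ?H \<ge> 3" by simp
  have rw: "set_pmf (rewire ?H x \<xi>) \<subseteq> conf ?H"
    by (rule set_rewire_subset[OF fin card assms(4,3)])
  have nb: "set_pmf (nb_step V d \<xi>' x) \<subseteq> ?H" if "\<xi>' \<in> conf ?H" for \<xi>'
  proof -
    have \<xi>': "\<xi>' x \<in> ?H" using confD(1)[OF that assms(3)] .
    then have d2: "d (fst (\<xi>' x)) \<ge> 2" using assms(2) by (fastforce simp: half_edges_def)
    show ?thesis
      using nb_step_eq_pmf_of_set[of \<xi>' x V d, OF \<xi>' d2]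
        nb_prob_eq_pmf_of_set(2,3)[of \<xi>' x V d, OF \<xi>' d2] by auto
  qed
  have "\<xi>' \<in> conf ?H"
    if "\<xi>' \<in> set_pmf (if b then rewire ?H x \<xi> else return_pmf \<xi>)" for b \<xi>'
    using that rw assms(4) by (auto split: if_splits)
  with nb show ?thesis
    by (fastforce simp: dyn_step_def)
qed

text \<open>The time scales \<open>c / \<alpha>\<^sub>n\<close> and \<open>c log n\<close> are automatically of order \<open>O(log n)\<close>.\<close>

lemma times_bigo_ln:
  fixes \<alpha> :: "nat \<Rightarrow> real"
  assumes "c \<ge> 0"
  shows "(\<lambda>n. real (nat \<lfloor>c * ln (real n)\<rfloor>)) \<in> O(\<lambda>n. ln (real n))"
    and "filterlim (\<lambda>n. \<alpha> n * ln (real n)) at_top sequentially \<Longrightarrow>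
           (\<lambda>n. real (nat \<lfloor>c / \<alpha> n\<rfloor>)) \<in> O(\<lambda>n. ln (real n))"
proof -
  have floor_le: "real (nat \<lfloor>u\<rfloor>) \<le> u" if "u \<ge> 0" for u :: real
    using that by simp
  show "(\<lambda>n. real (nat \<lfloor>c * ln (real n)\<rfloor>)) \<in> O(\<lambda>n. ln (real n))"
  proof (rule bigoI)
    show "\<forall>\<^sub>F n in sequentially. norm (real (nat \<lfloor>c * ln (real n)\<rfloor>)) \<le> c * norm (ln (real n))"
      using eventually_ge_at_top[of 1]
    proof eventually_elim
      case (elim n)
      then have "c * ln (real n) \<ge> 0" using assms by simp
      from floor_le[OF this] elim show ?case by simp
    qed
  qed
  assume "filterlim (\<lambda>n. \<alpha> n * ln (real n)) at_top sequentially"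
  then have "\<forall>\<^sub>F n in sequentially. \<alpha> n * ln (real n) \<ge> 1"
    by (simp add: filterlim_at_top)
  then show "(\<lambda>n. real (nat \<lfloor>c / \<alpha> n\<rfloor>)) \<in> O(\<lambda>n. ln (real n))"
  proof (intro bigoI[where c = c], elim eventually_rev_mp,
      intro eventually_mono[OF eventually_ge_at_top[of 1]] impI)
    fix n :: nat
    assume elim: "1 \<le> \<alpha> n * ln (real n)" "1 \<le> n"
    have ln: "ln (real n) \<ge> 0" using elim(2) by simp
    have \<alpha>: "\<alpha> n > 0"
      using elim(1) ln by (smt (verit) mult_nonpos_nonneg)
    have "c * 1 \<le> c * (\<alpha> n * ln (real n))"
      using assms elim(1) by (intro mult_left_mono) auto
    then have "c / \<alpha> n \<le> c * ln (real n)"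
      using \<alpha> by (simp add: field_simps)
    moreover have "c / \<alpha> n \<ge> 0" using assms \<alpha> by simp
    ultimately have "real (nat \<lfloor>c / \<alpha> n\<rfloor>) \<le> c * ln (real n)"
      using order_trans[OF floor_le[of "c / \<alpha> n"]] by blast
    then show "norm (real (nat \<lfloor>c / \<alpha> n\<rfloor>)) \<le> c * norm (ln (real n))"
      using ln by (simp only: real_norm_def abs_of_nonneg of_nat_0_le_iff)
  qed
qed

end

theory Submission
  imports Defs "HOL-Real_Asymp.Real_Asymp"
begin

text \<open>
  \<^bold>\<open>One rewiring makes the walk uniform.\<close> A rewiring attaches the edge of the walker to a uniform
  half-edge, so the walker moves to an almost uniform place, and the uniform distribution is
  stationary for the non-backtracking walk on every configuration. Hence the dynamic walk should
  behave like a walk on the fixed initial configuration that jumps to a uniform half-edge with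
  probability \<open>\<alpha>\<close> in each step. The distance of that walk from the uniform distribution is exactly
  \<open>(1 - \<alpha>) ^ t\<close> times the static distance (\<open>tv_dist_jump_law\<close>). The two walks are compared by
  replacing rewirings with jumps one step at a time. The uniform law on states is stationary
  for the dynamic chain (\<open>unif_start_dyn_law\<close>), so every replacement costs on average what it costs
  at time 0, where the new walk differs from a static walk with uniform start only
  if it meets one of the four rewired half-edges (\<open>tv_dist_rewired_law\<close>). This has small probability,
  because a walk on a uniform configuration does not return to its start within logarithmic time.
  The result is \<open>dyn_static_comparison\<close>.

  \<^bold>\<open>The static walk has a cutoff at \<open>ln n / lam1\<close>.\<close> Averaged over the configuration, the partner of
  a half-edge that was not used before is almost uniform (\<open>partner_almost_uniform\<close>, by switching).
  Consequently the walk has a path without repeated vertices with high probability, and such a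
  path is dominated by a sequence of independent uniform half-edges (\<open>simple_path_prob_le\<close>). The
  probability of the path given the configuration is the inverse of a product of values of
  \<open>deg_H\<close>; by Chebyshev's inequality it is \<open>exp (- t * lam1)\<close> up to a factor \<open>n\<close> to a small power.
  If \<open>t * lam1\<close> is below \<open>ln n\<close>, there are too few such paths to reach most half-edges
  (\<open>tv_dist_nbw_ge\<close>). If it is above \<open>ln n\<close>, the second moment method applies (\<open>tv_dist_nbw_sq_le\<close>):
  two walks on the same configuration must not end at the same half-edge with probability
  more than \<open>(1 + o(1)) / n\<close>. They follow the same path with probability \<open>o(1 / n)\<close>. Otherwise they
  separate and merge again, and conditioned on the first path the probabilities of merging a
  given number of steps before the end form a telescoping sum (\<open>collisions_le\<close>).

  The trichotomy follows because \<open>(1 - \<alpha>) ^ t\<close> converges to \<open>exp (- L)\<close> if \<open>\<alpha> * t\<close> converges to \<open>L\<close>.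
\<close>


section \<open>Total variation distance\<close>

lemma prob_bind_pmf:
  "measure_pmf.prob (bind_pmf p f) A = (\<integral>x. measure_pmf.prob (f x) A \<partial>measure_pmf p)"
proof -
  have "ennreal (measure_pmf.prob (bind_pmf p f) A) = emeasure (bind_pmf p f) A"
    by (simp add: measure_pmf.emeasure_eq_measure)
  also have "\<dots> = (\<integral>\<^sup>+x. ennreal (measure_pmf.prob (f x) A) \<partial>measure_pmf p)"
    by (subst emeasure_bind_pmf) (simp add: measure_pmf.emeasure_eq_measure)
  also have "\<dots> = ennreal (\<integral>x. measure_pmf.prob (f x) A \<partial>measure_pmf p)"
    by (rule nn_integral_eq_integral) (auto intro!: measure_pmf.integrable_const_bound[where B=1])
  finally show ?thesis
    by (subst (asm) ennreal_inj) (auto intro!: integral_nonneg_AE)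
qed

lemma integrable_pmf_bounded:
  fixes f :: "'a \<Rightarrow> real"
  assumes "\<And>x. \<bar>f x\<bar> \<le> B"
  shows "integrable (measure_pmf p) f"
  using assms by (intro measure_pmf.integrable_const_bound[where B=B]) auto

lemma tv_dist_bdd: "bdd_above (range (\<lambda>A. measure_pmf.prob p A - measure_pmf.prob q A))"
proof (rule bdd_aboveI2)
  show "measure_pmf.prob p A - measure_pmf.prob q A \<le> 1" for A
    by (smt (verit) measure_pmf.prob_le_1 measure_nonneg)
qed

lemma tv_dist_ge: "measure_pmf.prob p A - measure_pmf.prob q A \<le> tv_dist p q"
  unfolding tv_dist_def by (rule cSUP_upper[OF UNIV_I tv_dist_bdd])

lemma tv_dist_le:
  "(\<And>A. measure_pmf.prob p A - measure_pmf.prob q A \<le> c) \<Longrightarrow> tv_dist p q \<le> c"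
  unfolding tv_dist_def by (rule cSUP_least) auto

lemma tv_dist_nonneg: "0 \<le> tv_dist p q"
  using tv_dist_ge[of p "{}" q] by simp

lemma tv_dist_le_1: "tv_dist p q \<le> 1"
  by (rule tv_dist_le) (smt (verit) measure_pmf.prob_le_1 measure_nonneg)

lemma tv_dist_self [simp]: "tv_dist p p = 0"
  by (rule antisym[OF tv_dist_le tv_dist_nonneg]) simp

lemma tv_dist_triangle: "tv_dist p r \<le> tv_dist p q + tv_dist q r"
proof (rule tv_dist_le)
  fix A
  show "measure_pmf.prob p A - measure_pmf.prob r A \<le> tv_dist p q + tv_dist q r"
    using tv_dist_ge[of p A q] tv_dist_ge[of q A r] by linarith
qed

lemma tv_dist_sym_le:
  fixes p q :: "'a pmf"
  shows "tv_dist p q \<le> tv_dist q p"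
proof (rule tv_dist_le)
  fix A
  have "measure_pmf.prob r A = 1 - measure_pmf.prob r (-A)" for r :: "'a pmf"
    using measure_pmf.prob_compl[of A r] by (simp add: Compl_eq_Diff_UNIV)
  from this[of p] this[of q] show "measure_pmf.prob p A - measure_pmf.prob q A \<le> tv_dist q p"
    using tv_dist_ge[of q "-A" p] by linarith
qed

lemma tv_dist_commute: "tv_dist p q = tv_dist q p"
  by (rule antisym; rule tv_dist_sym_le)

lemma abs_tv_dist_diff: "\<bar>tv_dist p r - tv_dist q r\<bar> \<le> tv_dist p q"
  using tv_dist_triangle[of p r q] tv_dist_triangle[of q r p] tv_dist_commute[of p q] by linarith

lemma tv_dist_bind:
  fixes f g :: "'a \<Rightarrow> 'b pmf"
  shows "tv_dist (bind_pmf p f) (bind_pmf p g) \<le> (\<integral>x. tv_dist (f x) (g x) \<partial>measure_pmf p)"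
proof (rule tv_dist_le)
  fix A :: "'b set"
  have int: "integrable (measure_pmf p) (\<lambda>x. measure_pmf.prob (h x) A)" for h
    by (rule integrable_pmf_bounded[where B=1]) simp
  have "measure_pmf.prob (bind_pmf p f) A - measure_pmf.prob (bind_pmf p g) A
      = (\<integral>x. (measure_pmf.prob (f x) A - measure_pmf.prob (g x) A) \<partial>measure_pmf p)"
    by (simp add: prob_bind_pmf int)
  also have "\<dots> \<le> (\<integral>x. tv_dist (f x) (g x) \<partial>measure_pmf p)"
    by (rule integral_mono)
      (auto intro!: int tv_dist_ge Bochner_Integration.integrable_diff
        integrable_pmf_bounded[where B=1 and f="\<lambda>x. tv_dist (f x) (g x)"]
        simp: tv_dist_nonneg tv_dist_le_1)
  finally show "measure_pmf.prob (bind_pmf p f) A - measure_pmf.prob (bind_pmf p g) A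
      \<le> (\<integral>x. tv_dist (f x) (g x) \<partial>measure_pmf p)" .
qed

text \<open>
  The distance is the total mass that \<open>p\<close> lacks at the points where it is below uniform, so a
  lower bound \<open>Q\<close> of \<open>p\<close> suffices.
\<close>

lemma tv_dist_unif_le:
  assumes "finite S" "S \<noteq> {}" "set_pmf p \<subseteq> S" "\<And>y. y \<in> S \<Longrightarrow> Q y \<le> pmf p y"
  shows "tv_dist p (pmf_of_set S) \<le> (\<Sum>y\<in>S. \<bar>1 / real (card S) - Q y\<bar>)"
proof (rule tv_dist_le)
  fix A
  have pS: "measure_pmf.prob p B = (\<Sum>y\<in>S \<inter> B. pmf p y)" for B
  proof -
    have "measure_pmf.prob p B = measure_pmf.prob p (S \<inter> B)"
      by (rule measure_pmf.finite_measure_eq_AE)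
        (use assms(3) in \<open>auto simp: AE_measure_pmf_iff\<close>)
    also have "\<dots> = (\<Sum>y\<in>S \<inter> B. pmf p y)"
      using assms(1) by (simp add: measure_measure_pmf_finite)
    finally show ?thesis .
  qed
  have U: "measure_pmf.prob (pmf_of_set S) B = (\<Sum>y\<in>S \<inter> B. 1 / real (card S))" for B
    by (subst measure_pmf_of_set[OF assms(2,1)]) simp
  have compl: "measure_pmf.prob r A = 1 - measure_pmf.prob r (-A)" for r :: "'a pmf"
    using measure_pmf.prob_compl[of A r] by (simp add: Compl_eq_Diff_UNIV)
  have "measure_pmf.prob p A - measure_pmf.prob (pmf_of_set S) A
      = (\<Sum>y\<in>S \<inter> -A. 1 / real (card S) - pmf p y)"
    by (simp add: compl pS U sum_subtractf)
  also have "\<dots> \<le> (\<Sum>y\<in>S \<inter> -A. \<bar>1 / real (card S) - Q y\<bar>)"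
  proof (rule sum_mono)
    fix y assume "y \<in> S \<inter> -A"
    then show "1 / real (card S) - pmf p y \<le> \<bar>1 / real (card S) - Q y\<bar>"
      using assms(4)[of y] by auto
  qed
  also have "\<dots> \<le> (\<Sum>y\<in>S. \<bar>1 / real (card S) - Q y\<bar>)"
    by (rule sum_mono2) (use assms(1) in auto)
  finally show "measure_pmf.prob p A - measure_pmf.prob (pmf_of_set S) A
      \<le> (\<Sum>y\<in>S. \<bar>1 / real (card S) - Q y\<bar>)" .
qed

text \<open>The chains of two kernels that agree off \<open>Z\<close> can be coupled until they visit \<open>Z\<close>.\<close>

lemma tv_dist_kernels_agree:
  fixes k k' :: "'a \<Rightarrow> 'a pmf" and K K' :: "nat \<Rightarrow> 'a \<Rightarrow> 'a pmf"
  assumes K0: "\<And>x. K 0 x = return_pmf x" and KS: "\<And>m x. K (Suc m) x = bind_pmf (k x) (K m)"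
    and K'0: "\<And>x. K' 0 x = return_pmf x" and K'S: "\<And>m x. K' (Suc m) x = bind_pmf (k' x) (K' m)"
    and agree: "\<And>x. x \<notin> Z \<Longrightarrow> k x = k' x"
  shows "tv_dist (K m x) (K' m x) \<le> (\<Sum>i<m. measure_pmf.prob (K' i x) Z)"
proof (induction m arbitrary: x)
  case 0
  then show ?case by (simp add: K0 K'0)
next
  case (Suc m)
  show ?case
  proof (cases "x \<in> Z")
    case True
    have "tv_dist (K (Suc m) x) (K' (Suc m) x) \<le> measure_pmf.prob (K' 0 x) Z"
      using True tv_dist_le_1 by (simp add: K'0)
    also have "\<dots> \<le> (\<Sum>i<Suc m. measure_pmf.prob (K' i x) Z)"
      by (subst sum.lessThan_Suc_shift) (simp add: sum_nonneg)
    finally show ?thesis .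
  next
    case False
    have int: "integrable (measure_pmf (k' x)) (\<lambda>z. measure_pmf.prob (K' i z) Z)" for i
      by (rule integrable_pmf_bounded[where B=1]) simp
    have "tv_dist (K (Suc m) x) (K' (Suc m) x)
        \<le> (\<integral>z. tv_dist (K m z) (K' m z) \<partial>measure_pmf (k' x))"
      unfolding KS K'S agree[OF False] by (rule tv_dist_bind)
    also have "\<dots> \<le> (\<integral>z. (\<Sum>i<m. measure_pmf.prob (K' i z) Z) \<partial>measure_pmf (k' x))"
      by (rule integral_mono)
        (auto intro!: Suc.IH int Bochner_Integration.integrable_sum
            integrable_pmf_bounded[where B=1 and f="\<lambda>z. tv_dist (K m z) (K' m z)"]
          simp: tv_dist_nonneg tv_dist_le_1)
    also have "\<dots> = (\<Sum>i<m. measure_pmf.prob (K' (Suc i) x) Z)"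
      by (simp add: K'S prob_bind_pmf int)
    also have "\<dots> \<le> (\<Sum>i<Suc m. measure_pmf.prob (K' i x) Z)"
      by (subst sum.lessThan_Suc_shift) simp
    finally show ?thesis .
  qed
qed

section \<open>Switching edges of a uniform configuration\<close>

text \<open>The edges of \<open>x\<close> and \<open>y\<close> are broken and \<open>x\<close> is paired with \<open>y\<close>.\<close>

definition switch :: "'h \<Rightarrow> ('h \<Rightarrow> 'h) \<Rightarrow> 'h \<Rightarrow> 'h \<Rightarrow> 'h" where
  "switch x \<xi> y = \<xi>(x := y, y := x, \<xi> x := \<xi> y, \<xi> y := \<xi> x)"

lemma switch_apply:
  assumes "\<xi> \<in> conf H" "x \<in> H" "y \<in> H" "y \<noteq> x" "y \<noteq> \<xi> x"
  shows "switch x \<xi> y x = y" "switch x \<xi> y y = x"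
    "switch x \<xi> y (\<xi> x) = \<xi> y" "switch x \<xi> y (\<xi> y) = \<xi> x"
    "\<And>h. h \<notin> {x, y, \<xi> x, \<xi> y} \<Longrightarrow> switch x \<xi> y h = \<xi> h"
proof -
  note c = confD[OF assms(1)]
  have ne: "\<xi> x \<noteq> x" "\<xi> y \<noteq> y" "\<xi> y \<noteq> x" "\<xi> y \<noteq> \<xi> x"
    using c[OF assms(2)] c[OF assms(3)] assms(4,5) by metis+
  show "switch x \<xi> y x = y" "switch x \<xi> y y = x"
    "switch x \<xi> y (\<xi> x) = \<xi> y" "switch x \<xi> y (\<xi> y) = \<xi> x"
    "\<And>h. h \<notin> {x, y, \<xi> x, \<xi> y} \<Longrightarrow> switch x \<xi> y h = \<xi> h"
    using ne assms(4,5) by (auto simp: switch_def)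
qed

lemma switch_conf:
  assumes "\<xi> \<in> conf H" "x \<in> H" "y \<in> H" "y \<noteq> x" "y \<noteq> \<xi> x"
  shows "switch x \<xi> y \<in> conf H"
proof -
  note c = confD[OF assms(1)]
  note s = switch_apply[OF assms]
  have pair: "switch x \<xi> y h \<in> H \<and> switch x \<xi> y h \<noteq> h \<and> switch x \<xi> y (switch x \<xi> y h) = h"
    if h: "h \<in> H" for h
  proof (cases "h \<in> {x, y, \<xi> x, \<xi> y}")
    case True
    moreover have "\<xi> x \<noteq> x" "\<xi> y \<noteq> y" "\<xi> y \<noteq> x" "\<xi> y \<noteq> \<xi> x" "\<xi> x \<in> H" "\<xi> y \<in> H"
      using c[OF assms(2)] c[OF assms(3)] assms(4,5) by metis+
    ultimately show ?thesis using s(1-4) assms(2-5) by (elim insertE) simp_all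
  next
    case False
    then have "\<xi> h \<notin> {x, y, \<xi> x, \<xi> y}" using c(3)[OF h] c(3)[OF assms(2)] c(3)[OF assms(3)] by (metis insert_iff empty_iff)
    then show ?thesis using False s(5)[of h] s(5)[of "\<xi> h"] c[OF h] by simp
  qed
  have "switch x \<xi> y h = undefined" if "h \<notin> H" for h
  proof -
    have "h \<notin> {x, y, \<xi> x, \<xi> y}" using that assms(2,3) c(1) by auto
    then show ?thesis using s(5) assms(1) that by (auto simp: conf_def PiE_def extensional_def)
  qed
  with pair show ?thesis by (auto simp: conf_def PiE_def extensional_def)
qed

lemma switch_switch:
  assumes "\<xi> \<in> conf H" "x \<in> H" "y \<in> H" "y \<noteq> x" "y \<noteq> \<xi> x"
  shows "switch x (switch x \<xi> y) (\<xi> x) = \<xi>"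
proof
  fix h
  note c = confD[OF assms(1)]
  note s = switch_apply[OF assms]
  have ne: "\<xi> x \<noteq> x" "\<xi> x \<noteq> y" using c[OF assms(2)] c[OF assms(3)] assms(4,5) by metis+
  have "\<xi> x \<in> H" using c assms by blast
  from switch_apply[OF switch_conf[OF assms] assms(2) this ne(1)] s ne
  have s': "switch x (switch x \<xi> y) (\<xi> x) x = \<xi> x"
    "switch x (switch x \<xi> y) (\<xi> x) (\<xi> x) = x"
    "switch x (switch x \<xi> y) (\<xi> x) y = \<xi> y"
    "switch x (switch x \<xi> y) (\<xi> x) (\<xi> y) = y"
    "\<And>h. h \<notin> {x, \<xi> x, y, \<xi> y} \<Longrightarrow> switch x (switch x \<xi> y) (\<xi> x) h = switch x \<xi> y h"
    by auto
  show "switch x (switch x \<xi> y) (\<xi> x) h = \<xi> h"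
  proof (cases "h \<in> {x, y, \<xi> x, \<xi> y}")
    case True
    then show ?thesis using s' c(3)[OF assms(2)] c(3)[OF assms(3)] by (elim insertE) simp_all
  next
    case False
    then show ?thesis using s'(5)[of h] s(5)[of h] by auto
  qed
qed

text \<open>
  All edges have two half-edges, so a uniform half-edge of a uniform edge is a uniform half-edge.
\<close>

lemma rewire_eq_map_switch:
  assumes "finite H" "card H \<ge> 3" "\<xi> \<in> conf H" "x \<in> H"
  shows "rewire H x \<xi> = map_pmf (switch x \<xi>) (pmf_of_set (H - {x, \<xi> x}))"
proof -
  note c = confD[OF assms(3)]
  let ?E = "conf_edges H \<xi> - {{x, \<xi> x}}"
  have edge: "{l, \<xi> l} = {z, \<xi> z}" if "l \<in> H" "z \<in> {l, \<xi> l}" for l z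
    using that c[of l] by auto
  have U: "\<Union> ((\<lambda>e. e) ` ?E) = H - {x, \<xi> x}"
  proof (intro equalityI subsetI)
    fix h assume "h \<in> \<Union> ((\<lambda>e. e) ` ?E)"
    then obtain k where k: "k \<in> H" "{k, \<xi> k} \<noteq> {x, \<xi> x}" "h = k \<or> h = \<xi> k"
      by (auto simp: conf_edges_def)
    then have "{h, \<xi> h} \<noteq> {x, \<xi> x}" using edge[of k h] by auto
    moreover have "h \<in> H" using k c(1)[of k] by auto
    ultimately show "h \<in> H - {x, \<xi> x}" using edge[OF assms(4), of h] by auto
  next
    fix h assume h: "h \<in> H - {x, \<xi> x}"
    then have "{h, \<xi> h} \<in> ?E" by (auto simp: conf_edges_def doubleton_eq_iff)
    then show "h \<in> \<Union> ((\<lambda>e. e) ` ?E)" by auto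
  qed
  have disj: "disjoint_family_on (\<lambda>e. e) ?E"
    unfolding disjoint_family_on_def conf_edges_def
  proof (intro ballI impI)
    fix e f assume "e \<in> (\<lambda>h. {h, \<xi> h}) ` H - {{x, \<xi> x}}" "f \<in> (\<lambda>h. {h, \<xi> h}) ` H - {{x, \<xi> x}}" "e \<noteq> f"
    then obtain h k where "h \<in> H" "k \<in> H" "e = {h, \<xi> h}" "f = {k, \<xi> k}" by blast
    with edge \<open>e \<noteq> f\<close> show "e \<inter> f = {}" by blast
  qed
  have card2: "card e = 2" if e: "e \<in> ?E" for e
  proof -
    obtain h where "h \<in> H" "e = {h, \<xi> h}" using e by (auto simp: conf_edges_def)
    then show ?thesis using c(2)[of h] by simp
  qed
  have "pmf_of_set (\<Union> ((\<lambda>e. e) ` ?E)) = bind_pmf (pmf_of_set ?E) pmf_of_set"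
  proof (rule pmf_of_set_UN[where n = 2])
    show "finite (\<Union> ((\<lambda>e. e) ` ?E))" unfolding U using assms(1) by simp
    show "e \<noteq> {}" if "e \<in> ?E" for e using card2[OF that] by auto
  qed (use rewire_edges_nonempty[OF assms] card2 disj in auto)
  then have "bind_pmf (pmf_of_set ?E) pmf_of_set = pmf_of_set (H - {x, \<xi> x})"
    unfolding U by simp
  then show ?thesis
    unfolding rewire_def switch_def[symmetric]
    by (simp add: map_pmf_def bind_assoc_pmf[symmetric])
qed

lemma finite_conf: "finite H \<Longrightarrow> finite (conf H)"
  by (rule finite_subset[of _ "H \<rightarrow>\<^sub>E H"]) (auto simp: conf_def intro: finite_PiE)

lemma conf_nonempty: "finite H \<Longrightarrow> even (card H) \<Longrightarrow> conf H \<noteq> {}"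
proof (induction "card H" arbitrary: H rule: less_induct)
  case less
  show ?case
  proof (cases "H = {}")
    case True
    then show ?thesis by (auto simp: conf_def)
  next
    case False
    then obtain a where a: "a \<in> H" by auto
    have "H \<noteq> {a}" using less.prems by auto
    then obtain b where b: "b \<in> H" "b \<noteq> a" using a by auto
    define H' where "H' = H - {a, b}"
    have ab: "{a, b} \<subseteq> H" "card {a, b} = 2" using a b by auto
    have "card {a, b} \<le> card H" using less.prems(1) ab(1) by (rule card_mono)
    then have "card H = card H' + 2"
      using ab less.prems(1) by (simp add: H'_def card_Diff_subset del: insert_subset)
    then obtain \<zeta> where z: "\<zeta> \<in> conf H'"
      using less.hyps[of H'] less.prems by (auto simp: H'_def)
    have "\<zeta>(a := b, b := a) \<in> conf H"
      using z a b confD[OF z]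
      by (auto simp: conf_def PiE_iff extensional_def H'_def)
    then show ?thesis by auto
  qed
qed

text \<open>
  Rewiring is reversible: \<open>(\<xi>, y) \<mapsto> (switch x \<xi> y, \<xi> x)\<close> is an involution on the pairs of a
  configuration and a half-edge off the edge of \<open>x\<close>.
\<close>

lemma unif_conf_bind_rewire:
  assumes "finite H" "even (card H)" "card H \<ge> 3" "x \<in> H"
  shows "bind_pmf (pmf_of_set (conf H)) (rewire H x) = pmf_of_set (conf H)"
proof -
  let ?C = "conf H"
  let ?P = "Sigma ?C (\<lambda>\<xi>. H - {x, \<xi> x})"
  let ?f = "\<lambda>(\<xi>, y). (switch x \<xi> y, \<xi> x)"
  have fin: "finite ?C" "?C \<noteq> {}" using assms finite_conf conf_nonempty by auto
  have card: "card (H - {x, \<xi> x}) = card H - 2" if "\<xi> \<in> ?C" for \<xi>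
    using confD[OF that assms(4)] assms(1,4)
    by (subst card_Diff_subset) (auto simp: card_insert_if)
  have ne: "H - {x, \<xi> x} \<noteq> {}" if "\<xi> \<in> ?C" for \<xi>
    using card[OF that] assms(3) by (metis card.empty diff_is_0_eq not_less_eq_eq numeral_2_eq_2 numeral_3_eq_3)
  have finP: "finite ?P" "?P \<noteq> {}" using fin assms(1) ne by auto
  have pairs: "pmf_of_set ?P = bind_pmf (pmf_of_set ?C) (\<lambda>\<xi>. map_pmf (Pair \<xi>) (pmf_of_set (H - {x, \<xi> x})))"
  proof -
    have "?P = (\<Union>\<xi>\<in>?C. Pair \<xi> ` (H - {x, \<xi> x}))" by auto
    also have "pmf_of_set \<dots> = bind_pmf (pmf_of_set ?C) (\<lambda>\<xi>. pmf_of_set (Pair \<xi> ` (H - {x, \<xi> x})))"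
      by (rule pmf_of_set_UN[where n="card H - 2"])
        (use fin assms(1) ne card in \<open>auto simp: disjoint_family_on_def card_image inj_on_def\<close>)
    also have "\<dots> = bind_pmf (pmf_of_set ?C) (\<lambda>\<xi>. map_pmf (Pair \<xi>) (pmf_of_set (H - {x, \<xi> x})))"
      using fin ne assms(1)
      by (intro bind_pmf_cong refl) (auto simp: map_pmf_of_set_inj inj_on_def)
    finally show ?thesis .
  qed
  have inv: "?f p \<in> ?P \<and> ?f (?f p) = p" if pP: "p \<in> ?P" for p
  proof -
    obtain \<xi> y where p: "p = (\<xi>, y)" "\<xi> \<in> ?C" "y \<in> H" "y \<noteq> x" "y \<noteq> \<xi> x"
      using pP by auto
    note c = confD[OF p(2) assms(4)]
    show ?thesis
      using switch_conf[OF p(2) assms(4) p(3-5)] switch_switch[OF p(2) assms(4) p(3-5)]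
        switch_apply[OF p(2) assms(4) p(3-5)] c p by auto
  qed
  then have bij: "bij_betw ?f ?P ?P"
    by (intro bij_betw_byWitness[where f'="?f"]) auto
  have "bind_pmf (pmf_of_set ?C) (rewire H x)
      = bind_pmf (pmf_of_set ?C) (\<lambda>\<xi>. map_pmf (switch x \<xi>) (pmf_of_set (H - {x, \<xi> x})))"
    using fin by (intro bind_pmf_cong refl) (simp add: rewire_eq_map_switch[OF assms(1,3) _ assms(4)])
  also have "\<dots> = map_pmf fst (map_pmf ?f (pmf_of_set ?P))"
    unfolding pairs by (simp add: map_bind_pmf pmf.map_comp o_def)
  also have "map_pmf ?f (pmf_of_set ?P) = pmf_of_set ?P"
    by (rule map_pmf_of_set_bij_betw[OF bij finP(2,1)])
  also have "map_pmf fst (pmf_of_set ?P) = pmf_of_set ?C"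
    unfolding pairs by (simp add: map_bind_pmf pmf.map_comp o_def bind_return_pmf' map_pmf_const)
  finally show ?thesis .
qed

text \<open>
  Given the values of a configuration on \<open>U\<close>, the partner of a half-edge \<open>b\<close> outside \<open>U\<close> is
  almost uniform. The bound comes from switching: every configuration with \<open>\<xi> b = w\<close> can be
  switched to at least \<open>card H - 2 * card U - 1\<close> configurations with the same values on \<open>U\<close>, and
  the original configuration can be read off the result.
\<close>

lemma partner_almost_uniform:
  fixes g :: "('h \<Rightarrow> 'h) \<Rightarrow> real"
  assumes fin: "finite H" and U: "U \<subseteq> H" "card U \<le> u" and b: "b \<in> H" "b \<notin> U"
    and w: "w \<in> H" "w \<notin> U"
    and g: "\<And>\<xi>. 0 \<le> g \<xi>"
    and g_U: "\<And>\<xi> \<zeta>. (\<And>h. h \<in> U \<Longrightarrow> \<xi> h = \<zeta> h) \<Longrightarrow> g \<xi> = g \<zeta>"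
  shows "(real (card H) - 2 * real u - 1) * (\<Sum>\<xi>\<in>conf H. if \<xi> b = w then g \<xi> else 0)
      \<le> (\<Sum>\<xi>\<in>conf H. g \<xi>)"
proof -
  let ?W = "{\<xi> \<in> conf H. \<xi> b = w}"
  define Y where "Y = (\<lambda>\<xi>. {y \<in> H - {b} - U. \<xi> y \<notin> U})"
  define f where "f = (\<lambda>(\<xi>, y). if y = \<xi> b then \<xi> else switch b \<xi> y)"
  have finU: "finite U" using U(1) fin by (rule finite_subset)
  have finC: "finite (conf H)" using fin by (rule finite_conf)
  have finY: "finite (Y \<xi>)" for \<xi> unfolding Y_def using fin by auto
  have cardY: "real (card H) - 2 * real u - 1 \<le> real (card (Y \<xi>))" if "\<xi> \<in> ?W" for \<xi>
  proof -
    have "H \<subseteq> insert b (Y \<xi> \<union> U \<union> \<xi> ` U)"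
    proof
      fix h assume "h \<in> H"
      moreover have "h \<in> \<xi> ` U" if "\<xi> h \<in> U"
        using that confD(3)[of \<xi> H h] \<open>h \<in> H\<close> \<open>\<xi> \<in> ?W\<close> by (metis (no_types, lifting) imageI mem_Collect_eq)
      ultimately show "h \<in> insert b (Y \<xi> \<union> U \<union> \<xi> ` U)" by (auto simp: Y_def)
    qed
    then have "card H \<le> card (insert b (Y \<xi> \<union> U \<union> \<xi> ` U))"
      by (intro card_mono) (auto simp: finY finU)
    also have "\<dots> \<le> 1 + (card (Y \<xi>) + card U + card U)"
      by (rule order_trans[OF card_insert_le_m1 ]) 
        (auto intro!: order_trans[OF card_Un_le] add_mono card_image_le finU)
    finally show ?thesis using U(2) by linarith
  qed
  have sw: "f (\<xi>, y) \<in> conf H \<and> g (f (\<xi>, y)) = g \<xi> \<and> f (\<xi>, y) b = y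
      \<and> \<xi> = (if y = w then f (\<xi>, y) else switch b (f (\<xi>, y)) w)"
    if "\<xi> \<in> ?W" "y \<in> Y \<xi>" for \<xi> y
  proof (cases "y = \<xi> b")
    case True
    then show ?thesis using that by (auto simp: f_def)
  next
    case False
    have C: "\<xi> \<in> conf H" and bw: "\<xi> b = w" and y: "y \<in> H" "y \<noteq> b" "y \<notin> U" "\<xi> y \<notin> U"
      using that by (auto simp: Y_def)
    note s = switch_apply[OF C b(1) y(1,2) False]
    have "switch b \<xi> y h = \<xi> h" if "h \<in> U" for h
      by (rule s(5)) (use that b w y bw in auto)
    then have "g (switch b \<xi> y) = g \<xi>" by (rule g_U)
    then show ?thesis
      using False switch_conf[OF C b(1) y(1,2) False] s(1) switch_switch[OF C b(1) y(1,2) False] bw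
      by (auto simp: f_def)
  qed
  then have sw_g: "g (f (\<xi>, y)) = g \<xi>" and sw_C: "f (\<xi>, y) \<in> conf H"
    if "\<xi> \<in> conf H" "\<xi> b = w" "y \<in> Y \<xi>" for \<xi> y
    using that by blast+
  have inj: "inj_on f (Sigma ?W Y)"
  proof (rule inj_onI)
    fix p q assume pq: "p \<in> Sigma ?W Y" "q \<in> Sigma ?W Y" "f p = f q"
    obtain \<xi> y \<zeta> z where p: "p = (\<xi>, y)" and q: "q = (\<zeta>, z)" by fastforce
    have "\<xi> \<in> ?W" "y \<in> Y \<xi>" "\<zeta> \<in> ?W" "z \<in> Y \<zeta>" using pq p q by auto
    from sw[OF this(1,2)] sw[OF this(3,4)] have 1: "f (\<xi>, y) b = y" "f (\<zeta>, z) b = z"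
      and 2: "\<xi> = (if y = w then f (\<xi>, y) else switch b (f (\<xi>, y)) w)"
        "\<zeta> = (if z = w then f (\<zeta>, z) else switch b (f (\<zeta>, z)) w)"
      by blast+
    have "f (\<xi>, y) = f (\<zeta>, z)" using pq(3) p q by simp
    with 1 have "y = z" by simp
    with 2 \<open>f (\<xi>, y) = f (\<zeta>, z)\<close> have "\<xi> = \<zeta>" by metis
    with \<open>y = z\<close> show "p = q" by (simp add: p q)
  qed
  have "(real (card H) - 2 * real u - 1) * (\<Sum>\<xi>\<in>conf H. if \<xi> b = w then g \<xi> else 0)
      = (\<Sum>\<xi>\<in>?W. (real (card H) - 2 * real u - 1) * g \<xi>)"
    by (simp add: sum.inter_filter[OF finC, symmetric] sum_distrib_left)
  also have "\<dots> \<le> (\<Sum>\<xi>\<in>?W. real (card (Y \<xi>)) * g \<xi>)"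
    by (intro sum_mono mult_right_mono cardY g)
  also have "\<dots> = (\<Sum>(\<xi>, y)\<in>Sigma ?W Y. g \<xi>)"
    using finC finY by (subst sum.Sigma[symmetric]) auto
  also have "\<dots> = (\<Sum>p\<in>Sigma ?W Y. g (f p))"
    by (intro sum.cong refl) (auto simp: sw_g)
  also have "\<dots> = (\<Sum>\<xi>\<in>f ` Sigma ?W Y. g \<xi>)"
    using sum.reindex[OF inj, of g] by simp
  also have "\<dots> \<le> (\<Sum>\<xi>\<in>conf H. g \<xi>)"
    by (rule sum_mono2) (use finC sw_C g in auto)
  finally show ?thesis .
qed

section \<open>Paths of the non-backtracking walk\<close>

locale half_edge_graph =
  fixes V :: "'v set" and d :: "'v \<Rightarrow> nat"
  assumes finite_V: "finite V" and V_ne: "V \<noteq> {}" and deg_ge_3: "\<And>v. v \<in> V \<Longrightarrow> 3 \<le> d v"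
    and even_H: "even (card (half_edges V d))"
begin

abbreviation "H \<equiv> half_edges V d"
abbreviation "N \<equiv> real (card (half_edges V d))"
abbreviation "C \<equiv> conf (half_edges V d)"
abbreviation "D \<equiv> deg_H d"
abbreviation "nb \<equiv> nb_prob V d"

definition sib :: "'v \<times> nat \<Rightarrow> ('v \<times> nat) set" where
  "sib a = {y \<in> H. siblings a y}"

lemma finite_H: "finite H"
  using finite_V by (rule finite_half_edges)

lemma H_deg: "a \<in> H \<Longrightarrow> fst a \<in> V" "a \<in> H \<Longrightarrow> 3 \<le> d (fst a)"
  using deg_ge_3 by (auto simp: half_edges_def)

lemma card_vertex: "v \<in> V \<Longrightarrow> card {a \<in> H. fst a = v} = d v"
proof -
  assume "v \<in> V"
  then have "{a \<in> H. fst a = v} = Pair v ` {..<d v}" by (auto simp: half_edges_def)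
  then show ?thesis by (simp add: card_image inj_on_def)
qed

lemma card_H_ge_3: "3 \<le> card H"
proof -
  obtain v where v: "v \<in> V" using V_ne by auto
  have "card {a \<in> H. fst a = v} \<le> card H" by (rule card_mono) (auto simp: finite_H)
  then show ?thesis using card_vertex[OF v] deg_ge_3[OF v] by simp
qed

lemma H_ne: "H \<noteq> {}"
  using card_H_ge_3 by auto

lemma N_pos: "0 < N"
  using card_H_ge_3 by linarith

lemma finite_C: "finite C" and C_ne: "C \<noteq> {}"
  using finite_conf[OF finite_H] conf_nonempty[OF finite_H even_H] by auto

lemma card_C_pos: "0 < real (card C)"
  using finite_C C_ne by (simp add: card_gt_0_iff)

lemma D_ge_2: "a \<in> H \<Longrightarrow> 2 \<le> D a"
  using H_deg(2)[of a] by (simp add: deg_H_def)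

lemma finite_sib: "finite (sib a)" and sib_subset: "sib a \<subseteq> H"
  using finite_H by (auto simp: sib_def)

lemma card_sib: "a \<in> H \<Longrightarrow> real (card (sib a)) = D a"
proof -
  assume a: "a \<in> H"
  have "sib a = {b \<in> H. fst b = fst a} - {a}" by (auto simp: sib_def siblings_def)
  then have "card (sib a) = d (fst a) - 1"
    using a H_deg(1)[OF a] finite_H by (simp add: card_vertex)
  then show ?thesis using H_deg(2)[OF a] by (simp add: deg_H_def of_nat_diff)
qed

lemma sibD: "b \<in> sib a \<Longrightarrow> b \<in> H \<and> b \<noteq> a \<and> fst b = fst a \<and> D b = D a"
  by (auto simp: sib_def siblings_def deg_H_def)

lemma sib_sym: "a \<in> H \<Longrightarrow> b \<in> H \<Longrightarrow> b \<in> sib a \<longleftrightarrow> a \<in> sib b"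
  by (auto simp: sib_def siblings_def)

lemma nb_eq: "nb \<xi> x y = (if y \<in> sib (\<xi> x) then 1 / D y else 0)"
  by (auto simp: nb_prob_def sib_def siblings_def)

lemma nb_eq':
  "\<xi> \<in> C \<Longrightarrow> x \<in> H \<Longrightarrow> y \<in> H \<Longrightarrow> nb \<xi> x y = (if \<xi> x \<in> sib y then 1 / D y else 0)"
  using confD(1)[of \<xi> H x] sib_sym[of "\<xi> x" y] by (simp add: nb_eq)

lemma nb_nonneg: "0 \<le> nb \<xi> x y"
  using D_ge_2[of y] sibD[of y "\<xi> x"] by (auto simp: nb_eq)

lemma nb_le: "y \<in> H \<Longrightarrow> nb \<xi> x y \<le> 1 / D y"
  using D_ge_2[of y] by (auto simp: nb_eq)

lemma sum_nb: "\<xi> \<in> C \<Longrightarrow> x \<in> H \<Longrightarrow> (\<Sum>y\<in>H. nb \<xi> x y) = 1"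
proof -
  assume "\<xi> \<in> C" "x \<in> H"
  then have x: "\<xi> x \<in> H" by (rule confD(1))
  have "(\<Sum>y\<in>H. nb \<xi> x y) = (\<Sum>y\<in>sib (\<xi> x). 1 / D (\<xi> x))"
    unfolding nb_eq
    by (rule sum.mono_neutral_cong_right) (use finite_H sib_subset sibD in auto)
  also have "\<dots> = 1" using D_ge_2[OF x] by (simp add: card_sib[OF x])
  finally show ?thesis .
qed

lemma sum_nb_left: "\<xi> \<in> C \<Longrightarrow> y \<in> H \<Longrightarrow> (\<Sum>x\<in>H. nb \<xi> x y) = 1"
proof -
  assume \<xi>: "\<xi> \<in> C" and y: "y \<in> H"
  have inv: "\<xi> h \<in> H \<and> \<xi> (\<xi> h) = h" if "h \<in> H" for h
    using confD[OF \<xi> that] by auto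
  have "(\<Sum>x\<in>H. nb \<xi> x y) = (\<Sum>x\<in>H. if \<xi> x \<in> sib y then 1 / D y else 0)"
    using \<xi> y by (intro sum.cong refl nb_eq')
  also have "\<dots> = (\<Sum>x\<in>H. if x \<in> sib y then 1 / D y else 0)"
    by (rule sum.reindex_bij_witness[of _ \<xi> \<xi>]) (use inv in auto)
  also have "\<dots> = (\<Sum>x\<in>sib y. 1 / D y)"
    by (rule sum.mono_neutral_cong_right) (use finite_H sib_subset in auto)
  also have "\<dots> = 1" using D_ge_2[OF y] by (simp add: card_sib[OF y])
  finally show ?thesis .
qed

lemma nb_step_pmf:
  assumes "\<xi> \<in> C" "x \<in> H"
  shows "pmf (nb_step V d \<xi> x) = nb \<xi> x" "nb_step V d \<xi> x = pmf_of_set (sib (\<xi> x))"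
    "set_pmf (nb_step V d \<xi> x) = sib (\<xi> x)"
proof -
  have x: "\<xi> x \<in> H" using assms by (rule confD(1))
  then have d2: "2 \<le> d (fst (\<xi> x))" using H_deg(2)[of "\<xi> x"] by simp
  show "pmf (nb_step V d \<xi> x) = nb \<xi> x" by (rule pmf_nb_step[of \<xi> x V d, OF x d2])
  show u: "nb_step V d \<xi> x = pmf_of_set (sib (\<xi> x))"
    unfolding sib_def by (rule nb_step_eq_pmf_of_set[of \<xi> x V d, OF x d2])
  have "sib (\<xi> x) \<noteq> {}" using card_sib[OF x] D_ge_2[OF x] by auto
  then show "set_pmf (nb_step V d \<xi> x) = sib (\<xi> x)" unfolding u by (simp add: finite_sib)
qed

primrec nbw :: "('v \<times> nat \<Rightarrow> 'v \<times> nat) \<Rightarrow> nat \<Rightarrow> 'v \<times> nat \<Rightarrow> ('v \<times> nat) pmf" where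
  "nbw \<xi> 0 x = return_pmf x"
| "nbw \<xi> (Suc t) x = bind_pmf (nb_step V d \<xi> x) (nbw \<xi> t)"

lemma nbw_Suc_right: "nbw \<xi> (Suc t) x = bind_pmf (nbw \<xi> t x) (nb_step V d \<xi>)"
proof (induction t arbitrary: x)
  case 0
  have "nbw \<xi> 0 = return_pmf" by (rule ext) simp
  then show ?case by (simp add: bind_return_pmf bind_return_pmf')
next
  case (Suc t)
  have "nbw \<xi> (Suc t) = (\<lambda>z. bind_pmf (nbw \<xi> t z) (nb_step V d \<xi>))"
    by (rule ext) (rule Suc.IH)
  then have "nbw \<xi> (Suc (Suc t)) x = bind_pmf (nb_step V d \<xi> x) (\<lambda>z. bind_pmf (nbw \<xi> t z) (nb_step V d \<xi>))"
    by (simp only: nbw.simps(2)[of \<xi> "Suc t" x])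
  then show ?case by (simp only: bind_assoc_pmf nbw.simps(2)[of \<xi> t x])
qed

lemma set_nbw: "\<xi> \<in> C \<Longrightarrow> x \<in> H \<Longrightarrow> set_pmf (nbw \<xi> t x) \<subseteq> H"
proof (induction t arbitrary: x)
  case (Suc t)
  then show ?case using nb_step_pmf(3)[OF Suc.prems] sib_subset[of "\<xi> x"] by fastforce
qed simp

text \<open>
  A path is listed backwards, from its end to its start \<open>x\<close>, so that the walk extends it at the
  head; \<open>path_prob \<xi> p\<close> is the probability that the walk on \<open>\<xi>\<close> follows it.
\<close>

primrec paths :: "'v \<times> nat \<Rightarrow> nat \<Rightarrow> ('v \<times> nat) list set" where
  "paths x 0 = {[x]}"
| "paths x (Suc t) = (\<lambda>(b, p). b # p) ` (H \<times> paths x t)"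

fun path_prob :: "('v \<times> nat \<Rightarrow> 'v \<times> nat) \<Rightarrow> ('v \<times> nat) list \<Rightarrow> real" where
  "path_prob \<xi> (b # a # p) = nb \<xi> a b * path_prob \<xi> (a # p)"
| "path_prob \<xi> [a] = 1"
| "path_prob \<xi> [] = 1"

definition simple :: "('v \<times> nat) list \<Rightarrow> bool" where
  "simple p \<longleftrightarrow> distinct (map fst p)"

lemma simple_Cons: "simple (b # p) \<longleftrightarrow> fst b \<notin> fst ` set p \<and> simple p"
  by (simp add: simple_def)

lemma finite_paths: "finite (paths x t)"
  by (induction t) (auto simp: finite_H)

lemma pathsD:
  assumes "p \<in> paths x t"
  shows "p \<noteq> []" "length p = Suc t" "x \<in> H \<Longrightarrow> set p \<subseteq> H"
proof -
  show "p \<noteq> []" "length p = Suc t" using assms by (induction t arbitrary: p) auto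
  show "set p \<subseteq> H" if "x \<in> H"
    using assms
  proof (induction t arbitrary: p)
    case (Suc t)
    then obtain b q where "p = b # q" "b \<in> H" "q \<in> paths x t" by auto
    with Suc.IH[of q] show ?case by simp
  qed (use that in simp)
qed

lemma card_set_tl_path: "p \<in> paths x t \<Longrightarrow> card (set (tl p)) \<le> t"
  using card_length[of "tl p"] pathsD(2)[of p x t] by simp

lemma sum_paths_Suc:
  fixes F :: "('v \<times> nat) list \<Rightarrow> real"
  shows "(\<Sum>p\<in>paths x (Suc t). F p) = (\<Sum>p\<in>paths x t. \<Sum>b\<in>H. F (b # p))"
proof -
  have "(\<Sum>p\<in>paths x (Suc t). F p) = (\<Sum>(b, p)\<in>H \<times> paths x t. F (b # p))"
    unfolding paths.simps by (subst sum.reindex) (auto simp: inj_on_def o_def case_prod_unfold)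
  also have "\<dots> = (\<Sum>b\<in>H. \<Sum>p\<in>paths x t. F (b # p))"
    by (simp add: sum.cartesian_product)
  also have "\<dots> = (\<Sum>p\<in>paths x t. \<Sum>b\<in>H. F (b # p))" by (rule sum.swap)
  finally show ?thesis .
qed

lemma path_prob_Cons: "p \<noteq> [] \<Longrightarrow> path_prob \<xi> (b # p) = nb \<xi> (hd p) b * path_prob \<xi> p"
  by (cases p) auto

lemma path_prob_nonneg: "0 \<le> path_prob \<xi> p"
  by (induction \<xi> p rule: path_prob.induct) (auto simp: nb_nonneg)

lemma path_prob_cong: "(\<And>h. h \<in> set (tl p) \<Longrightarrow> \<xi> h = \<zeta> h) \<Longrightarrow> path_prob \<xi> p = path_prob \<zeta> p"
  by (induction p rule: induct_list012) (auto simp: nb_prob_def)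

lemma path_prob_pos_step:
  "path_prob \<xi> p \<noteq> 0 \<Longrightarrow> Suc i < length p \<Longrightarrow> siblings (\<xi> (p ! Suc i)) (p ! i)"
proof (induction \<xi> p arbitrary: i rule: path_prob.induct)
  case (1 \<xi> b a p)
  then show ?case by (cases i) (auto simp: nb_prob_def split: if_splits)
qed auto

lemma sum_path_prob: "\<xi> \<in> C \<Longrightarrow> x \<in> H \<Longrightarrow> (\<Sum>p\<in>paths x t. path_prob \<xi> p) = 1"
proof (induction t)
  case (Suc t)
  have "(\<Sum>p\<in>paths x (Suc t). path_prob \<xi> p)
      = (\<Sum>p\<in>paths x t. (\<Sum>b\<in>H. nb \<xi> (hd p) b) * path_prob \<xi> p)"
    unfolding sum_paths_Suc sum_distrib_right
    by (intro sum.cong refl path_prob_Cons) (auto dest: pathsD)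
  also have "\<dots> = (\<Sum>p\<in>paths x t. path_prob \<xi> p)"
  proof (intro sum.cong refl)
    fix p assume "p \<in> paths x t"
    then have "hd p \<in> H" using pathsD[of p x t] Suc.prems(2) by (meson hd_in_set subsetD)
    then show "(\<Sum>b\<in>H. nb \<xi> (hd p) b) * path_prob \<xi> p = path_prob \<xi> p"
      using sum_nb[OF Suc.prems(1)] by simp
  qed
  finally show ?case using Suc by simp
qed simp

lemma pmf_nbw:
  "\<xi> \<in> C \<Longrightarrow> x \<in> H \<Longrightarrow> pmf (nbw \<xi> t x) y = (\<Sum>p\<in>paths x t. if hd p = y then path_prob \<xi> p else 0)"
proof (induction t arbitrary: y)
  case 0
  then show ?case by (auto simp: indicator_def)
next
  case (Suc t)
  have hdH: "hd p \<in> H" if "p \<in> paths x t" for p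
    using pathsD[OF that] Suc.prems(2) by (meson hd_in_set subsetD)
  have "pmf (nbw \<xi> (Suc t) x) y = (\<integral>z. nb \<xi> z y \<partial>measure_pmf (nbw \<xi> t x))"
    unfolding nbw_Suc_right pmf_bind
  proof (rule integral_cong_AE)
    show "AE z in measure_pmf (nbw \<xi> t x). pmf (nb_step V d \<xi> z) y = nb \<xi> z y"
      using set_nbw[OF Suc.prems, of t] nb_step_pmf(1)[OF Suc.prems(1)]
      by (simp add: AE_measure_pmf_iff) (metis subsetD)
  qed auto
  also have "\<dots> = (\<Sum>z\<in>H. nb \<xi> z y * pmf (nbw \<xi> t x) z)"
    by (rule integral_measure_pmf_real) (use set_nbw[OF Suc.prems, of t] finite_H in auto)
  also have "\<dots> = (\<Sum>p\<in>paths x t. \<Sum>z\<in>H. if hd p = z then nb \<xi> z y * path_prob \<xi> p else 0)"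
    unfolding Suc.IH[OF Suc.prems] sum_distrib_left
    by (subst sum.swap) (intro sum.cong refl, simp)
  also have "\<dots> = (\<Sum>p\<in>paths x t. nb \<xi> (hd p) y * path_prob \<xi> p)"
    by (intro sum.cong refl) (simp add: finite_H hdH)
  also have "\<dots> = (\<Sum>p\<in>paths x t. \<Sum>b\<in>H. if b = y then nb \<xi> (hd p) b * path_prob \<xi> p else 0)"
    by (intro sum.cong refl) (auto simp: finite_H nb_prob_def)
  also have "\<dots> = (\<Sum>p\<in>paths x (Suc t). if hd p = y then path_prob \<xi> p else 0)"
    unfolding sum_paths_Suc
    by (intro sum.cong refl) (auto dest: pathsD simp: path_prob_Cons)
  finally show ?case .
qed

end

section \<open>Annealed path probabilities\<close>

context half_edge_graph
begin

lemma hd_path_in_H: "x \<in> H \<Longrightarrow> p \<in> paths x t \<Longrightarrow> hd p \<in> H"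
  using pathsD[of p x t] by (meson hd_in_set subsetD)

lemma nb_eq_sum:
  "\<xi> \<in> C \<Longrightarrow> a \<in> H \<Longrightarrow> b \<in> H \<Longrightarrow> nb \<xi> a b = (\<Sum>w\<in>sib b. if \<xi> a = w then 1 / D b else 0)"
  by (simp add: nb_eq' finite_sib)

lemma simple_nth_eq:
  assumes "simple p" "i < length p" "j < length p" "fst (p ! i) = fst (p ! j)"
  shows "i = j"
  using assms nth_eq_iff_index_eq[of "map fst p" i j] by (simp add: simple_def)

lemma partner_of_head:
  assumes "x \<in> H" "p \<in> paths x t" "simple p" "w \<in> H" "w \<notin> set (tl p)"
  shows "(N - 2 * real t - 1) * (\<Sum>\<xi>\<in>C. if \<xi> (hd p) = w then path_prob \<xi> p else 0)
    \<le> (\<Sum>\<xi>\<in>C. path_prob \<xi> p)"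
proof (rule partner_almost_uniform)
  show "set (tl p) \<subseteq> H"
    using pathsD(1,3)[OF assms(2)] assms(1) by (cases p) auto
  show "hd p \<in> H" by (rule hd_path_in_H[OF assms(1,2)])
  show "hd p \<notin> set (tl p)"
    using assms(3) pathsD(1)[OF assms(2)] by (cases p) (auto simp: simple_def)
  show "path_prob \<xi> p = path_prob \<zeta> p" if "\<And>h. h \<in> set (tl p) \<Longrightarrow> \<xi> h = \<zeta> h" for \<xi> \<zeta>
    using that by (rule path_prob_cong)
  show "card (set (tl p)) \<le> t" by (rule card_set_tl_path[OF assms(2)])
qed (use assms(4,5) finite_H path_prob_nonneg in blast)+

text \<open>
  In order to leave through \<open>b\<close>, the walk must arrive at one of the \<open>D b\<close> siblings of \<open>b\<close>, none of
  which was met before. Each of them is the partner of \<open>hd p\<close> with probability about \<open>1 / N\<close>, and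
  then \<open>b\<close> is chosen with probability \<open>1 / D b\<close>.
\<close>

lemma path_prob_extend:
  assumes "x \<in> H" "p \<in> paths x t" "b \<in> H" "simple (b # p)"
  shows "(N - 2 * real t - 1) * (\<Sum>\<xi>\<in>C. path_prob \<xi> (b # p)) \<le> (\<Sum>\<xi>\<in>C. path_prob \<xi> p)"
proof -
  have hd: "hd p \<in> H" by (rule hd_path_in_H[OF assms(1,2)])
  have simple: "simple p" "fst b \<notin> fst ` set p" using assms(4) by (auto simp: simple_Cons)
  have w: "w \<in> H" "w \<notin> set (tl p)" if "w \<in> sib b" for w
    using sibD[OF that] simple(2) pathsD(1)[OF assms(2)] list.set_sel(2)[of p w]
      image_eqI[of "fst b" fst w "set p"] by auto
  have "(\<Sum>\<xi>\<in>C. path_prob \<xi> (b # p))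
      = (\<Sum>\<xi>\<in>C. \<Sum>w\<in>sib b. 1 / D b * (if \<xi> (hd p) = w then path_prob \<xi> p else 0))"
    using pathsD(1)[OF assms(2)] hd assms(3)
    by (intro sum.cong refl)
      (auto simp: path_prob_Cons nb_eq_sum sum_distrib_right simp del: sum.delta sum.delta' intro!: sum.cong)
  also have "\<dots> = (\<Sum>w\<in>sib b. 1 / D b * (\<Sum>\<xi>\<in>C. if \<xi> (hd p) = w then path_prob \<xi> p else 0))"
    by (subst sum.swap) (simp add: sum_distrib_left)
  finally have "(N - 2 * real t - 1) * (\<Sum>\<xi>\<in>C. path_prob \<xi> (b # p))
      = (\<Sum>w\<in>sib b. 1 / D b *
          ((N - 2 * real t - 1) * (\<Sum>\<xi>\<in>C. if \<xi> (hd p) = w then path_prob \<xi> p else 0)))"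
    by (simp add: sum_distrib_left mult.left_commute)
  also have "\<dots> \<le> (\<Sum>w\<in>sib b. 1 / D b * (\<Sum>\<xi>\<in>C. path_prob \<xi> p))"
    by (intro sum_mono mult_left_mono partner_of_head[OF assms(1,2) simple(1)] w)
      (use D_ge_2[OF assms(3)] in auto)
  also have "\<dots> = (\<Sum>\<xi>\<in>C. path_prob \<xi> p)"
    using D_ge_2[OF assms(3)] by (simp add: card_sib[OF assms(3)])
  finally show ?thesis .
qed

text \<open>
  Averaged over the configuration, a simple path is dominated by a sequence of independent
  uniform half-edges, up to a factor that is close to 1 as long as \<open>t * T\<close> is small compared with
  \<open>N\<close>.
\<close>

lemma simple_path_prob_le:
  assumes "x \<in> H" "p \<in> paths x t" "simple p" "t \<le> T" "2 * real T + 1 < N"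
  shows "(N - 2 * real T - 1) ^ t * (\<Sum>\<xi>\<in>C. path_prob \<xi> p) \<le> real (card C)"
  using assms(2-4)
proof (induction t arbitrary: p)
  case 0
  then show ?case by simp
next
  case (Suc t)
  then obtain b q where p: "p = b # q" and b: "b \<in> H" and q: "q \<in> paths x t" by auto
  have nn: "0 \<le> (\<Sum>\<xi>\<in>C. path_prob \<xi> p)" by (intro sum_nonneg path_prob_nonneg)
  have "(N - 2 * real T - 1) ^ Suc t * (\<Sum>\<xi>\<in>C. path_prob \<xi> p)
      \<le> (N - 2 * real T - 1) ^ t * ((N - 2 * real t - 1) * (\<Sum>\<xi>\<in>C. path_prob \<xi> p))"
    using Suc.prems(3) assms(5) nn unfolding power_Suc2 mult.assoc
    by (intro mult_left_mono mult_right_mono) auto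
  also have "\<dots> \<le> (N - 2 * real T - 1) ^ t * (\<Sum>\<xi>\<in>C. path_prob \<xi> q)"
    unfolding p using Suc.prems(2) assms(5)
    by (intro mult_left_mono path_prob_extend[OF assms(1) q b]) (auto simp: p)
  also have "\<dots> \<le> real (card C)"
    using Suc.prems p by (intro Suc.IH q) (auto simp: simple_Cons)
  finally show ?case .
qed

definition nonsimple_mass :: "('v \<times> nat \<Rightarrow> 'v \<times> nat) \<Rightarrow> 'v \<times> nat \<Rightarrow> nat \<Rightarrow> real" where
  "nonsimple_mass \<xi> x t = (\<Sum>p\<in>paths x t. if simple p then 0 else path_prob \<xi> p)"

lemma card_vertices_le:
  assumes "\<And>v. v \<in> V \<Longrightarrow> d v \<le> \<Delta>" "finite S" "S \<subseteq> V"
  shows "card {w \<in> H. fst w \<in> S} \<le> card S * \<Delta>"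
proof -
  have "{w \<in> H. fst w \<in> S} = (\<Union>v\<in>S. {w \<in> H. fst w = v})" by auto
  also have "card \<dots> \<le> (\<Sum>v\<in>S. card {w \<in> H. fst w = v})"
    by (rule card_UN_le[OF assms(2)])
  also have "\<dots> \<le> (\<Sum>v\<in>S. \<Delta>)"
    using assms(1,3) by (intro sum_mono) (auto simp: card_vertex subset_iff)
  finally show ?thesis by simp
qed

lemma sum_path_prob_Cons:
  assumes "\<xi> \<in> C" "x \<in> H" "p \<in> paths x t"
  shows "(\<Sum>b\<in>H. path_prob \<xi> (b # p)) = path_prob \<xi> p"
  using sum_nb[OF assms(1) hd_path_in_H[OF assms(2,3)]] pathsD(1)[OF assms(3)]
  by (simp add: path_prob_Cons sum_distrib_right[symmetric])

text \<open>
  A simple path loses this property only if its head is paired with a half-edge of one of the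
  at most \<open>Suc t\<close> vertices on it.
\<close>

lemma nonsimple_mass_Suc:
  assumes "x \<in> H" "\<And>v. v \<in> V \<Longrightarrow> d v \<le> \<Delta>" "2 * real t + 1 < N"
  shows "(\<Sum>\<xi>\<in>C. nonsimple_mass \<xi> x (Suc t))
    \<le> (\<Sum>\<xi>\<in>C. nonsimple_mass \<xi> x t)
      + real (Suc t) * real \<Delta> / (N - 2 * real t - 1) * real (card C)"
proof -
  define W where "W = (\<lambda>p :: ('v \<times> nat) list. {w \<in> H. fst w \<in> fst ` set p})"
  define R where "R = (\<lambda>\<xi> p. if simple p then (\<Sum>w\<in>W p. if \<xi> (hd p) = w then path_prob \<xi> p else 0) else 0)"
  have finW: "finite (W p)" for p unfolding W_def using finite_H by simp
  have cardW: "real (card (W p)) \<le> real (Suc t) * real \<Delta>" if "p \<in> paths x t" for p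
  proof -
    have "card (W p) \<le> card (fst ` set p) * \<Delta>"
      unfolding W_def using pathsD(3)[OF that assms(1)]
      by (intro card_vertices_le assms(2)) (auto simp: half_edges_def)
    also have "card (fst ` set p) \<le> Suc t"
      using card_image_le[of "set p" fst] card_length[of p] pathsD(2)[OF that] by simp
    finally have "card (W p) \<le> Suc t * \<Delta>" by simp
    then show ?thesis unfolding of_nat_mult[symmetric] of_nat_le_iff .
  qed
  have ext: "(\<Sum>b\<in>H. if simple (b # p) then 0 else path_prob \<xi> (b # p))
      \<le> (if simple p then 0 else path_prob \<xi> p) + R \<xi> p"
    if \<xi>: "\<xi> \<in> C" and p: "p \<in> paths x t" for \<xi> p
  proof (cases "simple p")
    case False
    then show ?thesis
      using sum_path_prob_Cons[OF \<xi> assms(1) p] by (simp add: simple_Cons R_def)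
  next
    case True
    have hd: "hd p \<in> H" by (rule hd_path_in_H[OF assms(1) p])
    show ?thesis
    proof (cases "\<xi> (hd p) \<in> W p")
      case T: True
      have "(\<Sum>b\<in>H. if simple (b # p) then 0 else path_prob \<xi> (b # p)) \<le> (\<Sum>b\<in>H. path_prob \<xi> (b # p))"
        by (rule sum_mono) (simp add: path_prob_nonneg)
      also have "\<dots> = R \<xi> p"
        using sum_path_prob_Cons[OF \<xi> assms(1) p] True T finW by (simp add: R_def)
      finally show ?thesis using True by simp
    next
      case F: False
      have "path_prob \<xi> (b # p) = 0" if "b \<in> H" "\<not> simple (b # p)" for b
      proof -
        have "fst b \<in> fst ` set p" using that(2) True by (simp add: simple_Cons)
        then have "b \<notin> sib (\<xi> (hd p))"
          using F sibD[of b "\<xi> (hd p)"] confD(1)[OF \<xi> hd] unfolding W_def by (metis (lifting) mem_Collect_eq)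
        then show ?thesis using pathsD(1)[OF p] by (simp add: path_prob_Cons nb_eq)
      qed
      then have "(\<Sum>b\<in>H. if simple (b # p) then 0 else path_prob \<xi> (b # p)) = 0"
        by (intro sum.neutral) auto
      then show ?thesis using True by (simp add: R_def sum_nonneg path_prob_nonneg)
    qed
  qed
  have one: "(\<Sum>\<xi>\<in>C. R \<xi> p) \<le> real (Suc t) * real \<Delta> / (N - 2 * real t - 1) * (\<Sum>\<xi>\<in>C. path_prob \<xi> p)"
    if p: "p \<in> paths x t" for p
  proof (cases "simple p")
    case False
    then show ?thesis using assms(3) by (simp add: R_def sum_nonneg path_prob_nonneg)
  next
    case True
    have w: "(\<Sum>\<xi>\<in>C. if \<xi> (hd p) = w then path_prob \<xi> p else 0)
        \<le> (\<Sum>\<xi>\<in>C. path_prob \<xi> p) / (N - 2 * real t - 1)" if "w \<in> W p" for w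
    proof (cases "w \<in> set (tl p)")
      case False
      then show ?thesis
        using partner_of_head[OF assms(1) p True, of w] that assms(3)
        by (simp add: W_def field_simps)
    next
      case T: True
      \<comment> \<open>Had the walk already left through \<open>w\<close>, it would have arrived at \<open>hd p\<close> itself and
          moved on to a sibling of it, so its vertex would occur twice on \<open>p\<close>.\<close>
      have "path_prob \<xi> p = 0" if \<xi>: "\<xi> \<in> C" and eq: "\<xi> (hd p) = w" for \<xi>
      proof (rule ccontr)
        assume ne: "path_prob \<xi> p \<noteq> 0"
        have p0: "p \<noteq> []" by (rule pathsD(1)[OF p])
        obtain i where i: "Suc i < length p" "p ! Suc i = w"
          using T p0 by (metis Nitpick.size_list_simp(2) Suc_mono in_set_conv_nth nth_tl)
        have "\<xi> w = hd p"
          using eq confD(3)[OF \<xi> hd_path_in_H[OF assms(1) p]] by simp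
        then have "siblings (p ! 0) (p ! i)"
          using path_prob_pos_step[OF ne i(1)] i(2) p0 by (simp add: hd_conv_nth)
        then have "p ! i \<noteq> p ! 0" "fst (p ! 0) = fst (p ! i)" by (auto simp: siblings_def)
        with simple_nth_eq[OF True, of 0 i] i(1) p0 show False by auto
      qed
      then have "(\<Sum>\<xi>\<in>C. if \<xi> (hd p) = w then path_prob \<xi> p else 0) = 0"
        by (intro sum.neutral) auto
      then show ?thesis using assms(3) by (simp add: sum_nonneg path_prob_nonneg)
    qed
    have "(\<Sum>\<xi>\<in>C. R \<xi> p) = (\<Sum>w\<in>W p. \<Sum>\<xi>\<in>C. if \<xi> (hd p) = w then path_prob \<xi> p else 0)"
      using True unfolding R_def by (simp only: if_True) (rule sum.swap)
    also have "\<dots> \<le> (\<Sum>w\<in>W p. (\<Sum>\<xi>\<in>C. path_prob \<xi> p) / (N - 2 * real t - 1))"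
      by (rule sum_mono) (rule w)
    also have "\<dots> = real (card (W p)) * ((\<Sum>\<xi>\<in>C. path_prob \<xi> p) / (N - 2 * real t - 1))"
      by simp
    also have "\<dots> \<le> (real (Suc t) * real \<Delta>) * ((\<Sum>\<xi>\<in>C. path_prob \<xi> p) / (N - 2 * real t - 1))"
      using assms(3) by (intro mult_right_mono cardW p) (auto intro!: divide_nonneg_nonneg sum_nonneg path_prob_nonneg)
    finally show ?thesis by (simp only: times_divide_eq_left times_divide_eq_right)
  qed
  have "(\<Sum>\<xi>\<in>C. nonsimple_mass \<xi> x (Suc t))
      \<le> (\<Sum>\<xi>\<in>C. \<Sum>p\<in>paths x t. (if simple p then 0 else path_prob \<xi> p) + R \<xi> p)"
    unfolding nonsimple_mass_def sum_paths_Suc by (intro sum_mono ext)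
  also have "\<dots> = (\<Sum>\<xi>\<in>C. nonsimple_mass \<xi> x t) + (\<Sum>p\<in>paths x t. \<Sum>\<xi>\<in>C. R \<xi> p)"
    by (simp add: nonsimple_mass_def sum.distrib) (rule sum.swap)
  also have "(\<Sum>p\<in>paths x t. \<Sum>\<xi>\<in>C. R \<xi> p)
      \<le> (\<Sum>p\<in>paths x t. real (Suc t) * real \<Delta> / (N - 2 * real t - 1) * (\<Sum>\<xi>\<in>C. path_prob \<xi> p))"
    by (rule sum_mono) (rule one)
  also have "\<dots> = real (Suc t) * real \<Delta> / (N - 2 * real t - 1) * (\<Sum>\<xi>\<in>C. \<Sum>p\<in>paths x t. path_prob \<xi> p)"
    by (subst sum.swap) (simp add: sum_distrib_left)
  also have "(\<Sum>\<xi>\<in>C. \<Sum>p\<in>paths x t. path_prob \<xi> p) = real (card C)"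
    using sum_path_prob[OF _ assms(1)] by simp
  finally show ?thesis by simp
qed

lemma nonsimple_mass_le:
  assumes "x \<in> H" "\<And>v. v \<in> V \<Longrightarrow> d v \<le> \<Delta>" "t \<le> T" "2 * real T + 1 < N"
  shows "(\<Sum>\<xi>\<in>C. nonsimple_mass \<xi> x t)
    \<le> real t * (real T * real \<Delta> / (N - 2 * real T - 1)) * real (card C)"
  using assms(3)
proof (induction t)
  case 0
  then show ?case by (simp add: nonsimple_mass_def simple_def)
next
  case (Suc t)
  have "(\<Sum>\<xi>\<in>C. nonsimple_mass \<xi> x (Suc t))
    \<le> (\<Sum>\<xi>\<in>C. nonsimple_mass \<xi> x t)
      + real (Suc t) * real \<Delta> / (N - 2 * real t - 1) * real (card C)"
    using Suc.prems assms(4) by (intro nonsimple_mass_Suc assms(1,2)) auto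
  also have "\<dots> \<le> real t * (real T * real \<Delta> / (N - 2 * real T - 1)) * real (card C)
      + real T * real \<Delta> / (N - 2 * real T - 1) * real (card C)"
    using Suc assms(4)
    by (intro add_mono mult_right_mono frac_le mult_mono) auto
  finally show ?case by (simp add: algebra_simps add_divide_distrib)
qed

subsection \<open>The weight of a typical path\<close>

text \<open>
  The last entry is the start, which the walk does not choose.
\<close>

definition log_weight :: "('v \<times> nat) list \<Rightarrow> real" where
  "log_weight p = sum_list (map (\<lambda>b. ln (D b)) (butlast p))"

lemma log_weight_Cons: "p \<noteq> [] \<Longrightarrow> log_weight (b # p) = ln (D b) + log_weight p"
  by (simp add: log_weight_def)

lemma path_prob_exp:
  "set p \<subseteq> H \<Longrightarrow> path_prob \<xi> p \<noteq> 0 \<Longrightarrow> path_prob \<xi> p = exp (- log_weight p)"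
proof (induction \<xi> p rule: path_prob.induct)
  case (1 \<xi> b a p)
  have "0 < D b" using D_ge_2[of b] 1(2) by auto
  then have "exp (- ln (D b)) = 1 / D b" by (simp add: exp_minus inverse_eq_divide)
  moreover have "nb \<xi> a b = 1 / D b" using 1(3) by (auto simp: nb_eq split: if_splits)
  moreover have "path_prob \<xi> (a # p) = exp (- log_weight (a # p))" using 1 by simp
  ultimately have "path_prob \<xi> (b # a # p) = exp (- ln (D b)) * exp (- log_weight (a # p))"
    by simp
  also have "\<dots> = exp (- log_weight (b # a # p))"
    unfolding exp_add[symmetric] by (simp add: log_weight_Cons)
  finally show ?case .
qed (auto simp: log_weight_def)

text \<open>
  Up to the number \<open>N ^ t\<close> of paths, this is the variance of a sum of \<open>t\<close> independent copies of
  \<open>ln (D b)\<close> with \<open>b\<close> uniform, which have mean \<open>lam1\<close> and variance \<open>lam 2\<close>.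
\<close>

lemma sum_log_weight_sq:
  "(\<Sum>p\<in>paths x t. (log_weight p - real t * lam1 V d)\<^sup>2) = real t * lam 2 V d * N ^ t"
proof (induction t)
  case 0
  then show ?case by (simp add: log_weight_def)
next
  case (Suc t)
  have card: "real (card (paths x t)) = N ^ t" for t
  proof (induction t)
    case (Suc t)
    have "card (paths x (Suc t)) = card (H \<times> paths x t)"
      unfolding paths.simps by (rule card_image) (auto simp: inj_on_def)
    then show ?case using Suc by (simp add: card_cartesian_product)
  qed simp
  define m where "m = lam1 V d"
  have u1: "(\<Sum>b\<in>H. ln (D b) - m) = 0"
    using N_pos by (simp add: sum_subtractf m_def lam1_def)
  have u2: "(\<Sum>b\<in>H. (ln (D b) - m)\<^sup>2) = N * lam 2 V d"
    using N_pos by (simp add: lam_def m_def)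
  have "(\<Sum>b\<in>H. (log_weight (b # p) - real (Suc t) * m)\<^sup>2)
      = N * lam 2 V d + N * (log_weight p - real t * m)\<^sup>2" if "p \<in> paths x t" for p
  proof -
    let ?s = "log_weight p - real t * m"
    have "(\<Sum>b\<in>H. (log_weight (b # p) - real (Suc t) * m)\<^sup>2)
        = (\<Sum>b\<in>H. (ln (D b) - m)\<^sup>2 + 2 * ?s * (ln (D b) - m) + ?s\<^sup>2)"
      using pathsD(1)[OF that]
      by (intro sum.cong refl) (simp add: log_weight_Cons power2_eq_square algebra_simps)
    also have "\<dots> = N * lam 2 V d + 2 * ?s * 0 + N * ?s\<^sup>2"
      unfolding sum.distrib sum_distrib_left[symmetric] u1 u2 by simp
    finally show ?thesis by simp
  qed
  then have "(\<Sum>p\<in>paths x (Suc t). (log_weight p - real (Suc t) * m)\<^sup>2)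
      = (\<Sum>p\<in>paths x t. N * lam 2 V d + N * (log_weight p - real t * m)\<^sup>2)"
    unfolding sum_paths_Suc by (rule sum.cong[OF refl])
  also have "\<dots> = N ^ t * (N * lam 2 V d) + N * (real t * lam 2 V d * N ^ t)"
    unfolding sum.distrib sum_distrib_left[symmetric] using Suc by (simp add: card m_def)
  finally show ?case by (simp add: m_def algebra_simps)
qed

text \<open>
  Chebyshev's inequality for the independent half-edges that dominate a simple path.
\<close>

lemma deviation_mass_le:
  assumes "x \<in> H" "0 < a" "2 * real t + 1 < N"
  shows "(\<Sum>\<xi>\<in>C. \<Sum>p\<in>paths x t.
      if simple p \<and> a \<le> \<bar>log_weight p - real t * lam1 V d\<bar> then path_prob \<xi> p else 0)
    \<le> (N / (N - 2 * real t - 1)) ^ t * (real t * lam 2 V d / a\<^sup>2) * real (card C)"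
proof -
  let ?s = "\<lambda>p. log_weight p - real t * lam1 V d"
  let ?M = "N - 2 * real t - 1"
  have M: "0 < ?M" using assms(3) by simp
  have one: "(\<Sum>\<xi>\<in>C. if simple p \<and> a \<le> \<bar>?s p\<bar> then path_prob \<xi> p else 0)
      \<le> (?s p)\<^sup>2 / a\<^sup>2 * (real (card C) / ?M ^ t)" if "p \<in> paths x t" for p
  proof (cases "simple p \<and> a \<le> \<bar>?s p\<bar>")
    case True
    have "?M ^ t * (\<Sum>\<xi>\<in>C. path_prob \<xi> p) \<le> real (card C)"
      using True by (intro simple_path_prob_le[OF assms(1) that]) (auto simp: assms(3))
    then have le: "(\<Sum>\<xi>\<in>C. path_prob \<xi> p) \<le> real (card C) / ?M ^ t"
      using M by (simp add: field_simps)
    have "a\<^sup>2 \<le> (?s p)\<^sup>2" using True assms(2) by (simp add: abs_le_square_iff[symmetric])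
    then have "1 \<le> (?s p)\<^sup>2 / a\<^sup>2" using assms(2) by simp
    then have "1 * (real (card C) / ?M ^ t) \<le> (?s p)\<^sup>2 / a\<^sup>2 * (real (card C) / ?M ^ t)"
      using M by (intro mult_right_mono) auto
    with le True show ?thesis by simp
  next
    case False
    then show ?thesis using M by auto
  qed
  have "(\<Sum>\<xi>\<in>C. \<Sum>p\<in>paths x t. if simple p \<and> a \<le> \<bar>?s p\<bar> then path_prob \<xi> p else 0)
      \<le> (\<Sum>p\<in>paths x t. (?s p)\<^sup>2 / a\<^sup>2 * (real (card C) / ?M ^ t))"
    by (subst sum.swap) (intro sum_mono one)
  also have "\<dots> = (N / ?M) ^ t * (real t * lam 2 V d / a\<^sup>2) * real (card C)"
    unfolding sum_distrib_right[symmetric] sum_divide_distrib[symmetric] sum_log_weight_sq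
    by (simp add: power_divide field_simps)
  finally show ?thesis .
qed

end

section \<open>Collisions of two walks and static mixing\<close>

context half_edge_graph
begin

text \<open>
  Let \<open>A\<close> be the path of one walk, and let \<open>B\<close> be the path of the other one up to the time when the
  first is at \<open>hd A'\<close>. If \<open>B\<close> ends elsewhere, the walks can both be at \<open>a\<close> one step later
  only if \<open>hd B\<close> is paired with a sibling of \<open>a\<close> other than the partner of \<open>hd A'\<close>. These are \<open>D a - 1\<close>
  half-edges, neither path has met them, and \<open>a\<close> is then chosen with probability \<open>1 / D a\<close>. The
  exact factor \<open>1 - 1 / D a\<close> is what makes the sum over merging times telescope.
\<close>

lemma merge_le:
  assumes x: "x \<in> H" and A: "A = r @ a # A'" "A \<in> paths x t" "simple A" and A': "A' \<in> paths x k"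
    and N: "4 * real t + 1 < N"
  shows "(N - 4 * real t - 1) * (\<Sum>\<xi>\<in>C. path_prob \<xi> A * (\<Sum>B\<in>paths x k.
        if simple (a # B) \<and> hd B \<noteq> hd A' then nb \<xi> (hd B) a * path_prob \<xi> B else 0))
    \<le> (1 - 1 / D a) * (\<Sum>\<xi>\<in>C. path_prob \<xi> A)"
proof -
  let ?M = "N - 4 * real t - 1"
  have A'_ne: "A' \<noteq> []" by (rule pathsD(1)[OF A'])
  have aH: "a \<in> H" and hA': "hd A' \<in> H"
    using pathsD(3)[OF A(2) x] hd_path_in_H[OF x A'] by (auto simp: A(1))
  have k: "k < t"
    using pathsD(2)[OF A(2)] pathsD(2)[OF A'] by (simp add: A(1))
  have nth: "A ! length r = a" "A ! Suc (length r) = hd A'" "Suc (length r) < length A"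
    using A'_ne by (simp_all add: A(1) nth_append hd_conv_nth)
  have D: "2 \<le> D a" by (rule D_ge_2[OF aH])
  have one: "?M * (\<Sum>\<xi>\<in>C. path_prob \<xi> A * (nb \<xi> (hd B) a * path_prob \<xi> B))
      \<le> (1 - 1 / D a) * (\<Sum>\<xi>\<in>C. path_prob \<xi> A * path_prob \<xi> B)"
    if B: "B \<in> paths x k" "simple (a # B)" "hd B \<noteq> hd A'" for B
  proof -
    define b where "b = hd B"
    define g where "g = (\<lambda>h \<xi>. if \<xi> (hd A') = h then path_prob \<xi> A * path_prob \<xi> B else 0)"
    have bH: "b \<in> H" unfolding b_def by (rule hd_path_in_H[OF x B(1)])
    have B_ne: "B \<noteq> []" by (rule pathsD(1)[OF B(1)])
    have simpB: "simple B" "fst a \<notin> fst ` set B" using B(2) by (auto simp: simple_Cons)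
    have g0: "0 \<le> g h \<xi>" for h \<xi> by (simp add: g_def path_prob_nonneg)
    have fresh: "?M * (\<Sum>\<xi>\<in>C. if \<xi> b = w then g h \<xi> else 0) \<le> (\<Sum>\<xi>\<in>C. g h \<xi>)"
      if w: "w \<in> sib a" for w h
    proof (cases "b \<in> set (tl A)")
      case True
      \<comment> \<open>Wherever \<open>A\<close> uses \<open>b\<close>, it continues at the vertex of \<open>w\<close>, which is that of \<open>a\<close>. As \<open>A\<close> is
          simple, \<open>b\<close> would be \<open>hd A'\<close>.\<close>
      have "path_prob \<xi> A = 0" if "\<xi> b = w" for \<xi>
      proof (rule ccontr)
        assume ne: "path_prob \<xi> A \<noteq> 0"
        have "A \<noteq> []" by (simp add: A(1))
        then obtain i where i: "Suc i < length A" "A ! Suc i = b"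
          using True by (metis Nitpick.size_list_simp(2) Suc_mono in_set_conv_nth nth_tl)
        have "siblings w (A ! i)" using path_prob_pos_step[OF ne i(1)] i(2) that by simp
        then have "fst (A ! i) = fst (A ! length r)"
          using sibD[OF w] nth(1) by (simp add: siblings_def)
        then have "i = length r" using simple_nth_eq[OF A(3), of i "length r"] i(1) nth(3) by simp
        then show False using i(2) nth(2) B(3) by (simp add: b_def)
      qed
      then have "(\<Sum>\<xi>\<in>C. if \<xi> b = w then g h \<xi> else 0) = 0"
        by (intro sum.neutral) (auto simp: g_def)
      then show ?thesis using g0 by (simp add: sum_nonneg)
    next
      case False
      let ?U = "set (tl A) \<union> set (tl B)"
      have UH: "?U \<subseteq> H"
        using pathsD(3)[OF A(2) x] pathsD(3)[OF B(1) x] list.set_sel(2)[of A] list.set_sel(2)[of B]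
          B_ne A(1) by blast
      have cU: "card ?U \<le> 2 * t"
        using card_Un_le[of "set (tl A)" "set (tl B)"] card_set_tl_path[OF A(2)]
          card_set_tl_path[OF B(1)] k by linarith
      have bU: "b \<notin> ?U"
        using False simpB(1) B_ne by (cases B) (auto simp: b_def simple_def)
      have wA: "w \<notin> set A"
      proof
        assume "w \<in> set A"
        then obtain i where "i < length A" "A ! i = w" by (auto simp: in_set_conv_nth)
        with sibD[OF w] nth simple_nth_eq[OF A(3), of i "length r"] show False by auto
      qed
      have wB: "w \<notin> set B" using sibD[OF w] simpB(2) by (metis imageI)
      have wU: "w \<notin> ?U"
        using wA wB list.set_sel(2)[of A w] list.set_sel(2)[of B w] B_ne A(1) by auto
      have dep: "g h \<xi> = g h \<zeta>" if "\<And>h. h \<in> ?U \<Longrightarrow> \<xi> h = \<zeta> h" for \<xi> \<zeta>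
      proof -
        have "hd A' \<in> set (tl A)" using A'_ne by (cases r) (auto simp: A(1))
        then have "\<xi> (hd A') = \<zeta> (hd A')" using that by auto
        moreover have "path_prob \<xi> A = path_prob \<zeta> A" "path_prob \<xi> B = path_prob \<zeta> B"
          using that by (auto intro!: path_prob_cong)
        ultimately show ?thesis by (simp add: g_def)
      qed
      have "(N - 2 * real (2 * t) - 1) * (\<Sum>\<xi>\<in>C. if \<xi> b = w then g h \<xi> else 0) \<le> (\<Sum>\<xi>\<in>C. g h \<xi>)"
        using sibD[OF w]
        by (intro partner_almost_uniform[OF finite_H UH cU bH bU _ wU g0 dep]) auto
      then show ?thesis by simp
    qed
    have split: "path_prob \<xi> A * (nb \<xi> b a * path_prob \<xi> B)
        \<le> (\<Sum>h\<in>sib a. \<Sum>w\<in>sib a - {h}. 1 / D a * (if \<xi> b = w then g h \<xi> else 0))" (is "_ \<le> ?R")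
      if \<xi>: "\<xi> \<in> C" for \<xi>
    proof (cases "path_prob \<xi> A \<noteq> 0 \<and> \<xi> b \<in> sib a")
      case True
      have "siblings (\<xi> (hd A')) a" using path_prob_pos_step[of \<xi> A "length r"] True nth by simp
      then have h: "\<xi> (hd A') \<in> sib a"
        using confD(1)[OF \<xi> hA'] by (auto simp: sib_def siblings_def)
      have "\<xi> b \<noteq> \<xi> (hd A')" using confD(3)[OF \<xi>] bH hA' B(3) by (metis b_def)
      then have w: "\<xi> b \<in> sib a - {\<xi> (hd A')}" using True by simp
      have "path_prob \<xi> A * (nb \<xi> b a * path_prob \<xi> B)
          = (\<Sum>w\<in>sib a - {\<xi> (hd A')}. 1 / D a * (if \<xi> b = w then g (\<xi> (hd A')) \<xi> else 0))"
        unfolding sum_distrib_left[symmetric]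
        using w True finite_sib[of a] bH aH \<xi> by (simp add: nb_eq' g_def)
      also have "\<dots> \<le> ?R"
        by (rule member_le_sum[OF h, where f="\<lambda>h. \<Sum>w\<in>sib a - {h}. 1 / D a * (if \<xi> b = w then g h \<xi> else 0)"])
          (use D g0 finite_sib in \<open>auto intro!: sum_nonneg\<close>)
      finally show ?thesis .
    next
      case False
      then have "path_prob \<xi> A * (nb \<xi> b a * path_prob \<xi> B) = 0"
        using nb_eq'[OF \<xi> bH aH] by auto
      also have "0 \<le> ?R" using D g0 by (intro sum_nonneg) auto
      finally show ?thesis .
    qed
    have "?M * (\<Sum>\<xi>\<in>C. path_prob \<xi> A * (nb \<xi> b a * path_prob \<xi> B))
        \<le> ?M * (\<Sum>\<xi>\<in>C. \<Sum>h\<in>sib a. \<Sum>w\<in>sib a - {h}. 1 / D a * (if \<xi> b = w then g h \<xi> else 0))"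
      using N by (intro mult_left_mono sum_mono split) auto
    also have "(\<Sum>\<xi>\<in>C. \<Sum>h\<in>sib a. \<Sum>w\<in>sib a - {h}. 1 / D a * (if \<xi> b = w then g h \<xi> else 0))
        = (\<Sum>h\<in>sib a. \<Sum>w\<in>sib a - {h}. 1 / D a * (\<Sum>\<xi>\<in>C. if \<xi> b = w then g h \<xi> else 0))"
      by (subst sum.swap, intro sum.cong refl, subst sum.swap) (simp add: sum_distrib_left)
    also have "?M * \<dots> = (\<Sum>h\<in>sib a. \<Sum>w\<in>sib a - {h}. 1 / D a * (?M * (\<Sum>\<xi>\<in>C. if \<xi> b = w then g h \<xi> else 0)))"
      by (simp only: sum_distrib_left mult.left_commute)
    also have "\<dots> \<le> (\<Sum>h\<in>sib a. \<Sum>w\<in>sib a - {h}. 1 / D a * (\<Sum>\<xi>\<in>C. g h \<xi>))"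
      using D by (intro sum_mono mult_left_mono fresh) auto
    also have "\<dots> = (\<Sum>h\<in>sib a. (1 - 1 / D a) * (\<Sum>\<xi>\<in>C. g h \<xi>))"
    proof (intro sum.cong refl)
      fix h assume h: "h \<in> sib a"
      have "0 < card (sib a)" using h finite_sib[of a] by (auto simp: card_gt_0_iff)
      then have "real (card (sib a - {h})) = D a - 1"
        using h finite_sib[of a] card_sib[OF aH] by (simp add: of_nat_diff Suc_le_eq)
      then show "(\<Sum>w\<in>sib a - {h}. 1 / D a * (\<Sum>\<xi>\<in>C. g h \<xi>)) = (1 - 1 / D a) * (\<Sum>\<xi>\<in>C. g h \<xi>)"
        unfolding sum_constant using D by (simp only:) (simp add: field_simps)
    qed
    also have "\<dots> = (1 - 1 / D a) * (\<Sum>\<xi>\<in>C. \<Sum>h\<in>sib a. g h \<xi>)"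
      unfolding sum_distrib_left[symmetric] by (rule arg_cong[OF sum.swap])
    also have "\<dots> \<le> (1 - 1 / D a) * (\<Sum>\<xi>\<in>C. path_prob \<xi> A * path_prob \<xi> B)"
      using D finite_sib[of a]
      by (intro mult_left_mono sum_mono) (auto simp: g_def path_prob_nonneg)
    finally show ?thesis by (simp only: b_def)
  qed
  have "?M * (\<Sum>\<xi>\<in>C. path_prob \<xi> A * (\<Sum>B\<in>paths x k.
        if simple (a # B) \<and> hd B \<noteq> hd A' then nb \<xi> (hd B) a * path_prob \<xi> B else 0))
      = (\<Sum>B\<in>paths x k. if simple (a # B) \<and> hd B \<noteq> hd A'
          then ?M * (\<Sum>\<xi>\<in>C. path_prob \<xi> A * (nb \<xi> (hd B) a * path_prob \<xi> B)) else 0)"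
  proof -
    have "(\<Sum>\<xi>\<in>C. path_prob \<xi> A * (\<Sum>B\<in>paths x k.
        if simple (a # B) \<and> hd B \<noteq> hd A' then nb \<xi> (hd B) a * path_prob \<xi> B else 0))
      = (\<Sum>B\<in>paths x k. \<Sum>\<xi>\<in>C. path_prob \<xi> A *
        (if simple (a # B) \<and> hd B \<noteq> hd A' then nb \<xi> (hd B) a * path_prob \<xi> B else 0))"
      unfolding sum_distrib_left by (rule sum.swap)
    also have "?M * \<dots> = (\<Sum>B\<in>paths x k. if simple (a # B) \<and> hd B \<noteq> hd A'
          then ?M * (\<Sum>\<xi>\<in>C. path_prob \<xi> A * (nb \<xi> (hd B) a * path_prob \<xi> B)) else 0)"
      unfolding sum_distrib_left by (intro sum.cong refl) auto
    finally show ?thesis .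
  qed
  also have "\<dots> \<le> (\<Sum>B\<in>paths x k. (1 - 1 / D a) * (\<Sum>\<xi>\<in>C. path_prob \<xi> A * path_prob \<xi> B))"
    using one D by (intro sum_mono) (auto intro!: mult_nonneg_nonneg sum_nonneg simp: path_prob_nonneg)
  also have "\<dots> = (1 - 1 / D a) * (\<Sum>\<xi>\<in>C. path_prob \<xi> A * (\<Sum>B\<in>paths x k. path_prob \<xi> B))"
    unfolding sum_distrib_left[symmetric, of "1 - 1 / D a"] by (subst sum.swap) (simp add: sum_distrib_left)
  also have "\<dots> = (1 - 1 / D a) * (\<Sum>\<xi>\<in>C. path_prob \<xi> A)"
    using sum_path_prob[OF _ x] by simp
  finally show ?thesis .
qed

text \<open>
  The probability that a walk from \<open>x\<close> meets the end of \<open>A\<close> at the same time, along a simple path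
  other than \<open>A\<close>.
\<close>

definition collisions :: "('v \<times> nat \<Rightarrow> 'v \<times> nat) \<Rightarrow> 'v \<times> nat \<Rightarrow> nat \<Rightarrow> ('v \<times> nat) list \<Rightarrow> real" where
  "collisions \<xi> x k A
    = (\<Sum>B\<in>paths x k. if simple B \<and> hd B = hd A \<and> B \<noteq> A then path_prob \<xi> B else 0)"

text \<open>
  Either the walks have met before and make the same choice \<open>a\<close>, which has probability \<open>1 / D a\<close>, or
  they merge at \<open>a\<close>. If \<open>\<kappa> = 1 / (N - 4 * t - 1)\<close> bounds the collisions one step earlier, the next bound
  is \<open>1 / D a * \<kappa> + (1 - 1 / D a) * \<kappa> = \<kappa>\<close>. The weight \<open>path_prob \<xi> (r @ A)\<close> stands for conditioning on
  the whole first path, so the suffix \<open>A\<close> can vary in the induction.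
\<close>

lemma collisions_le:
  assumes x: "x \<in> H" and N: "4 * real t + 1 < N"
    and "r @ A \<in> paths x t" "simple (r @ A)" "A \<in> paths x k"
  shows "(N - 4 * real t - 1) * (\<Sum>\<xi>\<in>C. path_prob \<xi> (r @ A) * collisions \<xi> x k A)
    \<le> (\<Sum>\<xi>\<in>C. path_prob \<xi> (r @ A))"
  using assms(3-5)
proof (induction k arbitrary: r A)
  case 0
  then show ?case by (simp add: collisions_def sum_nonneg path_prob_nonneg)
next
  case (Suc k)
  then obtain a A' where A: "A = a # A'" and a: "a \<in> H" and A': "A' \<in> paths x k" by auto
  let ?M = "N - 4 * real t - 1"
  let ?P = "r @ A"
  let ?m = "\<lambda>\<xi>. \<Sum>B\<in>paths x k.
        if simple (a # B) \<and> hd B \<noteq> hd A' then nb \<xi> (hd B) a * path_prob \<xi> B else 0"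
  have D: "2 \<le> D a" by (rule D_ge_2[OF a])
  have coll: "collisions \<xi> x (Suc k) A \<le> 1 / D a * collisions \<xi> x k A' + ?m \<xi>" for \<xi>
  proof -
    have "collisions \<xi> x (Suc k) A = (\<Sum>B\<in>paths x k. \<Sum>b\<in>H.
        if b = a then (if simple (a # B) \<and> B \<noteq> A' then path_prob \<xi> (a # B) else 0) else 0)"
      unfolding collisions_def sum_paths_Suc by (intro sum.cong refl) (auto simp: A)
    also have "\<dots> = (\<Sum>B\<in>paths x k. if simple (a # B) \<and> B \<noteq> A' then nb \<xi> (hd B) a * path_prob \<xi> B else 0)"
      using a finite_H by (intro sum.cong refl) (auto simp: path_prob_Cons dest: pathsD)
    also have "\<dots> \<le> (\<Sum>B\<in>paths x k.
        1 / D a * (if simple B \<and> hd B = hd A' \<and> B \<noteq> A' then path_prob \<xi> B else 0)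
        + (if simple (a # B) \<and> hd B \<noteq> hd A' then nb \<xi> (hd B) a * path_prob \<xi> B else 0))"
    proof (rule sum_mono)
      fix B
      have "nb \<xi> (hd B) a * path_prob \<xi> B \<le> 1 / D a * path_prob \<xi> B"
        by (intro mult_right_mono nb_le a path_prob_nonneg)
      moreover have "0 \<le> path_prob \<xi> B" by (rule path_prob_nonneg)
      ultimately show "(if simple (a # B) \<and> B \<noteq> A' then nb \<xi> (hd B) a * path_prob \<xi> B else 0)
        \<le> 1 / D a * (if simple B \<and> hd B = hd A' \<and> B \<noteq> A' then path_prob \<xi> B else 0)
        + (if simple (a # B) \<and> hd B \<noteq> hd A' then nb \<xi> (hd B) a * path_prob \<xi> B else 0)"
        using D by (auto simp: simple_Cons)
    qed
    also have "\<dots> = 1 / D a * collisions \<xi> x k A' + ?m \<xi>"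
      by (simp add: collisions_def sum.distrib sum_distrib_left)
    finally show ?thesis .
  qed
  have "?M * (\<Sum>\<xi>\<in>C. path_prob \<xi> ?P * collisions \<xi> x (Suc k) A)
      \<le> ?M * (\<Sum>\<xi>\<in>C. path_prob \<xi> ?P * (1 / D a * collisions \<xi> x k A' + ?m \<xi>))"
    using N by (intro mult_left_mono sum_mono coll path_prob_nonneg) auto
  also have "\<dots> = 1 / D a * (?M * (\<Sum>\<xi>\<in>C. path_prob \<xi> ?P * collisions \<xi> x k A'))
      + ?M * (\<Sum>\<xi>\<in>C. path_prob \<xi> ?P * ?m \<xi>)"
    by (simp add: distrib_left sum.distrib sum_distrib_left mult_ac)
  also have "\<dots> \<le> 1 / D a * (\<Sum>\<xi>\<in>C. path_prob \<xi> ?P) + (1 - 1 / D a) * (\<Sum>\<xi>\<in>C. path_prob \<xi> ?P)"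
  proof (intro add_mono mult_left_mono)
    show "?M * (\<Sum>\<xi>\<in>C. path_prob \<xi> ?P * collisions \<xi> x k A') \<le> (\<Sum>\<xi>\<in>C. path_prob \<xi> ?P)"
      using Suc.IH[of "r @ [a]" A'] Suc.prems A A' by simp
    show "?M * (\<Sum>\<xi>\<in>C. path_prob \<xi> ?P * ?m \<xi>) \<le> (1 - 1 / D a) * (\<Sum>\<xi>\<in>C. path_prob \<xi> ?P)"
      using Suc.prems by (intro merge_le[OF x _ _ _ A' N]) (auto simp: A)
  qed (use D in auto)
  also have "\<dots> = (\<Sum>\<xi>\<in>C. path_prob \<xi> ?P)" by (simp add: algebra_simps)
  finally show ?case .
qed

end

section \<open>The static walk before and after its cutoff\<close>

context half_edge_graph
begin

definition bad_mass :: "('v \<times> nat \<Rightarrow> 'v \<times> nat) \<Rightarrow> 'v \<times> nat \<Rightarrow> nat \<Rightarrow> real \<Rightarrow> real" where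
  "bad_mass \<xi> x t a = nonsimple_mass \<xi> x t
    + (\<Sum>p\<in>paths x t. if simple p \<and> a \<le> \<bar>log_weight p - real t * lam1 V d\<bar> then path_prob \<xi> p else 0)"

text \<open>
  A bound for the mean of \<^term>\<open>bad_mass\<close> if \<open>\<Delta>\<close> bounds the degrees: the first summand is for
  repeated vertices, the second one comes from Chebyshev's inequality.
\<close>

definition bad_bound :: "nat \<Rightarrow> nat \<Rightarrow> real \<Rightarrow> real" where
  "bad_bound \<Delta> t a = real t * (real t * real \<Delta> / (N - 2 * real t - 1))
    + (N / (N - 2 * real t - 1)) ^ t * (real t * lam 2 V d / a\<^sup>2)"

lemma sum_bad_mass_le:
  assumes "x \<in> H" "\<And>v. v \<in> V \<Longrightarrow> d v \<le> \<Delta>" "2 * real t + 1 < N" "0 < a"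
  shows "(\<Sum>\<xi>\<in>C. bad_mass \<xi> x t a) \<le> bad_bound \<Delta> t a * real (card C)"
  using nonsimple_mass_le[OF assms(1,2) order_refl assms(3)] deviation_mass_le[OF assms(1,4,3)]
  by (simp add: bad_mass_def bad_bound_def sum.distrib distrib_right)

lemma good_mass:
  assumes "\<xi> \<in> C" "x \<in> H"
  shows "(\<Sum>p\<in>paths x t. if simple p \<and> \<bar>log_weight p - real t * lam1 V d\<bar> < a then path_prob \<xi> p else 0)
    = 1 - bad_mass \<xi> x t a"
proof -
  have "1 = (\<Sum>p\<in>paths x t. path_prob \<xi> p)" by (rule sum_path_prob[OF assms, symmetric])
  also have "\<dots> = (\<Sum>p\<in>paths x t.
      (if simple p \<and> \<bar>log_weight p - real t * lam1 V d\<bar> < a then path_prob \<xi> p else 0)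
      + ((if simple p then 0 else path_prob \<xi> p)
      + (if simple p \<and> a \<le> \<bar>log_weight p - real t * lam1 V d\<bar> then path_prob \<xi> p else 0)))"
    by (intro sum.cong refl) auto
  finally show ?thesis by (simp add: sum.distrib bad_mass_def nonsimple_mass_def)
qed

text \<open>
  There are at most \<open>exp (t * lam1 + a)\<close> paths of probability at least \<open>exp (- (t * lam1 + a))\<close>, so a walk
  that takes one of them ends in a set of at most that size.
\<close>

lemma tv_dist_nbw_ge:
  assumes \<xi>: "\<xi> \<in> C" and x: "x \<in> H"
  shows "1 - tv_dist (nbw \<xi> t x) (pmf_of_set H) \<le> bad_mass \<xi> x t a + exp (real t * lam1 V d + a) / N"
proof -
  let ?good = "\<lambda>p. simple p \<and> \<bar>log_weight p - real t * lam1 V d\<bar> < a"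
  let ?m = "real t * lam1 V d"
  define G where "G = {p \<in> paths x t. ?good p \<and> path_prob \<xi> p \<noteq> 0}"
  define A where "A = hd ` G"
  have finG: "finite G" unfolding G_def using finite_paths by simp
  have "real (card G) * exp (- (?m + a)) = (\<Sum>p\<in>G. exp (- (?m + a)))" by simp
  also have "\<dots> \<le> (\<Sum>p\<in>G. path_prob \<xi> p)"
  proof (rule sum_mono)
    fix p assume "p \<in> G"
    then have "path_prob \<xi> p = exp (- log_weight p)" "log_weight p \<le> ?m + a"
      using path_prob_exp[of p \<xi>] pathsD(3)[of p x t] x by (auto simp: G_def)
    then show "exp (- (?m + a)) \<le> path_prob \<xi> p" by simp
  qed
  also have "\<dots> \<le> (\<Sum>p\<in>paths x t. path_prob \<xi> p)"
    by (rule sum_mono2) (auto simp: G_def finite_paths path_prob_nonneg)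
  also have "\<dots> = 1" by (rule sum_path_prob[OF \<xi> x])
  finally have "real (card G) / exp (?m + a) \<le> 1" by (simp only: exp_minus divide_inverse)
  then have "real (card G) \<le> exp (?m + a)" by (subst (asm) pos_divide_le_eq) auto
  moreover have "card A \<le> card G" unfolding A_def by (rule card_image_le[OF finG])
  ultimately have cardA: "real (card A) \<le> exp (?m + a)" by linarith
  have "1 - bad_mass \<xi> x t a = (\<Sum>p\<in>paths x t. if ?good p then path_prob \<xi> p else 0)"
    by (rule good_mass[OF \<xi> x, symmetric])
  also have "\<dots> \<le> (\<Sum>p\<in>paths x t. \<Sum>y\<in>A. if hd p = y then path_prob \<xi> p else 0)"
  proof (rule sum_mono)
    fix p assume "p \<in> paths x t"
    then show "(if ?good p then path_prob \<xi> p else 0) \<le> (\<Sum>y\<in>A. if hd p = y then path_prob \<xi> p else 0)"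
      using finG by (auto simp: A_def G_def path_prob_nonneg)
  qed
  also have "\<dots> = (\<Sum>y\<in>A. pmf (nbw \<xi> t x) y)"
    unfolding pmf_nbw[OF \<xi> x] by (rule sum.swap)
  also have "\<dots> = measure_pmf.prob (nbw \<xi> t x) A"
    using finG by (simp add: A_def measure_measure_pmf_finite)
  finally have P: "1 - bad_mass \<xi> x t a \<le> measure_pmf.prob (nbw \<xi> t x) A" .
  have "measure_pmf.prob (pmf_of_set H) A = real (card (H \<inter> A)) / N"
    by (rule measure_pmf_of_set[OF H_ne finite_H])
  also have "\<dots> \<le> exp (?m + a) / N"
  proof (intro divide_right_mono)
    have "card (H \<inter> A) \<le> card A" by (rule card_mono) (auto simp: A_def finG)
    with cardA show "real (card (H \<inter> A)) \<le> exp (?m + a)" by linarith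
  qed simp
  finally show ?thesis using P tv_dist_ge[of "nbw \<xi> t x" A "pmf_of_set H"] by linarith
qed

text \<open>
  The second moment method for \<open>Q \<xi> y\<close>, the probability of reaching \<open>y\<close> along a typical path: its
  sum over \<open>y\<close> is close to 1 by \<open>good_mass\<close>, and the sum of its squares is the probability
  that two walks meet, which is close to \<open>1 / N\<close>. The paths of the two walks coincide with
  probability at most \<open>exp (- (t * lam1 - a))\<close>, the largest probability of a typical path.
\<close>

lemma tv_dist_nbw_sq_le:
  assumes x: "x \<in> H" and Delta: "\<And>v. v \<in> V \<Longrightarrow> d v \<le> \<Delta>" and N: "4 * real t + 1 < N" and a: "0 < a"
  shows "(\<Sum>\<xi>\<in>C. (tv_dist (nbw \<xi> t x) (pmf_of_set H))\<^sup>2)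
    \<le> (N * exp (- (real t * lam1 V d - a)) + (N / (N - 4 * real t - 1) - 1) + 2 * bad_bound \<Delta> t a)
      * real (card C)"
proof -
  let ?L = "real t * lam1 V d - a"
  let ?good = "\<lambda>p. simple p \<and> \<bar>log_weight p - real t * lam1 V d\<bar> < a"
  let ?M = "N - 4 * real t - 1"
  define q where "q = (\<lambda>\<xi> p. if ?good p then path_prob \<xi> p else 0)"
  define Q where "Q = (\<lambda>\<xi> y. \<Sum>p\<in>paths x t. if hd p = y then q \<xi> p else 0)"
  have q0: "0 \<le> q \<xi> p" and qle: "q \<xi> p \<le> path_prob \<xi> p" for \<xi> p
    by (auto simp: q_def path_prob_nonneg)
  have hdH: "hd p \<in> H" if "p \<in> paths x t" for p by (rule hd_path_in_H[OF x that])
  have sumQ: "(\<Sum>y\<in>H. Q \<xi> y) = 1 - bad_mass \<xi> x t a" if "\<xi> \<in> C" for \<xi>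
  proof -
    have "(\<Sum>y\<in>H. Q \<xi> y) = (\<Sum>p\<in>paths x t. \<Sum>y\<in>H. if hd p = y then q \<xi> p else 0)"
      unfolding Q_def by (rule sum.swap)
    also have "\<dots> = (\<Sum>p\<in>paths x t. q \<xi> p)"
      by (intro sum.cong refl) (simp add: finite_H hdH)
    finally show ?thesis using good_mass[OF that x] by (simp add: q_def)
  qed
  have tv: "(tv_dist (nbw \<xi> t x) (pmf_of_set H))\<^sup>2 \<le> 1 - 2 * (\<Sum>y\<in>H. Q \<xi> y) + N * (\<Sum>y\<in>H. (Q \<xi> y)\<^sup>2)"
    if \<xi>: "\<xi> \<in> C" for \<xi>
  proof -
    have "tv_dist (nbw \<xi> t x) (pmf_of_set H) \<le> (\<Sum>y\<in>H. \<bar>1 / N - Q \<xi> y\<bar>)"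
    proof (rule tv_dist_unif_le[OF finite_H H_ne set_nbw[OF \<xi> x]])
      fix y
      show "Q \<xi> y \<le> pmf (nbw \<xi> t x) y"
        unfolding Q_def pmf_nbw[OF \<xi> x] using qle by (intro sum_mono) auto
    qed
    then have "(tv_dist (nbw \<xi> t x) (pmf_of_set H))\<^sup>2 \<le> (\<Sum>y\<in>H. \<bar>1 / N - Q \<xi> y\<bar>)\<^sup>2"
      by (intro power_mono tv_dist_nonneg)
    also have "\<dots> \<le> (\<Sum>y\<in>H. \<bar>1 / N - Q \<xi> y\<bar>\<^sup>2) * N"
      by (rule sum_squared_le_sum_of_squares)
    also have "(\<Sum>y\<in>H. \<bar>1 / N - Q \<xi> y\<bar>\<^sup>2) = (\<Sum>y\<in>H. 1 / N\<^sup>2 - 2 / N * Q \<xi> y + (Q \<xi> y)\<^sup>2)"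
      by (intro sum.cong refl) (simp add: power2_diff power_divide)
    also have "\<dots> = 1 / N - 2 / N * (\<Sum>y\<in>H. Q \<xi> y) + (\<Sum>y\<in>H. (Q \<xi> y)\<^sup>2)"
      using N_pos by (simp add: sum.distrib sum_subtractf sum_distrib_left power2_eq_square)
    also have "\<dots> * N = 1 - 2 * (\<Sum>y\<in>H. Q \<xi> y) + N * (\<Sum>y\<in>H. (Q \<xi> y)\<^sup>2)"
      using N_pos by (simp add: field_simps)
    finally show ?thesis .
  qed
  have sq: "(\<Sum>y\<in>H. (Q \<xi> y)\<^sup>2)
      \<le> exp (- ?L) + (\<Sum>A\<in>paths x t. if simple A then path_prob \<xi> A * collisions \<xi> x t A else 0)"
    if \<xi>: "\<xi> \<in> C" for \<xi>
  proof -
    have "(\<Sum>y\<in>H. (Q \<xi> y)\<^sup>2) = (\<Sum>y\<in>H. \<Sum>A\<in>paths x t. if hd A = y then q \<xi> A * Q \<xi> y else 0)"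
    proof (rule sum.cong[OF refl])
      fix y
      have "(Q \<xi> y)\<^sup>2 = (\<Sum>A\<in>paths x t. if hd A = y then q \<xi> A else 0) * Q \<xi> y"
        by (simp add: power2_eq_square Q_def)
      also have "\<dots> = (\<Sum>A\<in>paths x t. if hd A = y then q \<xi> A * Q \<xi> y else 0)"
        unfolding sum_distrib_right by (intro sum.cong refl) auto
      finally show "(Q \<xi> y)\<^sup>2 = (\<Sum>A\<in>paths x t. if hd A = y then q \<xi> A * Q \<xi> y else 0)" .
    qed
    also have "\<dots> = (\<Sum>A\<in>paths x t. q \<xi> A * Q \<xi> (hd A))"
      by (subst sum.swap) (intro sum.cong refl, simp add: finite_H hdH)
    also have "\<dots> \<le> (\<Sum>A\<in>paths x t. exp (- ?L) * path_prob \<xi> A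
        + (if simple A then path_prob \<xi> A * collisions \<xi> x t A else 0))"
    proof (rule sum_mono)
      fix A assume A: "A \<in> paths x t"
      have Q: "Q \<xi> (hd A) \<le> q \<xi> A + collisions \<xi> x t A"
      proof -
        have "Q \<xi> (hd A) \<le> (\<Sum>B\<in>paths x t. (if B = A then q \<xi> B else 0)
            + (if simple B \<and> hd B = hd A \<and> B \<noteq> A then path_prob \<xi> B else 0))"
          unfolding Q_def using q0 qle path_prob_nonneg by (intro sum_mono) (auto simp: q_def)
        then show ?thesis using A by (simp add: sum.distrib collisions_def finite_paths)
      qed
      have c0: "0 \<le> collisions \<xi> x t A"
        by (auto simp: collisions_def path_prob_nonneg intro!: sum_nonneg)
      show "q \<xi> A * Q \<xi> (hd A) \<le> exp (- ?L) * path_prob \<xi> A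
        + (if simple A then path_prob \<xi> A * collisions \<xi> x t A else 0)"
      proof (cases "?good A \<and> path_prob \<xi> A \<noteq> 0")
        case True
        then have "path_prob \<xi> A = exp (- log_weight A)" "?L \<le> log_weight A"
          using path_prob_exp[of A \<xi>] pathsD(3)[OF A x] by auto
        then have "q \<xi> A \<le> exp (- ?L)" using True by (simp add: q_def)
        have "q \<xi> A * Q \<xi> (hd A) \<le> path_prob \<xi> A * (q \<xi> A + collisions \<xi> x t A)"
          using Q True path_prob_nonneg[of \<xi> A] by (simp add: q_def mult_left_mono)
        also have "\<dots> \<le> path_prob \<xi> A * (exp (- ?L) + collisions \<xi> x t A)"
          using \<open>q \<xi> A \<le> exp (- ?L)\<close> by (intro mult_left_mono path_prob_nonneg) simp
        finally show ?thesis using True by (simp add: algebra_simps)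
      next
        case False
        then have "q \<xi> A = 0" by (auto simp: q_def)
        then show ?thesis using c0 path_prob_nonneg[of \<xi> A] by (simp del: exp_minus)
      qed
    qed
    also have "\<dots> = exp (- ?L) + (\<Sum>A\<in>paths x t. if simple A then path_prob \<xi> A * collisions \<xi> x t A else 0)"
      using sum_path_prob[OF \<xi> x, of t] by (simp only: sum.distrib sum_distrib_left[symmetric] mult_1_right)
    finally show ?thesis .
  qed
  have coll: "(\<Sum>\<xi>\<in>C. \<Sum>A\<in>paths x t. if simple A then path_prob \<xi> A * collisions \<xi> x t A else 0)
      \<le> real (card C) / ?M"
  proof -
    have "(\<Sum>\<xi>\<in>C. \<Sum>A\<in>paths x t. if simple A then path_prob \<xi> A * collisions \<xi> x t A else 0)
        \<le> (\<Sum>A\<in>paths x t. (\<Sum>\<xi>\<in>C. path_prob \<xi> A) / ?M)"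
    proof (subst sum.swap, rule sum_mono)
      fix A assume A: "A \<in> paths x t"
      show "(\<Sum>\<xi>\<in>C. if simple A then path_prob \<xi> A * collisions \<xi> x t A else 0)
          \<le> (\<Sum>\<xi>\<in>C. path_prob \<xi> A) / ?M"
      proof (cases "simple A")
        case True
        then show ?thesis using collisions_le[OF x N, of "[]" A t] A N by (simp add: field_simps)
      next
        case False
        then show ?thesis using N by (simp add: sum_nonneg path_prob_nonneg)
      qed
    qed
    also have "\<dots> = (\<Sum>\<xi>\<in>C. \<Sum>A\<in>paths x t. path_prob \<xi> A) / ?M"
      unfolding sum_divide_distrib[symmetric] by (subst sum.swap) simp
    also have "\<dots> = real (card C) / ?M" using sum_path_prob[OF _ x] by simp
    finally show ?thesis .
  qed
  have "(\<Sum>\<xi>\<in>C. (tv_dist (nbw \<xi> t x) (pmf_of_set H))\<^sup>2)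
      \<le> (\<Sum>\<xi>\<in>C. 1 - 2 * (1 - bad_mass \<xi> x t a) + N * (exp (- ?L)
        + (\<Sum>A\<in>paths x t. if simple A then path_prob \<xi> A * collisions \<xi> x t A else 0)))"
  proof (rule sum_mono)
    fix \<xi> assume \<xi>: "\<xi> \<in> C"
    have "N * (\<Sum>y\<in>H. (Q \<xi> y)\<^sup>2) \<le> N * (exp (- ?L)
        + (\<Sum>A\<in>paths x t. if simple A then path_prob \<xi> A * collisions \<xi> x t A else 0))"
      by (rule mult_left_mono[OF sq[OF \<xi>]]) simp
    then show "(tv_dist (nbw \<xi> t x) (pmf_of_set H))\<^sup>2 \<le> 1 - 2 * (1 - bad_mass \<xi> x t a) + N * (exp (- ?L)
        + (\<Sum>A\<in>paths x t. if simple A then path_prob \<xi> A * collisions \<xi> x t A else 0))"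
      unfolding sumQ[OF \<xi>, symmetric] by (intro order_trans[OF tv[OF \<xi>]] add_left_mono)
  qed
  also have "\<dots> = (N * exp (- ?L) - 1) * real (card C) + 2 * (\<Sum>\<xi>\<in>C. bad_mass \<xi> x t a)
      + N * (\<Sum>\<xi>\<in>C. \<Sum>A\<in>paths x t. if simple A then path_prob \<xi> A * collisions \<xi> x t A else 0)"
    unfolding distrib_left sum.distrib sum_subtractf sum_distrib_left[symmetric] right_diff_distrib
    by (simp add: algebra_simps)
  also have "\<dots> \<le> (N * exp (- ?L) - 1) * real (card C) + 2 * (bad_bound \<Delta> t a * real (card C))
      + N * (real (card C) / ?M)"
    using N by (intro add_mono mult_left_mono order_refl coll sum_bad_mass_le[OF x Delta _ a]) auto
  also have "\<dots> = (N * exp (- ?L) + (N / ?M - 1) + 2 * bad_bound \<Delta> t a) * real (card C)"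
    by (simp add: algebra_simps)
  finally show ?thesis .
qed

end

section \<open>Comparing the dynamic with the static walk\<close>

context half_edge_graph
begin

abbreviation "unif_H \<equiv> pmf_of_set (half_edges V d)"
abbreviation "states \<equiv> half_edges V d \<times> conf (half_edges V d)"

lemma set_unif_H: "set_pmf unif_H = H"
  using H_ne finite_H by simp

lemma unif_nb_step:
  assumes "\<xi> \<in> C"
  shows "bind_pmf unif_H (nb_step V d \<xi>) = unif_H"
proof (rule pmf_eqI)
  fix y
  have "pmf (bind_pmf unif_H (nb_step V d \<xi>)) y = (\<Sum>x\<in>H. nb \<xi> x y) / N"
    using nb_step_pmf(1)[OF assms] by (simp add: pmf_bind_pmf_of_set H_ne finite_H)
  also have "\<dots> = pmf unif_H y"
  proof (cases "y \<in> H")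
    case True
    then show ?thesis using sum_nb_left[OF assms] H_ne finite_H by simp
  next
    case False
    then show ?thesis using H_ne finite_H by (simp add: nb_prob_def)
  qed
  finally show "pmf (bind_pmf unif_H (nb_step V d \<xi>)) y = pmf unif_H y" .
qed

lemma unif_nbw: "\<xi> \<in> C \<Longrightarrow> bind_pmf unif_H (nbw \<xi> t) = unif_H"
proof (induction t)
  case 0
  have "nbw \<xi> 0 = return_pmf" by (rule ext) simp
  then show ?case by (simp add: bind_return_pmf')
next
  case (Suc t)
  have "nbw \<xi> (Suc t) = (\<lambda>x. bind_pmf (nb_step V d \<xi> x) (nbw \<xi> t))" by (rule ext) simp
  then have "bind_pmf unif_H (nbw \<xi> (Suc t)) = bind_pmf (bind_pmf unif_H (nb_step V d \<xi>)) (nbw \<xi> t)"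
    by (simp only: bind_assoc_pmf)
  then show ?case by (simp only: unif_nb_step[OF Suc.prems] Suc.IH[OF Suc.prems])
qed

lemma sum_prob_nbw:
  assumes "\<xi> \<in> C"
  shows "(\<Sum>y\<in>H. measure_pmf.prob (nbw \<xi> t y) A) = N * measure_pmf.prob unif_H A"
proof -
  have "measure_pmf.prob unif_H A = (\<integral>y. measure_pmf.prob (nbw \<xi> t y) A \<partial>measure_pmf unif_H)"
    by (subst unif_nbw[OF assms, of t, symmetric]) (rule prob_bind_pmf)
  also have "\<dots> = (\<Sum>y\<in>H. measure_pmf.prob (nbw \<xi> t y) A) / N"
    by (rule integral_pmf_of_set[OF H_ne finite_H])
  finally show ?thesis using N_pos by simp
qed

lemma sum_conf_reindex: "\<xi> \<in> C \<Longrightarrow> (\<Sum>y\<in>H. F (\<xi> y)) = (\<Sum>y\<in>H. F y)" for F :: "'v \<times> nat \<Rightarrow> real"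
  by (rule sum.reindex_bij_witness[of _ \<xi> \<xi>]) (auto dest: confD)

lemma finite_states: "finite states" and states_ne: "states \<noteq> {}"
  and card_states: "real (card states) = N * real (card C)"
  using finite_H finite_C H_ne C_ne by (auto simp: card_cartesian_product)

lemma unif_start_eq: "unif_start V d = pmf_of_set states"
proof (rule pmf_eqI)
  fix s
  show "pmf (unif_start V d) s = pmf (pmf_of_set states) s"
    unfolding unif_start_def using finite_H finite_C H_ne C_ne
    by (cases s) (auto simp: pmf_pair indicator_def card_cartesian_product)
qed

lemma unif_start_dyn_step:
  assumes "0 \<le> \<alpha>" "\<alpha> \<le> 1"
  shows "bind_pmf (unif_start V d) (dyn_step V d \<alpha>) = unif_start V d"
proof -
  let ?UC = "pmf_of_set C"
  let ?G = "\<lambda>x \<xi>. map_pmf (\<lambda>x'. (x', \<xi>)) (nb_step V d \<xi> x)"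
  have step: "dyn_step V d \<alpha> (x, \<xi>) = bind_pmf (bernoulli_pmf \<alpha>)
      (\<lambda>b. bind_pmf (if b then rewire H x \<xi> else return_pmf \<xi>) (?G x))" for x \<xi>
    by (simp add: dyn_step_def map_pmf_def)
  have rewired: "bind_pmf ?UC (\<lambda>\<xi>. dyn_step V d \<alpha> (x, \<xi>)) = bind_pmf ?UC (?G x)" if x: "x \<in> H" for x
  proof -
    have b: "bind_pmf ?UC (\<lambda>\<xi>. bind_pmf (if b then rewire H x \<xi> else return_pmf \<xi>) (?G x)) = bind_pmf ?UC (?G x)" for b
      using unif_conf_bind_rewire[OF finite_H even_H card_H_ge_3 x]
      by (cases b) (simp_all add: bind_return_pmf flip: bind_assoc_pmf)
    show ?thesis unfolding step by (subst bind_commute_pmf) (simp add: b)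
  qed
  have "bind_pmf (unif_start V d) (dyn_step V d \<alpha>)
      = bind_pmf unif_H (\<lambda>x. bind_pmf ?UC (\<lambda>\<xi>. dyn_step V d \<alpha> (x, \<xi>)))"
    by (simp add: unif_start_def pair_pmf_def bind_assoc_pmf bind_return_pmf)
  also have "\<dots> = bind_pmf unif_H (\<lambda>x. bind_pmf ?UC (?G x))"
    by (rule bind_pmf_cong[OF refl]) (simp add: set_unif_H rewired)
  also have "\<dots> = bind_pmf ?UC (\<lambda>\<xi>. bind_pmf unif_H (\<lambda>x. ?G x \<xi>))"
    by (rule bind_commute_pmf)
  also have "\<dots> = bind_pmf ?UC (\<lambda>\<xi>. map_pmf (\<lambda>x'. (x', \<xi>)) unif_H)"
    by (rule bind_pmf_cong[OF refl])
      (use finite_C C_ne in \<open>simp add: map_bind_pmf[symmetric] unif_nb_step\<close>)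
  also have "\<dots> = unif_start V d"
    unfolding unif_start_def pair_pmf_def map_pmf_def by (rule bind_commute_pmf)
  finally show ?thesis .
qed

lemma unif_start_dyn_law:
  assumes "0 \<le> \<alpha>" "\<alpha> \<le> 1"
  shows "bind_pmf (unif_start V d) (\<lambda>s. dyn_law V d \<alpha> s t) = unif_start V d"
proof (induction t)
  case 0
  then show ?case by (simp add: bind_return_pmf')
next
  case (Suc t)
  have "bind_pmf (unif_start V d) (\<lambda>s. dyn_law V d \<alpha> s (Suc t))
      = bind_pmf (bind_pmf (unif_start V d) (\<lambda>s. dyn_law V d \<alpha> s t)) (dyn_step V d \<alpha>)"
    by (simp add: bind_assoc_pmf)
  then show ?case using Suc unif_start_dyn_step[OF assms] by simp
qed

lemma set_dyn_law:
  assumes "s \<in> states"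
  shows "set_pmf (dyn_law V d \<alpha> s t) \<subseteq> states"
proof (induction t)
  case (Suc t)
  then show ?case
    using set_dyn_step_subset[OF finite_V, of d] deg_ge_3 by (fastforce simp: subset_iff)
qed (use assms in simp)

lemma sum_pmf_dyn_law:
  assumes "0 \<le> \<alpha>" "\<alpha> \<le> 1" "s' \<in> states"
  shows "(\<Sum>s\<in>states. pmf (dyn_law V d \<alpha> s t) s') = 1"
proof -
  have "pmf (unif_start V d) s' = pmf (bind_pmf (unif_start V d) (\<lambda>s. dyn_law V d \<alpha> s t)) s'"
    by (simp add: unif_start_dyn_law[OF assms(1,2)])
  then have "1 / real (card states) = (\<Sum>s\<in>states. pmf (dyn_law V d \<alpha> s t) s') / real (card states)"
    unfolding unif_start_eq using assms(3)
    by (simp add: pmf_bind_pmf_of_set finite_states states_ne pmf_of_set finite_H finite_C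
        H_ne C_ne del: card_cartesian_product)
  moreover have "real (card states) \<noteq> 0"
    using finite_states states_ne by (simp only: of_nat_eq_0_iff card_0_eq) auto
  ultimately show ?thesis by simp
qed

text \<open>The uniform law on the states is stationary.\<close>

lemma sum_expectation_dyn_law:
  fixes F :: "('v \<times> nat) \<times> ('v \<times> nat \<Rightarrow> 'v \<times> nat) \<Rightarrow> real"
  assumes "0 \<le> \<alpha>" "\<alpha> \<le> 1"
  shows "(\<Sum>s\<in>states. measure_pmf.expectation (dyn_law V d \<alpha> s t) F) = (\<Sum>s\<in>states. F s)"
proof -
  have "(\<Sum>s\<in>states. measure_pmf.expectation (dyn_law V d \<alpha> s t) F)
      = (\<Sum>s\<in>states. \<Sum>s'\<in>states. F s' * pmf (dyn_law V d \<alpha> s t) s')"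
    by (intro sum.cong refl integral_measure_pmf_real finite_states) (use set_dyn_law in blast)
  also have "\<dots> = (\<Sum>s'\<in>states. F s' * (\<Sum>s\<in>states. pmf (dyn_law V d \<alpha> s t) s'))"
    unfolding sum_distrib_left by (rule sum.swap)
  also have "\<dots> = (\<Sum>s'\<in>states. F s')"
    by (intro sum.cong refl) (simp only: sum_pmf_dyn_law[OF assms] mult_1_right)
  finally show ?thesis .
qed

text \<open>
  The law at time \<open>t\<close> of a walk on the fixed configuration \<open>\<xi>\<close> that jumps to a uniform half-edge
  with probability \<open>\<alpha>\<close> in each step: as the uniform distribution is stationary for the walk, only
  the event that there was no jump matters.
\<close>

definition jump_law :: "real \<Rightarrow> ('v \<times> nat) \<times> ('v \<times> nat \<Rightarrow> 'v \<times> nat) \<Rightarrow> nat \<Rightarrow> ('v \<times> nat) pmf" where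
  "jump_law \<alpha> s t = bind_pmf (bernoulli_pmf ((1 - \<alpha>) ^ t)) (\<lambda>b. if b then nbw (snd s) t (fst s) else unif_H)"

lemma prob_jump_law:
  assumes "0 \<le> \<alpha>" "\<alpha> \<le> 1"
  shows "measure_pmf.prob (jump_law \<alpha> s t) A
    = (1 - \<alpha>) ^ t * measure_pmf.prob (nbw (snd s) t (fst s)) A
      + (1 - (1 - \<alpha>) ^ t) * measure_pmf.prob unif_H A"
  using assms unfolding jump_law_def prob_bind_pmf
  by (subst integral_bernoulli_pmf) (auto intro!: power_le_one)

lemma tv_dist_scale:
  assumes "0 \<le> (c :: real)"
    and "\<And>A. measure_pmf.prob p A - measure_pmf.prob q A = c * (measure_pmf.prob p' A - measure_pmf.prob q' A)"
  shows "tv_dist p q = c * tv_dist p' q'"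
proof (rule antisym)
  show "tv_dist p q \<le> c * tv_dist p' q'"
    by (rule tv_dist_le) (simp only: assms(2) mult_left_mono[OF tv_dist_ge assms(1)])
  show "c * tv_dist p' q' \<le> tv_dist p q"
  proof (cases "c = 0")
    case True
    then show ?thesis by (simp add: tv_dist_nonneg)
  next
    case False
    then have c: "0 < c" using assms(1) by simp
    have "tv_dist p' q' \<le> tv_dist p q / c"
    proof (rule tv_dist_le)
      fix A
      show "measure_pmf.prob p' A - measure_pmf.prob q' A \<le> tv_dist p q / c"
        using c tv_dist_ge[of p A q] unfolding assms(2)[of A] by (simp add: field_simps)
    qed
    then show ?thesis using c by (simp add: field_simps)
  qed
qed

lemma tv_dist_jump_law:
  assumes "0 \<le> \<alpha>" "\<alpha> \<le> 1"
  shows "tv_dist (jump_law \<alpha> s t) unif_H = (1 - \<alpha>) ^ t * tv_dist (nbw (snd s) t (fst s)) unif_H"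
  by (rule tv_dist_scale) (use assms in \<open>auto simp: prob_jump_law algebra_simps\<close>)

text \<open>
  The walk on a configuration that is rewired at the start of the walk and then kept.
\<close>

definition rewired_law :: "('v \<times> nat) \<times> ('v \<times> nat \<Rightarrow> 'v \<times> nat) \<Rightarrow> nat \<Rightarrow> ('v \<times> nat) pmf" where
  "rewired_law s m = bind_pmf (rewire H (fst s) (snd s)) (\<lambda>\<xi>. nbw \<xi> m (fst s))"

text \<open>
  The jump walk and the walk with one dynamic step differ only if this step rewires. Then
  the former becomes uniform. A jump in the remaining \<open>m\<close> steps would make both uniform.
\<close>

lemma tv_dist_one_dyn_step:
  assumes "0 \<le> \<alpha>" "\<alpha> \<le> 1" "s \<in> states"
  shows "tv_dist (bind_pmf (dyn_step V d \<alpha> s) (\<lambda>s'. jump_law \<alpha> s' m)) (jump_law \<alpha> s (Suc m))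
    \<le> \<alpha> * tv_dist (rewired_law s (Suc m)) unif_H"
proof -
  obtain x \<xi> where s: "s = (x, \<xi>)" by (cases s)
  let ?c = "(1 - \<alpha>) ^ m"
  have pl: "measure_pmf.prob (bind_pmf (nb_step V d \<zeta> x) (\<lambda>x'. jump_law \<alpha> (x', \<zeta>) m)) A
      = ?c * measure_pmf.prob (nbw \<zeta> (Suc m) x) A + (1 - ?c) * measure_pmf.prob unif_H A" for \<zeta> A
    unfolding prob_bind_pmf prob_jump_law[OF assms(1,2)] nbw.simps
    by (subst Bochner_Integration.integral_add)
      (auto intro!: integrable_pmf_bounded[where B=1])
  have eq: "bind_pmf (dyn_step V d \<alpha> s) (\<lambda>s'. jump_law \<alpha> s' m) = bind_pmf (bernoulli_pmf \<alpha>) (\<lambda>b.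
      if b then bind_pmf (rewire H x \<xi>) (\<lambda>\<zeta>. bind_pmf (nb_step V d \<zeta> x) (\<lambda>x'. jump_law \<alpha> (x', \<zeta>) m))
      else bind_pmf (nb_step V d \<xi> x) (\<lambda>x'. jump_law \<alpha> (x', \<xi>) m))"
    unfolding s dyn_step_def by (simp add: bind_assoc_pmf bind_return_pmf) (intro bind_pmf_cong refl, simp add: bind_return_pmf)
  have rw: "measure_pmf.prob (bind_pmf (rewire H x \<xi>)
        (\<lambda>\<zeta>. bind_pmf (nb_step V d \<zeta> x) (\<lambda>x'. jump_law \<alpha> (x', \<zeta>) m))) A
      = ?c * measure_pmf.prob (rewired_law s (Suc m)) A + (1 - ?c) * measure_pmf.prob unif_H A" for A
    unfolding rewired_law_def s fst_conv snd_conv prob_bind_pmf[of "rewire H x \<xi>"] pl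
    by (subst Bochner_Integration.integral_add)
      (auto intro!: integrable_pmf_bounded[where B=1])
  have "tv_dist (bind_pmf (dyn_step V d \<alpha> s) (\<lambda>s'. jump_law \<alpha> s' m)) (jump_law \<alpha> s (Suc m))
      = \<alpha> * ?c * tv_dist (rewired_law s (Suc m)) unif_H"
  proof (rule tv_dist_scale)
    fix A
    show "measure_pmf.prob (bind_pmf (dyn_step V d \<alpha> s) (\<lambda>s'. jump_law \<alpha> s' m)) A
        - measure_pmf.prob (jump_law \<alpha> s (Suc m)) A
      = \<alpha> * ?c * (measure_pmf.prob (rewired_law s (Suc m)) A - measure_pmf.prob unif_H A)"
      unfolding eq prob_bind_pmf[of "bernoulli_pmf \<alpha>"] prob_jump_law[OF assms(1,2)]
      by (subst integral_bernoulli_pmf)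
        (use assms(1,2) in \<open>simp_all add: rw pl s algebra_simps del: nbw.simps\<close>)
  qed (use assms in auto)
  also have "\<dots> \<le> \<alpha> * tv_dist (rewired_law s (Suc m)) unif_H"
  proof (intro mult_right_mono tv_dist_nonneg)
    show "\<alpha> * ?c \<le> \<alpha>" using assms(1,2) by (intro mult_left_le power_le_one) auto
  qed
  finally show ?thesis .
qed

text \<open>
  The first step from \<open>y\<close> leads to a sibling of \<open>\<xi> y\<close>, so a later visit to \<open>y\<close> or \<open>\<xi> y\<close> repeats a
  vertex.
\<close>

lemma return_nonsimple:
  assumes "\<xi> \<in> C" "y \<in> H"
  shows "pmf (nbw \<xi> (Suc i) y) y + pmf (nbw \<xi> (Suc i) y) (\<xi> y) \<le> nonsimple_mass \<xi> y (Suc i)"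
proof -
  have last: "last p = y" if "p \<in> paths y t" for p t
    using that by (induction t arbitrary: p) (auto dest: pathsD(1))
  have ns: "hd p \<noteq> y \<and> hd p \<noteq> \<xi> y"
    if p: "p \<in> paths y (Suc i)" and s: "simple p" and ne: "path_prob \<xi> p \<noteq> 0" for p
  proof -
    have len: "length p = Suc (Suc i)" and p0: "p \<noteq> []" using pathsD[OF p] by auto
    have y: "p ! Suc i = y" using last[OF p] p0 len by (simp add: last_conv_nth)
    have sibl: "siblings (\<xi> y) (p ! i)" using path_prob_pos_step[OF ne, of i] len y by simp
    have "p ! 0 \<noteq> y" using simple_nth_eq[OF s, of 0 "Suc i"] len y by auto
    moreover have "p ! 0 \<noteq> \<xi> y"
      using simple_nth_eq[OF s, of 0 i] len sibl by (auto simp: siblings_def)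
    ultimately show ?thesis using p0 by (simp add: hd_conv_nth)
  qed
  have "pmf (nbw \<xi> (Suc i) y) y + pmf (nbw \<xi> (Suc i) y) (\<xi> y)
      = (\<Sum>p\<in>paths y (Suc i). (if hd p = y then path_prob \<xi> p else 0) + (if hd p = \<xi> y then path_prob \<xi> p else 0))"
    unfolding pmf_nbw[OF assms] by (rule sum.distrib[symmetric])
  also have "\<dots> \<le> nonsimple_mass \<xi> y (Suc i)"
    unfolding nonsimple_mass_def
  proof (rule sum_mono)
    fix p assume "p \<in> paths y (Suc i)"
    then show "(if hd p = y then path_prob \<xi> p else 0) + (if hd p = \<xi> y then path_prob \<xi> p else 0)
        \<le> (if simple p then 0 else path_prob \<xi> p)"
      using ns[of p] path_prob_nonneg[of \<xi> p] confD(2)[OF assms] by auto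
  qed
  finally show ?thesis .
qed

text \<open>
  After the rewiring the walk sits at a sibling of the uniform half-edge \<open>y\<close>. Until it meets one
  of the four half-edges that were rewired, it moves like the walk on \<open>\<xi>\<close> started from \<open>\<xi> y\<close>,
  which is uniform.
\<close>

lemma tv_dist_rewired_law:
  assumes x: "x \<in> H" and \<xi>: "\<xi> \<in> C"
  shows "tv_dist (rewired_law (x, \<xi>) (Suc m)) unif_H
    \<le> 2 / N + (\<Sum>y\<in>H. \<Sum>i<m. measure_pmf.prob (nbw \<xi> (Suc i) (\<xi> y)) {x, y, \<xi> x, \<xi> y}) / (N - 2)"
proof -
  let ?Y = "H - {x, \<xi> x}"
  let ?p = "\<lambda>y. nbw \<xi> (Suc m) (\<xi> y)"
  have cardY: "real (card ?Y) = N - 2"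
    using confD[OF \<xi> x] x finite_H card_H_ge_3 by (simp add: card_Diff_subset card_insert_if of_nat_diff)
  have Y: "finite ?Y" "?Y \<noteq> {}"
  proof -
    show "?Y \<noteq> {}"
    proof
      assume "?Y = {}"
      then show False using cardY card_H_ge_3 by (simp only: card.empty)
    qed
  qed (use finite_H in simp)
  have rl: "rewired_law (x, \<xi>) (Suc m) = bind_pmf (pmf_of_set ?Y) (\<lambda>y. nbw (switch x \<xi> y) (Suc m) x)"
    by (simp only: rewired_law_def fst_conv snd_conv rewire_eq_map_switch[OF finite_H card_H_ge_3 \<xi> x] bind_map_pmf)
  have one: "tv_dist (nbw (switch x \<xi> y) (Suc m) x) (?p y)
      \<le> (\<Sum>i<m. measure_pmf.prob (nbw \<xi> (Suc i) (\<xi> y)) {x, y, \<xi> x, \<xi> y})" if y: "y \<in> ?Y" for y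
  proof -
    let ?\<zeta> = "switch x \<xi> y" and ?Z = "{x, y, \<xi> x, \<xi> y}"
    have yH: "y \<in> H" "y \<noteq> x" "y \<noteq> \<xi> x" using y by auto
    note sw = switch_apply[OF \<xi> x yH] and c = confD[OF \<xi> yH(1)]
    have \<zeta>: "?\<zeta> \<in> C" by (rule switch_conf[OF \<xi> x yH])
    have first: "nb_step V d ?\<zeta> x = nb_step V d \<xi> (\<xi> y)"
      unfolding nb_step_pmf(2)[OF \<zeta> x] nb_step_pmf(2)[OF \<xi> c(1)] sw(1) c(3) ..
    have agree: "nb_step V d ?\<zeta> z = nb_step V d \<xi> z" if "z \<notin> ?Z" for z
      unfolding nb_step_def nb_prob_def using sw(5)[of z] that by auto
    have int: "integrable (measure_pmf p) (\<lambda>z. measure_pmf.prob (nbw \<xi> i z) ?Z)" for i p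
      by (rule integrable_pmf_bounded[where B=1]) simp
    have "tv_dist (nbw ?\<zeta> (Suc m) x) (?p y)
        \<le> (\<integral>z. tv_dist (nbw ?\<zeta> m z) (nbw \<xi> m z) \<partial>measure_pmf (nb_step V d \<xi> (\<xi> y)))"
      unfolding nbw.simps first by (rule tv_dist_bind)
    also have "\<dots> \<le> (\<integral>z. (\<Sum>i<m. measure_pmf.prob (nbw \<xi> i z) ?Z) \<partial>measure_pmf (nb_step V d \<xi> (\<xi> y)))"
    proof (rule integral_mono)
      show "tv_dist (nbw ?\<zeta> m z) (nbw \<xi> m z) \<le> (\<Sum>i<m. measure_pmf.prob (nbw \<xi> i z) ?Z)" for z
        by (rule tv_dist_kernels_agree[where k="nb_step V d ?\<zeta>" and k'="nb_step V d \<xi>"])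
          (simp_all add: agree)
    qed (auto intro!: int Bochner_Integration.integrable_sum
          integrable_pmf_bounded[where B=1 and f="\<lambda>z. tv_dist (nbw ?\<zeta> m z) (nbw \<xi> m z)"]
        simp: tv_dist_nonneg tv_dist_le_1)
    also have "\<dots> = (\<Sum>i<m. measure_pmf.prob (nbw \<xi> (Suc i) (\<xi> y)) ?Z)"
      by (simp add: prob_bind_pmf int)
    finally show ?thesis .
  qed
  have "tv_dist (rewired_law (x, \<xi>) (Suc m)) (bind_pmf (pmf_of_set ?Y) ?p)
      \<le> (\<integral>y. tv_dist (nbw (switch x \<xi> y) (Suc m) x) (?p y) \<partial>measure_pmf (pmf_of_set ?Y))"
    unfolding rl by (rule tv_dist_bind)
  also have "\<dots> = (\<Sum>y\<in>?Y. tv_dist (nbw (switch x \<xi> y) (Suc m) x) (?p y)) / (N - 2)"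
    by (simp only: integral_pmf_of_set[OF Y(2,1)] cardY)
  also have "\<dots> \<le> (\<Sum>y\<in>?Y. \<Sum>i<m. measure_pmf.prob (nbw \<xi> (Suc i) (\<xi> y)) {x, y, \<xi> x, \<xi> y}) / (N - 2)"
    using card_H_ge_3 by (intro divide_right_mono sum_mono one) auto
  also have "\<dots> \<le> (\<Sum>y\<in>H. \<Sum>i<m. measure_pmf.prob (nbw \<xi> (Suc i) (\<xi> y)) {x, y, \<xi> x, \<xi> y}) / (N - 2)"
    using card_H_ge_3 by (intro divide_right_mono sum_mono2) (auto simp: finite_H intro!: sum_nonneg)
  finally have 1: "tv_dist (rewired_law (x, \<xi>) (Suc m)) (bind_pmf (pmf_of_set ?Y) ?p) \<le> \<dots>" .
  \<comment> \<open>The half-edge \<open>y\<close> avoids only the two half-edges of the broken edge.\<close>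
  have 2: "tv_dist (bind_pmf (pmf_of_set ?Y) ?p) unif_H \<le> 2 / N"
  proof (rule tv_dist_le)
    fix A
    let ?f = "\<lambda>y. measure_pmf.prob (?p y) A"
    have f: "0 \<le> ?f y" "?f y \<le> 1" for y by simp_all
    let ?a = "\<Sum>y\<in>?Y. ?f y" and ?b = "\<Sum>y\<in>H. ?f y"
    have "?b = (\<Sum>y\<in>H. measure_pmf.prob (nbw \<xi> (Suc m) y) A)"
      by (rule sum_conf_reindex[OF \<xi>, of "\<lambda>y. measure_pmf.prob (nbw \<xi> (Suc m) y) A"])
    then have b: "measure_pmf.prob unif_H A = ?b / N"
      using sum_prob_nbw[OF \<xi>, of "Suc m" A] N_pos by simp
    have a: "measure_pmf.prob (bind_pmf (pmf_of_set ?Y) ?p) A = ?a / (N - 2)"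
      by (simp only: prob_bind_pmf integral_pmf_of_set[OF Y(2,1)] cardY)
    have ab: "?a \<le> ?b" by (rule sum_mono2) (auto simp: finite_H)
    have "?a \<le> (\<Sum>y\<in>?Y. 1)" by (rule sum_mono) simp
    then have a2: "?a \<le> N - 2" using cardY by simp
    have N2: "0 < N - 2" using card_H_ge_3 by simp
    have "?a / (N - 2) - ?b / N \<le> ?a / (N - 2) - ?a / N"
      using ab N_pos by (simp add: divide_right_mono)
    also have "\<dots> = ?a / (N - 2) * (2 / N)" using N2 N_pos by (simp add: field_simps)
    also have "\<dots> \<le> 1 * (2 / N)" using N2 N_pos a2 by (intro mult_right_mono) (auto simp: divide_le_eq)
    finally show "measure_pmf.prob (bind_pmf (pmf_of_set ?Y) ?p) A - measure_pmf.prob unif_H A \<le> 2 / N"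
      unfolding a b by simp
  qed
  show ?thesis using 1 2 tv_dist_triangle[of "rewired_law (x, \<xi>) (Suc m)" unif_H "bind_pmf (pmf_of_set ?Y) ?p"]
    by linarith
qed

text \<open>
  A bound for the mean over all states of the distance of \<^term>\<open>rewired_law\<close> from uniform after
  at most \<open>t\<close> further steps.
\<close>

definition rewiring_error :: "nat \<Rightarrow> nat \<Rightarrow> real" where
  "rewiring_error \<Delta> t = 2 / N
    + real t * (2 + N * (real t * (real t * real \<Delta> / (N - 2 * real t - 1)))) / (N - 2)"

text \<open>
  Of the four rewired half-edges, \<open>x\<close> and \<open>\<xi> x\<close> are uniform and independent of the walk from
  \<open>\<xi> y\<close>, so each is met with probability \<open>1 / N\<close> in each step. The other two are the start of the walk
  and its partner.
\<close>

lemma sum_tv_dist_rewired_law: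
  assumes Delta: "\<And>v. v \<in> V \<Longrightarrow> d v \<le> \<Delta>" and N: "2 * real t + 1 < N" and m: "m \<le> t"
  shows "(\<Sum>s\<in>states. tv_dist (rewired_law s (Suc m)) unif_H)
    \<le> rewiring_error \<Delta> t * real (card states)"
proof -
  let ?ns = "real t * (real t * real \<Delta> / (N - 2 * real t - 1))"
  have ns0: "0 \<le> ?ns" using N by simp
  let ?K = "real (card C)"
  have N2: "0 < N - 2" using card_H_ge_3 by simp
  have i: "(\<Sum>\<xi>\<in>C. \<Sum>x\<in>H. \<Sum>y\<in>H. measure_pmf.prob (nbw \<xi> (Suc i) (\<xi> y)) {x, y, \<xi> x, \<xi> y})
      \<le> (2 + N * ?ns) * (N * ?K)" if "i < m" for i
  proof -
    let ?p = "\<lambda>\<xi> y. pmf (nbw \<xi> (Suc i) y)"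
    have four: "measure_pmf.prob p {x, y, z, w} \<le> pmf p x + pmf p z + (pmf p w + pmf p y)"
      for p :: "('v \<times> nat) pmf" and x y z w
    proof -
      have "measure_pmf.prob p {x, y, z, w} = (\<Sum>h\<in>{x, y, z, w}. pmf p h)"
        by (simp add: measure_measure_pmf_finite)
      also have "\<dots> \<le> pmf p x + pmf p z + (pmf p w + pmf p y)"
        by (auto simp: sum.insert_if add_nonneg_nonneg add.commute add.left_commute add.assoc)
      finally show ?thesis .
    qed
    have "(\<Sum>\<xi>\<in>C. \<Sum>x\<in>H. \<Sum>y\<in>H. measure_pmf.prob (nbw \<xi> (Suc i) (\<xi> y)) {x, y, \<xi> x, \<xi> y})
        \<le> (\<Sum>\<xi>\<in>C. \<Sum>y\<in>H. 2 + N * nonsimple_mass \<xi> y (Suc i))"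
    proof (rule sum_mono)
      fix \<xi> assume \<xi>: "\<xi> \<in> C"
      have p1: "(\<Sum>x\<in>H. ?p \<xi> y x) = 1" if "y \<in> H" for y
        using set_nbw[OF \<xi> that] by (rule sum_pmf_eq_1[OF finite_H])
      have "(\<Sum>x\<in>H. \<Sum>y\<in>H. measure_pmf.prob (nbw \<xi> (Suc i) (\<xi> y)) {x, y, \<xi> x, \<xi> y})
          \<le> (\<Sum>x\<in>H. \<Sum>y\<in>H. ?p \<xi> (\<xi> y) x + ?p \<xi> (\<xi> y) (\<xi> x) + (?p \<xi> (\<xi> y) (\<xi> y) + ?p \<xi> (\<xi> y) y))"
        by (intro sum_mono four)
      also have "\<dots> = (\<Sum>x\<in>H. \<Sum>y\<in>H. ?p \<xi> y x + ?p \<xi> y (\<xi> x) + (?p \<xi> y y + ?p \<xi> y (\<xi> y)))"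
      proof (rule sum.cong[OF refl])
        fix x
        show "(\<Sum>y\<in>H. ?p \<xi> (\<xi> y) x + ?p \<xi> (\<xi> y) (\<xi> x) + (?p \<xi> (\<xi> y) (\<xi> y) + ?p \<xi> (\<xi> y) y))
          = (\<Sum>y\<in>H. ?p \<xi> y x + ?p \<xi> y (\<xi> x) + (?p \<xi> y y + ?p \<xi> y (\<xi> y)))"
          by (rule sum.reindex_bij_witness[of _ \<xi> \<xi>]) (auto dest: confD[OF \<xi>])
      qed
      also have "\<dots> = (\<Sum>y\<in>H. (\<Sum>x\<in>H. ?p \<xi> y x) + (\<Sum>x\<in>H. ?p \<xi> y (\<xi> x)) + N * (?p \<xi> y y + ?p \<xi> y (\<xi> y)))"
        by (subst sum.swap) (simp add: sum.distrib)
      also have "\<dots> \<le> (\<Sum>y\<in>H. 2 + N * nonsimple_mass \<xi> y (Suc i))"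
      proof (rule sum_mono)
        fix y assume y: "y \<in> H"
        show "(\<Sum>x\<in>H. ?p \<xi> y x) + (\<Sum>x\<in>H. ?p \<xi> y (\<xi> x)) + N * (?p \<xi> y y + ?p \<xi> y (\<xi> y))
          \<le> 2 + N * nonsimple_mass \<xi> y (Suc i)"
          unfolding sum_conf_reindex[OF \<xi>, of "?p \<xi> y"] p1[OF y]
          using mult_left_mono[OF return_nonsimple[OF \<xi> y, of i], of N] by simp
      qed
      finally show "(\<Sum>x\<in>H. \<Sum>y\<in>H. measure_pmf.prob (nbw \<xi> (Suc i) (\<xi> y)) {x, y, \<xi> x, \<xi> y})
          \<le> (\<Sum>y\<in>H. 2 + N * nonsimple_mass \<xi> y (Suc i))" .
    qed
    also have "\<dots> = 2 * N * ?K + N * (\<Sum>y\<in>H. \<Sum>\<xi>\<in>C. nonsimple_mass \<xi> y (Suc i))"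
      by (subst sum.swap) (simp add: sum.distrib sum_distrib_left)
    also have "\<dots> \<le> 2 * N * ?K + N * (\<Sum>y\<in>H. ?ns * ?K)"
    proof (intro add_left_mono mult_left_mono sum_mono)
      fix y assume y: "y \<in> H"
      have "(\<Sum>\<xi>\<in>C. nonsimple_mass \<xi> y (Suc i))
          \<le> real (Suc i) * (real t * real \<Delta> / (N - 2 * real t - 1)) * ?K"
        using that m by (intro nonsimple_mass_le[OF y Delta _ N]) auto
      also have "\<dots> \<le> ?ns * ?K"
        using that m N by (intro mult_right_mono) auto
      finally show "(\<Sum>\<xi>\<in>C. nonsimple_mass \<xi> y (Suc i)) \<le> ?ns * ?K" .
    qed simp
    also have "\<dots> = (2 + N * ?ns) * (N * ?K)" by (simp add: algebra_simps)
    finally show ?thesis .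
  qed
  have "(\<Sum>s\<in>states. tv_dist (rewired_law s (Suc m)) unif_H)
      = (\<Sum>x\<in>H. \<Sum>\<xi>\<in>C. tv_dist (rewired_law (x, \<xi>) (Suc m)) unif_H)"
    by (simp add: sum.cartesian_product)
  also have "\<dots> \<le> (\<Sum>x\<in>H. \<Sum>\<xi>\<in>C. 2 / N
      + (\<Sum>y\<in>H. \<Sum>i<m. measure_pmf.prob (nbw \<xi> (Suc i) (\<xi> y)) {x, y, \<xi> x, \<xi> y}) / (N - 2))"
    by (intro sum_mono tv_dist_rewired_law)
  also have "\<dots> = 2 / N * (N * ?K)
      + (\<Sum>i<m. \<Sum>\<xi>\<in>C. \<Sum>x\<in>H. \<Sum>y\<in>H. measure_pmf.prob (nbw \<xi> (Suc i) (\<xi> y)) {x, y, \<xi> x, \<xi> y}) / (N - 2)"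
  proof -
    have "(\<Sum>x\<in>H. \<Sum>\<xi>\<in>C. \<Sum>y\<in>H. \<Sum>i<m. f i x \<xi> y) = (\<Sum>i<m. \<Sum>\<xi>\<in>C. \<Sum>x\<in>H. \<Sum>y\<in>H. f i x \<xi> y)"
      for f :: "nat \<Rightarrow> 'v \<times> nat \<Rightarrow> ('v \<times> nat \<Rightarrow> 'v \<times> nat) \<Rightarrow> 'v \<times> nat \<Rightarrow> real"
    proof -
      have "(\<Sum>x\<in>H. \<Sum>\<xi>\<in>C. \<Sum>y\<in>H. \<Sum>i<m. f i x \<xi> y) = (\<Sum>\<xi>\<in>C. \<Sum>x\<in>H. \<Sum>i<m. \<Sum>y\<in>H. f i x \<xi> y)"
        by (subst sum.swap) (intro sum.cong refl sum.swap)
      also have "\<dots> = (\<Sum>\<xi>\<in>C. \<Sum>i<m. \<Sum>x\<in>H. \<Sum>y\<in>H. f i x \<xi> y)"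
        by (intro sum.cong refl sum.swap)
      also have "\<dots> = (\<Sum>i<m. \<Sum>\<xi>\<in>C. \<Sum>x\<in>H. \<Sum>y\<in>H. f i x \<xi> y)" by (rule sum.swap)
      finally show ?thesis .
    qed
    then show ?thesis by (simp add: sum.distrib sum_divide_distrib[symmetric])
  qed
  also have "\<dots> \<le> 2 / N * (N * ?K) + (\<Sum>i<m. (2 + N * ?ns) * (N * ?K)) / (N - 2)"
    using N2 by (intro add_left_mono divide_right_mono sum_mono i) auto
  also have "\<dots> \<le> 2 / N * (N * ?K) + real t * ((2 + N * ?ns) * (N * ?K)) / (N - 2)"
  proof -
    have "0 \<le> (2 + N * ?ns) * (N * ?K)" 
      by (intro mult_nonneg_nonneg[of "2 + N * ?ns"] add_nonneg_nonneg mult_nonneg_nonneg[OF _ ns0]) auto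
    then show ?thesis
      unfolding sum_constant card_lessThan using N2 m
      by (intro add_left_mono divide_right_mono mult_right_mono) auto
  qed
  also have "\<dots> = rewiring_error \<Delta> t * real (card states)"
    unfolding card_states rewiring_error_def by (simp add: distrib_right mult.assoc)
  finally show ?thesis .
qed

text \<open>
  The walk that makes \<open>i\<close> dynamic steps and then moves like the jump walk interpolates between the
  two walks. Since the mean is over the stationary law, making one more dynamic step costs on
  average as much as making one at time 0.
\<close>

lemma dyn_static_comparison:
  assumes \<alpha>: "0 \<le> \<alpha>" "\<alpha> \<le> 1" and Delta: "\<And>v. v \<in> V \<Longrightarrow> d v \<le> \<Delta>" and N: "2 * real t + 1 < N"
  shows "(\<Sum>s\<in>states. \<bar>dyn_dist V d \<alpha> s t - (1 - \<alpha>) ^ t * tv_dist (nbw (snd s) t (fst s)) unif_H\<bar>)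
    \<le> \<alpha> * real t * rewiring_error \<Delta> t * real (card states)"
proof -
  define A where "A = (\<lambda>s i. bind_pmf (dyn_law V d \<alpha> s i) (\<lambda>s'. jump_law \<alpha> s' (t - i)))"
  define h where "h = (\<lambda>m s. tv_dist (bind_pmf (dyn_step V d \<alpha> s) (\<lambda>s'. jump_law \<alpha> s' m)) (jump_law \<alpha> s (Suc m)))"
  have bern1: "bernoulli_pmf 1 = return_pmf True"
    by (rule pmf_eqI) (auto simp: indicator_def pmf_bernoulli_True split: bool.splits intro: bool.exhaust)
  have A_t: "A s t = map_pmf fst (dyn_law V d \<alpha> s t)" for s
    by (simp add: A_def jump_law_def bern1 bind_return_pmf map_pmf_def)
  have A_0: "A s 0 = jump_law \<alpha> s t" for s by (simp add: A_def bind_return_pmf)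
  have tv: "tv_dist (A s k) (A s 0) \<le> (\<Sum>i<k. tv_dist (A s (Suc i)) (A s i))" for s k
  proof (induction k)
    case (Suc k)
    then show ?case using tv_dist_triangle[of "A s (Suc k)" "A s 0" "A s k"] by simp
  qed simp
  have step: "tv_dist (A s (Suc i)) (A s i) \<le> measure_pmf.expectation (dyn_law V d \<alpha> s i) (h (t - Suc i))"
    if "i < t" for s i
  proof -
    have "t - i = Suc (t - Suc i)" using that by simp
    then show ?thesis
      unfolding A_def h_def by (simp add: bind_assoc_pmf) (rule tv_dist_bind)
  qed
  have "(\<Sum>s\<in>states. \<bar>dyn_dist V d \<alpha> s t - (1 - \<alpha>) ^ t * tv_dist (nbw (snd s) t (fst s)) unif_H\<bar>)
      \<le> (\<Sum>s\<in>states. tv_dist (A s t) (A s 0))"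
    unfolding dyn_dist_def tv_dist_jump_law[OF \<alpha>, symmetric] A_t A_0
    by (intro sum_mono abs_tv_dist_diff)
  also have "\<dots> \<le> (\<Sum>s\<in>states. \<Sum>i<t. measure_pmf.expectation (dyn_law V d \<alpha> s i) (h (t - Suc i)))"
    by (intro sum_mono order_trans[OF tv]) (simp add: step)
  also have "\<dots> = (\<Sum>i<t. \<Sum>s\<in>states. h (t - Suc i) s)"
    by (subst sum.swap) (simp only: sum_expectation_dyn_law[OF \<alpha>])
  also have "\<dots> \<le> (\<Sum>i<t. \<alpha> * (rewiring_error \<Delta> t * real (card states)))"
  proof (rule sum_mono)
    fix i assume "i \<in> {..<t}"
    have "(\<Sum>s\<in>states. h (t - Suc i) s)
        \<le> (\<Sum>s\<in>states. \<alpha> * tv_dist (rewired_law s (Suc (t - Suc i))) unif_H)"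
      unfolding h_def by (intro sum_mono tv_dist_one_dyn_step \<alpha>)
    also have "\<dots> \<le> \<alpha> * (rewiring_error \<Delta> t * real (card states))"
      unfolding sum_distrib_left[symmetric]
      by (intro mult_left_mono sum_tv_dist_rewired_law Delta N \<alpha>) auto
    finally show "(\<Sum>s\<in>states. h (t - Suc i) s) \<le> \<alpha> * (rewiring_error \<Delta> t * real (card states))" .
  qed
  also have "\<dots> = \<alpha> * real t * rewiring_error \<Delta> t * real (card states)" by simp
  finally show ?thesis .
qed

end

section \<open>Mean distance to equilibrium\<close>

context half_edge_graph
begin

abbreviation "mean \<equiv> measure_pmf.expectation (unif_start V d)"

lemma mean_eq: "mean F = (\<Sum>s\<in>states. F s) / real (card states)"
  for F :: "('v \<times> nat) \<times> ('v \<times> nat \<Rightarrow> 'v \<times> nat) \<Rightarrow> real"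
  unfolding unif_start_eq by (rule integral_pmf_of_set[OF states_ne finite_states])

lemma card_states_pos: "0 < real (card states)"
  unfolding card_states using N_pos card_C_pos by (rule mult_pos_pos)

lemma sum_states: "(\<Sum>s\<in>states. F s) = (\<Sum>x\<in>H. \<Sum>\<xi>\<in>C. F (x, \<xi>))"
  for F :: "('v \<times> nat) \<times> ('v \<times> nat \<Rightarrow> 'v \<times> nat) \<Rightarrow> real"
  by (simp add: sum.cartesian_product)

lemma mean_le:
  assumes "(\<Sum>s\<in>states. F s) \<le> c * real (card states)"
  shows "mean F \<le> c"
  using assms card_states_pos unfolding mean_eq by (simp add: divide_le_eq)

abbreviation stat_dist :: "nat \<Rightarrow> ('v \<times> nat) \<times> ('v \<times> nat \<Rightarrow> 'v \<times> nat) \<Rightarrow> real" where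
  "stat_dist t s \<equiv> tv_dist (nbw (snd s) t (fst s)) unif_H"

lemma sum_stat_dist_ge:
  assumes Delta: "\<And>v. v \<in> V \<Longrightarrow> d v \<le> \<Delta>" and N: "2 * real t + 1 < N" and a: "0 < a"
  shows "(\<Sum>s\<in>states. 1 - stat_dist t s)
    \<le> (bad_bound \<Delta> t a + exp (real t * lam1 V d + a) / N) * real (card states)"
proof -
  let ?e = "exp (real t * lam1 V d + a) / N"
  have "(\<Sum>s\<in>states. 1 - stat_dist t s) = (\<Sum>x\<in>H. \<Sum>\<xi>\<in>C. 1 - tv_dist (nbw \<xi> t x) unif_H)"
    unfolding sum_states by simp
  also have "\<dots> \<le> (\<Sum>x\<in>H. \<Sum>\<xi>\<in>C. bad_mass \<xi> x t a + ?e)"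
    by (intro sum_mono tv_dist_nbw_ge)
  also have "\<dots> \<le> (\<Sum>x\<in>H. bad_bound \<Delta> t a * real (card C) + real (card C) * ?e)"
  proof (rule sum_mono)
    fix x assume "x \<in> H"
    from sum_bad_mass_le[OF this Delta N a]
    show "(\<Sum>\<xi>\<in>C. bad_mass \<xi> x t a + ?e) \<le> bad_bound \<Delta> t a * real (card C) + real (card C) * ?e"
      by (simp add: sum.distrib)
  qed
  also have "\<dots> = (bad_bound \<Delta> t a + ?e) * real (card states)"
    unfolding card_states by (simp add: algebra_simps)
  finally show ?thesis .
qed

text \<open>
  The bound of \<open>tv_dist_nbw_sq_le\<close> for the mean squared distance of the static walk from uniform.
\<close>

definition static_error :: "nat \<Rightarrow> nat \<Rightarrow> real \<Rightarrow> real" where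
  "static_error \<Delta> t a = N * exp (- (real t * lam1 V d - a))
    + (N / (N - 4 * real t - 1) - 1) + 2 * bad_bound \<Delta> t a"

lemma sum_stat_dist_le:
  assumes Delta: "\<And>v. v \<in> V \<Longrightarrow> d v \<le> \<Delta>" and N: "4 * real t + 1 < N" and a: "0 < a"
  shows "(\<Sum>s\<in>states. stat_dist t s) \<le> sqrt (static_error \<Delta> t a) * real (card states)"
proof -
  have "(\<Sum>s\<in>states. (stat_dist t s)\<^sup>2) \<le> (\<Sum>x\<in>H. static_error \<Delta> t a * real (card C))"
    unfolding sum_states static_error_def
    by (intro sum_mono) (use tv_dist_nbw_sq_le[OF _ Delta N a] in simp)
  also have "\<dots> = static_error \<Delta> t a * real (card states)"
    unfolding card_states by simp
  finally have sq: "(\<Sum>s\<in>states. (stat_dist t s)\<^sup>2) \<le> static_error \<Delta> t a * real (card states)" .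
  have "(\<Sum>s\<in>states. stat_dist t s)\<^sup>2 \<le> (\<Sum>s\<in>states. (stat_dist t s)\<^sup>2) * real (card states)"
    by (rule sum_squared_le_sum_of_squares)
  also have "\<dots> \<le> static_error \<Delta> t a * real (card states) * real (card states)"
    by (rule mult_right_mono[OF sq]) simp
  finally have "(\<Sum>s\<in>states. stat_dist t s) \<le> sqrt (static_error \<Delta> t a * (real (card states))\<^sup>2)"
    by (intro real_le_rsqrt) (simp add: power2_eq_square mult.assoc)
  also have "\<dots> = sqrt (static_error \<Delta> t a) * real (card states)"
    by (simp only: real_sqrt_mult real_sqrt_abs abs_of_nat)
  finally show ?thesis .
qed

lemma mean_dyn_dist_early:
  assumes \<alpha>: "0 \<le> \<alpha>" "\<alpha> \<le> 1" and Delta: "\<And>v. v \<in> V \<Longrightarrow> d v \<le> \<Delta>"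
    and N: "2 * real t + 1 < N" and a: "0 < a"
  shows "mean (\<lambda>s. \<bar>dyn_dist V d \<alpha> s t - l\<bar>)
    \<le> \<alpha> * real t * rewiring_error \<Delta> t + \<bar>(1 - \<alpha>) ^ t - l\<bar>
      + (bad_bound \<Delta> t a + exp (real t * lam1 V d + a) / N)"
proof (rule mean_le)
  let ?q = "(1 - \<alpha>) ^ t"
  have q: "0 \<le> ?q" "?q \<le> 1" using \<alpha> by (auto intro: power_le_one)
  have "(\<Sum>s\<in>states. \<bar>dyn_dist V d \<alpha> s t - l\<bar>)
      \<le> (\<Sum>s\<in>states. \<bar>dyn_dist V d \<alpha> s t - ?q * stat_dist t s\<bar> + (\<bar>?q - l\<bar> + (1 - stat_dist t s)))"
  proof (rule sum_mono)
    fix s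
    have "?q * (1 - stat_dist t s) \<le> 1 * (1 - stat_dist t s)"
      using q by (intro mult_right_mono) (simp_all add: tv_dist_le_1)
    moreover have "0 \<le> ?q * (1 - stat_dist t s)"
      using q by (intro mult_nonneg_nonneg) (simp_all add: tv_dist_le_1)
    ultimately have "\<bar>?q * stat_dist t s - ?q\<bar> \<le> 1 - stat_dist t s"
      by (simp add: right_diff_distrib abs_le_iff)
    then show "\<bar>dyn_dist V d \<alpha> s t - l\<bar>
        \<le> \<bar>dyn_dist V d \<alpha> s t - ?q * stat_dist t s\<bar> + (\<bar>?q - l\<bar> + (1 - stat_dist t s))"
      by linarith
  qed
  also have "\<dots> = (\<Sum>s\<in>states. \<bar>dyn_dist V d \<alpha> s t - ?q * stat_dist t s\<bar>)
      + (\<bar>?q - l\<bar> * real (card states) + (\<Sum>s\<in>states. 1 - stat_dist t s))"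
    by (simp only: sum.distrib sum_constant mult.commute)
  also have "\<dots> \<le> \<alpha> * real t * rewiring_error \<Delta> t * real (card states)
      + (\<bar>?q - l\<bar> * real (card states)
      + (bad_bound \<Delta> t a + exp (real t * lam1 V d + a) / N) * real (card states))"
    by (intro add_mono order_refl dyn_static_comparison[OF \<alpha> Delta N] sum_stat_dist_ge[OF Delta N a])
  finally show "(\<Sum>s\<in>states. \<bar>dyn_dist V d \<alpha> s t - l\<bar>)
      \<le> (\<alpha> * real t * rewiring_error \<Delta> t + \<bar>?q - l\<bar>
        + (bad_bound \<Delta> t a + exp (real t * lam1 V d + a) / N)) * real (card states)"
    by (simp only: distrib_right add.assoc)
qed

lemma mean_dyn_dist_late:
  assumes \<alpha>: "0 \<le> \<alpha>" "\<alpha> \<le> 1" and Delta: "\<And>v. v \<in> V \<Longrightarrow> d v \<le> \<Delta>"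
    and N: "4 * real t + 1 < N" and a: "0 < a"
  shows "mean (\<lambda>s. \<bar>dyn_dist V d \<alpha> s t - 0\<bar>)
    \<le> \<alpha> * real t * rewiring_error \<Delta> t + sqrt (static_error \<Delta> t a)"
proof (rule mean_le)
  let ?q = "(1 - \<alpha>) ^ t"
  have q: "0 \<le> ?q" "?q \<le> 1" using \<alpha> by (auto intro: power_le_one)
  have N': "2 * real t + 1 < N" using N by linarith
  have "(\<Sum>s\<in>states. \<bar>dyn_dist V d \<alpha> s t - 0\<bar>)
      \<le> (\<Sum>s\<in>states. \<bar>dyn_dist V d \<alpha> s t - ?q * stat_dist t s\<bar> + stat_dist t s)"
  proof (rule sum_mono)
    fix s
    have "?q * stat_dist t s \<le> 1 * stat_dist t s"
      using q by (intro mult_right_mono) (simp_all add: tv_dist_nonneg)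
    moreover have "0 \<le> ?q * stat_dist t s"
      using q by (intro mult_nonneg_nonneg) (simp_all add: tv_dist_nonneg)
    ultimately show "\<bar>dyn_dist V d \<alpha> s t - 0\<bar> \<le> \<bar>dyn_dist V d \<alpha> s t - ?q * stat_dist t s\<bar> + stat_dist t s"
      by linarith
  qed
  also have "\<dots> \<le> \<alpha> * real t * rewiring_error \<Delta> t * real (card states)
      + sqrt (static_error \<Delta> t a) * real (card states)"
    unfolding sum.distrib
    by (intro add_mono dyn_static_comparison[OF \<alpha> Delta N'] sum_stat_dist_le[OF Delta N a])
  finally show "(\<Sum>s\<in>states. \<bar>dyn_dist V d \<alpha> s t - 0\<bar>)
      \<le> (\<alpha> * real t * rewiring_error \<Delta> t + sqrt (static_error \<Delta> t a)) * real (card states)"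
    by (simp only: distrib_right)
qed

lemma lam2_le:
  assumes "\<And>v. v \<in> V \<Longrightarrow> d v \<le> \<Delta>"
  shows "lam 2 V d \<le> ln (real \<Delta>) * lam1 V d"
proof -
  define m where "m = lam1 V d"
  have S: "(\<Sum>z\<in>H. ln (D z)) = N * m" using N_pos by (simp add: m_def lam1_def)
  have "(\<Sum>z\<in>H. \<bar>ln (D z) - m\<bar> ^ 2) = (\<Sum>z\<in>H. (ln (D z))\<^sup>2 - 2 * m * ln (D z) + m\<^sup>2)"
    by (intro sum.cong refl) (simp add: power2_diff)
  also have "\<dots> = (\<Sum>z\<in>H. (ln (D z))\<^sup>2) - N * m\<^sup>2"
    unfolding sum.distrib sum_subtractf sum_distrib_left[symmetric] S by (simp add: power2_eq_square)
  also have "\<dots> \<le> (\<Sum>z\<in>H. (ln (D z))\<^sup>2)" by simp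
  also have "\<dots> \<le> (\<Sum>z\<in>H. ln (real \<Delta>) * ln (D z))"
  proof (rule sum_mono)
    fix z assume z: "z \<in> H"
    have "D z \<le> real \<Delta>" using assms[OF H_deg(1)[OF z]] by (simp add: deg_H_def)
    then have "ln (D z) \<le> ln (real \<Delta>)" "0 \<le> ln (D z)" using D_ge_2[OF z] by auto
    then show "(ln (D z))\<^sup>2 \<le> ln (real \<Delta>) * ln (D z)"
      by (simp add: power2_eq_square mult_right_mono)
  qed
  also have "\<dots> = ln (real \<Delta>) * (N * m)" by (simp add: sum_distrib_left[symmetric] S)
  finally show ?thesis using N_pos by (simp add: lam_def m_def[symmetric] divide_le_eq mult_ac)
qed

lemma nonsimple_bound:
  assumes "real t \<le> \<tau>" "4 * \<tau> + 2 \<le> N" "1 / N \<le> r" "real \<Delta> \<le> b"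
  shows "real t * (real t * real \<Delta> / (N - 2 * real t - 1)) \<le> 2 * \<tau>\<^sup>2 * b * r"
proof -
  have \<tau>: "0 \<le> \<tau>" using assms(1) of_nat_0_le_iff[of t] by linarith
  have h: "N / 2 \<le> N - 2 * real t - 1" using assms(1,2) by linarith
  have inv: "1 / (N - 2 * real t - 1) \<le> 2 * r"
  proof -
    have "1 / (N - 2 * real t - 1) \<le> 1 / (N / 2)" using h N_pos by (intro divide_left_mono) auto
    then show ?thesis using assms(3) by simp
  qed
  have "real t * (real t * real \<Delta> / (N - 2 * real t - 1))
      = (real t)\<^sup>2 * real \<Delta> * (1 / (N - 2 * real t - 1))"
    by (simp add: power2_eq_square)
  also have "\<dots> \<le> \<tau>\<^sup>2 * b * (2 * r)"
    using assms(1,4) \<tau> inv h N_pos by (intro mult_mono power_mono) auto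
  finally show ?thesis by (simp add: mult_ac)
qed

lemma bad_bound_le:
  assumes t: "real t \<le> \<tau>" and N: "4 * \<tau> + 2 \<le> N" "2 * \<tau> * (2 * \<tau> + 1) \<le> N" and r: "1 / N \<le> r"
    and b: "real \<Delta> \<le> b" and v: "lam 2 V d \<le> v" and a: "0 < a"
  shows "bad_bound \<Delta> t a \<le> 2 * \<tau>\<^sup>2 * b * r + 2 * (\<tau> * v / a\<^sup>2)"
proof -
  have \<tau>: "0 \<le> \<tau>" using t of_nat_0_le_iff[of t] by linarith
  have h: "N / 2 \<le> N - 2 * real t - 1" using t N(1) by linarith
  have lam0: "0 \<le> lam 2 V d" by (simp add: lam_def sum_nonneg)
  let ?u = "(2 * real t + 1) / N"
  have "?u \<le> (N / 2) / N" using h by (intro divide_right_mono) auto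
  then have u: "0 \<le> ?u" "?u \<le> 1 / 2" using N_pos by auto
  have "real t * (2 * real t + 1) \<le> \<tau> * (2 * \<tau> + 1)"
    using t \<tau> by (intro mult_mono) auto
  then have "1 / 2 \<le> 1 + real t * (- ?u)" using N(2) N_pos by (simp add: field_simps)
  also have "\<dots> \<le> (1 + (- ?u)) ^ t" using u by (intro Bernoulli_inequality) linarith
  finally have half: "1 / 2 \<le> (1 - ?u) ^ t" by simp
  have "N / (N - 2 * real t - 1) = 1 / (1 - ?u)" using h N_pos by (simp add: field_simps)
  then have "(N / (N - 2 * real t - 1)) ^ t = 1 / (1 - ?u) ^ t" by (simp add: power_one_over)
  also have "\<dots> \<le> 1 / (1 / 2)" using half by (intro divide_left_mono) auto
  finally have pow: "(N / (N - 2 * real t - 1)) ^ t \<le> 2" by simp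
  have "(N / (N - 2 * real t - 1)) ^ t * (real t * lam 2 V d / a\<^sup>2) \<le> 2 * (\<tau> * v / a\<^sup>2)"
    using pow t v \<tau> lam0 a h N_pos
    by (intro mult_mono divide_right_mono) auto
  with nonsimple_bound[OF t N(1) r b] show ?thesis
    unfolding bad_bound_def by linarith
qed

lemma rewiring_error_le:
  assumes t: "real t \<le> \<tau>" and N: "4 * \<tau> + 2 \<le> N" and r: "1 / N \<le> r"
    and b: "real \<Delta> \<le> b" and \<alpha>: "0 \<le> \<alpha>" "\<alpha> \<le> 1"
  shows "\<alpha> * real t * rewiring_error \<Delta> t \<le> \<tau> * ( 2 * r + \<tau> * (4 * r + 4 * \<tau>\<^sup>2 * b * r))"
proof -
  have \<tau>: "0 \<le> \<tau>" using t of_nat_0_le_iff[of t] by linarith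
  let ?ns = "real t * (real t * real \<Delta> / (N - 2 * real t - 1))"
  have h: "N / 2 \<le> N - 2 * real t - 1" using t N(1) by linarith
  have ns0: "0 \<le> ?ns" using h N_pos by simp
  have "4 \<le> N"
  proof -
    have "card H \<noteq> 3" using even_H by auto
    then show ?thesis using card_H_ge_3 by linarith
  qed
  then have N2: "1 / (N - 2) \<le> 2 / N" "N / (N - 2) \<le> 2" by (auto simp: field_simps)
  have "(2 + N * ?ns) / (N - 2) = 2 * (1 / (N - 2)) + N / (N - 2) * ?ns"
    by (simp add: add_divide_distrib)
  also have "\<dots> \<le> 2 * (2 / N) + 2 * ?ns"
    using N2 ns0 by (intro add_mono mult_left_mono mult_right_mono) auto
  also have "\<dots> \<le> 2 * (2 * r) + 2 * (2 * \<tau>\<^sup>2 * b * r)"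
    using r by (intro add_mono mult_left_mono nonsimple_bound[OF t N r b]) auto
  also have "\<dots> = 4 * r + 4 * \<tau>\<^sup>2 * b * r" by simp
  finally have le: "(2 + N * ?ns) / (N - 2) \<le> 4 * r + 4 * \<tau>\<^sup>2 * b * r" .
  have nn: "0 \<le> (2 + N * ?ns) / (N - 2)"
    using \<open>4 \<le> N\<close> by (intro divide_nonneg_nonneg add_nonneg_nonneg mult_nonneg_nonneg[OF _ ns0]) auto
  have eq: "rewiring_error \<Delta> t = 2 / N + real t * ((2 + N * ?ns) / (N - 2))"
    by (simp add: rewiring_error_def)
  also have "\<dots> \<le> 2 * r + \<tau> * (4 * r + 4 * \<tau>\<^sup>2 * b * r)"
    using r t \<tau> le nn by (intro add_mono mult_mono) auto
  finally have re: "rewiring_error \<Delta> t \<le> 2 * r + \<tau> * (4 * r + 4 * \<tau>\<^sup>2 * b * r)" .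
  have "0 \<le> rewiring_error \<Delta> t"
    unfolding eq by (intro add_nonneg_nonneg mult_nonneg_nonneg nn) auto
  moreover have "\<alpha> * real t \<le> 1 * \<tau>" using \<alpha> t by (intro mult_mono) auto
  ultimately show ?thesis using re \<tau> by (intro mult_mono) auto
qed

lemma static_error_le:
  assumes t: "real t \<le> \<tau>" and N: "8 * \<tau> + 2 \<le> N" "2 * \<tau> * (2 * \<tau> + 1) \<le> N" and r: "1 / N \<le> r"
    and b: "real \<Delta> \<le> b" and v: "lam 2 V d \<le> v" and a: "0 < a"
  shows "static_error \<Delta> t a \<le> N * exp (- (real t * lam1 V d - a)) + 2 * (4 * \<tau> + 1) * r
    + 2 * (2 * \<tau>\<^sup>2 * b * r + 2 * (\<tau> * v / a\<^sup>2))"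
proof -
  have \<tau>: "0 \<le> \<tau>" using t of_nat_0_le_iff[of t] by linarith
  have h: "N / 2 \<le> N - 4 * real t - 1" using t N(1) by linarith
  have "N / (N - 4 * real t - 1) - 1 = (4 * real t + 1) * (1 / (N - 4 * real t - 1))"
    using h N_pos by (simp add: field_simps)
  also have "\<dots> \<le> (4 * \<tau> + 1) * (1 / (N / 2))"
    using h N_pos t \<tau> by (intro mult_mono divide_left_mono) auto
  also have "\<dots> = 2 * (4 * \<tau> + 1) * (1 / N)" by simp
  also have "\<dots> \<le> 2 * (4 * \<tau> + 1) * r" using r \<tau> by (intro mult_left_mono) auto
  finally have 1: "N / (N - 4 * real t - 1) - 1 \<le> 2 * (4 * \<tau> + 1) * r" .
  have N': "4 * \<tau> + 2 \<le> N" using N(1) \<tau> by linarith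
  show ?thesis
    unfolding static_error_def
    by (intro add_mono mult_left_mono order_refl 1 bad_bound_le[OF t N' N(2) r b v a]) simp
qed

lemma prob_deviation_le_mean:
  assumes "0 < \<epsilon>"
  shows "measure_pmf.prob (unif_start V d) {s. \<epsilon> < \<bar>R s\<bar>} \<le> mean (\<lambda>s. \<bar>R s\<bar>) / \<epsilon>"
proof -
  let ?S = "states \<inter> {s. \<epsilon> < \<bar>R s\<bar>}"
  have "\<epsilon> * real (card ?S) = (\<Sum>s\<in>?S. \<epsilon>)" by simp
  also have "\<dots> \<le> (\<Sum>s\<in>?S. \<bar>R s\<bar>)" by (rule sum_mono) auto
  also have "\<dots> \<le> (\<Sum>s\<in>states. \<bar>R s\<bar>)" by (rule sum_mono2[OF finite_states]) auto
  finally have "real (card ?S) \<le> (\<Sum>s\<in>states. \<bar>R s\<bar>) / \<epsilon>"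
    using assms by (simp add: field_simps)
  moreover have "measure_pmf.prob (unif_start V d) {s. \<epsilon> < \<bar>R s\<bar>} = real (card ?S) / real (card states)"
    unfolding unif_start_eq by (rule measure_pmf_of_set[OF states_ne finite_states])
  moreover have "real (card ?S) / real (card states) \<le> (\<Sum>s\<in>states. \<bar>R s\<bar>) / \<epsilon> / real (card states)"
    using calculation(1) by (rule divide_right_mono) simp
  ultimately show ?thesis unfolding mean_eq by (simp add: mult.commute)
qed

end

section \<open>Asymptotics\<close>

lemma power_one_minus_tendsto_exp:
  fixes \<alpha> :: "nat \<Rightarrow> real" and T :: "nat \<Rightarrow> nat"
  assumes nonneg: "\<And>n. 0 \<le> \<alpha> n" and zero: "\<alpha> \<longlonglongrightarrow> 0" and lim: "(\<lambda>n. \<alpha> n * real (T n)) \<longlonglongrightarrow> L"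
  shows "(\<lambda>n. (1 - \<alpha> n) ^ T n) \<longlonglongrightarrow> exp (- L)"
proof (rule tendsto_sandwich)
  have small: "\<forall>\<^sub>F n in sequentially. \<alpha> n \<le> 1 / 2"
    using order_tendstoD(2)[OF zero, of "1 / 2"] by (auto elim: eventually_mono)
  show "\<forall>\<^sub>F n in sequentially. exp (- (\<alpha> n * real (T n)) - 2 * \<alpha> n * (\<alpha> n * real (T n))) \<le> (1 - \<alpha> n) ^ T n"
    using small
  proof eventually_elim
    case (elim n)
    have "- \<alpha> n - 2 * (\<alpha> n)\<^sup>2 \<le> ln (1 - \<alpha> n)"
      using nonneg[of n] elim by (rule ln_one_minus_pos_lower_bound)
    then have "exp (- \<alpha> n - 2 * (\<alpha> n)\<^sup>2) \<le> 1 - \<alpha> n"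
      using elim by (subst (asm) ln_ge_iff) auto
    then have "exp (- \<alpha> n - 2 * (\<alpha> n)\<^sup>2) ^ T n \<le> (1 - \<alpha> n) ^ T n"
      by (rule power_mono) simp
    then show ?case
      unfolding exp_of_nat_mult[symmetric] by (simp add: algebra_simps power2_eq_square)
  qed
  show "\<forall>\<^sub>F n in sequentially. (1 - \<alpha> n) ^ T n \<le> exp (- (\<alpha> n * real (T n)))"
    using small
  proof eventually_elim
    case (elim n)
    have "1 - \<alpha> n \<le> exp (- \<alpha> n)" using exp_ge_add_one_self[of "- \<alpha> n"] by simp
    then have "(1 - \<alpha> n) ^ T n \<le> exp (- \<alpha> n) ^ T n" using elim by (intro power_mono) auto
    then show ?case unfolding exp_of_nat_mult[symmetric] by (simp add: mult.commute)
  qed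
  have "(\<lambda>n. exp (- (\<alpha> n * real (T n)) - 2 * \<alpha> n * (\<alpha> n * real (T n)))) \<longlonglongrightarrow> exp (- L - 2 * 0 * L)"
    by (intro tendsto_intros zero lim)
  then show "(\<lambda>n. exp (- (\<alpha> n * real (T n)) - 2 * \<alpha> n * (\<alpha> n * real (T n)))) \<longlonglongrightarrow> exp (- L)" by simp
  show "(\<lambda>n. exp (- (\<alpha> n * real (T n)))) \<longlonglongrightarrow> exp (- L)"
    by (intro tendsto_intros lim)
qed

text \<open>
  The growth conditions with explicit constants. The static walk has its cutoff at \<open>ln n / \<Lambda>\<close>.
\<close>

locale growing_graphs =
  fixes V :: "nat \<Rightarrow> 'v set" and d :: "nat \<Rightarrow> 'v \<Rightarrow> nat" and \<alpha> \<epsilon> :: "nat \<Rightarrow> real"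
    and \<Lambda> c\<^sub>1 c\<^sub>2 :: real
  assumes graph: "\<forall>\<^sub>F n in sequentially. half_edge_graph (V n) (d n)"
    and alpha: "\<And>n. 0 \<le> \<alpha> n" "\<And>n. \<alpha> n \<le> 1"
    and c\<^sub>1: "0 < c\<^sub>1"
    and size: "\<forall>\<^sub>F n in sequentially. c\<^sub>1 * real n \<le> real (card (half_edges (V n) (d n)))"
      "\<forall>\<^sub>F n in sequentially. real (card (half_edges (V n) (d n))) \<le> c\<^sub>2 * real n"
    and max_degree: "\<forall>\<^sub>F n in sequentially. \<forall>v\<in>V n. real (d n v) \<le> real n powr \<epsilon> n"
    and eps: "\<epsilon> \<longlonglongrightarrow> 0"
    and lam1_lim: "(\<lambda>n. lam1 (V n) (d n)) \<longlonglongrightarrow> \<Lambda>"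
begin

abbreviation "num_H n \<equiv> real (card (half_edges (V n) (d n)))"
abbreviation "\<mu> n \<equiv> unif_start (V n) (d n)"

definition max_deg :: "nat \<Rightarrow> nat" where
  "max_deg n = nat \<lfloor>real n powr \<epsilon> n\<rfloor>"

lemma eventually_max_deg:
  "\<forall>\<^sub>F n in sequentially. (\<forall>v\<in>V n. d n v \<le> max_deg n) \<and> real (max_deg n) \<le> sqrt (real n)
    \<and> ln (real (max_deg n)) \<le> \<bar>\<epsilon> n\<bar> * ln (real n)"
proof -
  have "\<forall>\<^sub>F n in sequentially. \<epsilon> n < 1 / 2" by (rule order_tendstoD(2)[OF eps]) simp
  with max_degree eventually_ge_at_top[of 1] show ?thesis
  proof eventually_elim
    case (elim n)
    have n: "1 \<le> real n" using elim(2) by simp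
    have up: "real (max_deg n) \<le> real n powr \<epsilon> n" by (simp add: max_deg_def)
    also have "\<dots> \<le> real n powr (1 / 2)" using n elim(3) by (intro powr_mono) auto
    finally have s: "real (max_deg n) \<le> sqrt (real n)" by (simp add: powr_half_sqrt)
    have le: "d n v \<le> max_deg n" if "v \<in> V n" for v
      using elim(1) that unfolding max_deg_def by (simp add: le_nat_iff le_floor_iff)
    have "ln (real (max_deg n)) \<le> \<bar>\<epsilon> n\<bar> * ln (real n)"
    proof (cases "max_deg n = 0")
      case True
      then show ?thesis using n by simp
    next
      case False
      then have "ln (real (max_deg n)) \<le> ln (real n powr \<epsilon> n)" using up by (intro ln_mono) auto
      also have "\<dots> = \<epsilon> n * ln (real n)" using n by (simp add: ln_powr)
      also have "\<dots> \<le> \<bar>\<epsilon> n\<bar> * ln (real n)" using n by (intro mult_right_mono) auto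
      finally show ?thesis .
    qed
    with s le show ?case by auto
  qed
qed

definition var_bound :: "nat \<Rightarrow> real" where
  "var_bound n = \<bar>\<epsilon> n\<bar> * ln (real n) * (\<Lambda> + 1)"

lemma eventually_sizes:
  assumes K: "0 < K"
  shows "\<forall>\<^sub>F n in sequentially. half_edge_graph (V n) (d n) \<and> 1 < n
    \<and> 8 * (K * ln (real n)) + 2 \<le> num_H n
    \<and> 2 * (K * ln (real n)) * (2 * (K * ln (real n)) + 1) \<le> num_H n
    \<and> 1 / num_H n \<le> 1 / (c\<^sub>1 * real n) \<and> num_H n \<le> c\<^sub>2 * real n
    \<and> lam 2 (V n) (d n) \<le> var_bound n
    \<and> (\<forall>v\<in>V n. d n v \<le> max_deg n) \<and> real (max_deg n) \<le> sqrt (real n)"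
proof -
  have 1: "\<forall>\<^sub>F n in sequentially. 8 * (K * ln (real n)) + 2 \<le> c\<^sub>1 * real n"
    using c\<^sub>1 K by real_asymp
  have 2: "\<forall>\<^sub>F n in sequentially. 2 * (K * ln (real n)) * (2 * (K * ln (real n)) + 1) \<le> c\<^sub>1 * real n"
    using c\<^sub>1 K by real_asymp
  have 3: "\<forall>\<^sub>F n in sequentially. lam1 (V n) (d n) < \<Lambda> + 1"
    by (rule order_tendstoD(2)[OF lam1_lim]) simp
  show ?thesis
    using graph 1 2 3 size eventually_max_deg eventually_gt_at_top[of 1]
  proof eventually_elim
    case (elim n)
    interpret half_edge_graph "V n" "d n" by (rule elim(1))
    have n: "1 < real n" using elim(8) by simp
    have "0 < c\<^sub>1 * real n" using c\<^sub>1 n by simp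
    then have r: "1 / num_H n \<le> 1 / (c\<^sub>1 * real n)"
      using elim(5) N_pos by (intro divide_left_mono) auto
    have lam1_nonneg: "0 \<le> lam1 (V n) (d n)"
      unfolding lam1_def
    proof (intro divide_nonneg_nonneg sum_nonneg)
      fix z assume "z \<in> H"
      from D_ge_2[OF this] show "0 \<le> ln (D z)" by simp
    qed simp
    have "lam 2 (V n) (d n) \<le> ln (real (max_deg n)) * lam1 (V n) (d n)"
      using elim(7) by (intro lam2_le) blast
    also have "\<dots> \<le> (\<bar>\<epsilon> n\<bar> * ln (real n)) * (\<Lambda> + 1)"
      using elim(4,7) lam1_nonneg n by (intro mult_mono) auto
    finally have "lam 2 (V n) (d n) \<le> var_bound n" by (simp add: var_bound_def)
    with elim r show ?case by auto
  qed
qed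

text \<open>
  For times up to \<open>K * ln n\<close> and deviations \<open>a = \<delta> * ln n\<close> of the weight, \<open>atypical_error\<close> dominates
  \<open>bad_bound\<close>, and \<open>comparison_error\<close> dominates the error of the comparison with the static walk. Both
  vanish since the maximal degree is \<open>n\<close> to the power \<open>o(1)\<close>.
\<close>

definition atypical_error :: "real \<Rightarrow> real \<Rightarrow> nat \<Rightarrow> real" where
  "atypical_error K \<delta> n = (let \<tau> = K * ln (real n); r = 1 / (c\<^sub>1 * real n) in
    2 * \<tau>\<^sup>2 * sqrt (real n) * r + 2 * (\<tau> * var_bound n / (\<delta> * ln (real n))\<^sup>2))"

definition comparison_error :: "real \<Rightarrow> nat \<Rightarrow> real" where
  "comparison_error K n = (let \<tau> = K * ln (real n); r = 1 / (c\<^sub>1 * real n) in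
    \<tau> * (2 * r + \<tau> * (4 * r + 4 * \<tau>\<^sup>2 * sqrt (real n) * r)))"

lemma atypical_error_tendsto:
  assumes "0 < K" "0 < \<delta>"
  shows "atypical_error K \<delta> \<longlonglongrightarrow> 0"
proof -
  have 1: "(\<lambda>n. 2 * (K * ln (real n))\<^sup>2 * sqrt (real n) * (1 / (c\<^sub>1 * real n))) \<longlonglongrightarrow> 0"
    using c\<^sub>1 assms(1) by real_asymp
  have 2: "(\<lambda>n. 2 * (K * ln (real n) * var_bound n / (\<delta> * ln (real n))\<^sup>2)) \<longlonglongrightarrow> 0"
  proof (rule Lim_transform_eventually)
    have "(\<lambda>n. 2 * K * (\<Lambda> + 1) / \<delta>\<^sup>2 * \<bar>\<epsilon> n\<bar>) \<longlonglongrightarrow> 2 * K * (\<Lambda> + 1) / \<delta>\<^sup>2 * \<bar>0\<bar>"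
      by (intro tendsto_intros eps)
    then show "(\<lambda>n. 2 * K * (\<Lambda> + 1) / \<delta>\<^sup>2 * \<bar>\<epsilon> n\<bar>) \<longlonglongrightarrow> 0" by simp
    show "\<forall>\<^sub>F n in sequentially. 2 * K * (\<Lambda> + 1) / \<delta>\<^sup>2 * \<bar>\<epsilon> n\<bar>
        = 2 * (K * ln (real n) * var_bound n / (\<delta> * ln (real n))\<^sup>2)"
      using eventually_gt_at_top[of 1]
    proof eventually_elim
      case (elim n)
      then have "ln (real n) \<noteq> 0" by simp
      then show ?case using assms(2) by (simp add: var_bound_def power2_eq_square field_simps)
    qed
  qed
  from tendsto_add[OF 1 2] show ?thesis by (simp add: atypical_error_def[abs_def] Let_def)
qed

lemma comparison_error_tendsto: "0 < K \<Longrightarrow> comparison_error K \<longlonglongrightarrow> 0"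
  unfolding comparison_error_def[abs_def] Let_def using c\<^sub>1 by real_asymp

lemma whp_eq_oP_if_mean:
  assumes "\<forall>\<^sub>F n in sequentially. half_edge_graph (V n) (d n) \<and>
      measure_pmf.expectation (\<mu> n) (\<lambda>s. \<bar>F n s - a\<bar>) \<le> b n"
    and "b \<longlonglongrightarrow> 0"
  shows "whp_eq_oP \<mu> F a"
  unfolding whp_eq_oP_def
proof (intro exI conjI)
  show "little_oP \<mu> (\<lambda>n s. F n s - a)"
    unfolding little_oP_def
  proof (intro allI impI)
    fix e :: real assume e: "0 < e"
    show "(\<lambda>n. measure_pmf.prob (\<mu> n) {s. e < \<bar>F n s - a\<bar>}) \<longlonglongrightarrow> 0"
    proof (rule tendsto_sandwich[where f = "\<lambda>_. 0" and h = "\<lambda>n. b n / e"])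
      show "\<forall>\<^sub>F n in sequentially. measure_pmf.prob (\<mu> n) {s. e < \<bar>F n s - a\<bar>} \<le> b n / e"
        using assms(1)
      proof eventually_elim
        case (elim n)
        then interpret half_edge_graph "V n" "d n" by simp
        have "measure_pmf.prob (\<mu> n) {s. e < \<bar>F n s - a\<bar>}
            \<le> measure_pmf.expectation (\<mu> n) (\<lambda>s. \<bar>F n s - a\<bar>) / e"
          by (rule prob_deviation_le_mean[OF e])
        also have "\<dots> \<le> b n / e" using elim e by (intro divide_right_mono) auto
        finally show ?case .
      qed
      show "(\<lambda>n. b n / e) \<longlonglongrightarrow> 0" using tendsto_divide[OF assms(2) tendsto_const, of e] e by simp
    qed auto
  qed
  show "whp \<mu> (\<lambda>n s. F n s = F n s - a + a)" by (simp add: whp_def)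
qed

lemma early_distance:
  fixes T :: "nat \<Rightarrow> nat"
  assumes K: "0 < K" and T: "\<forall>\<^sub>F n in sequentially. real (T n) \<le> K * ln (real n)"
    and \<delta>: "0 < \<delta>"
    and early: "\<forall>\<^sub>F n in sequentially. real (T n) * lam1 (V n) (d n) \<le> (1 - 2 * \<delta>) * ln (real n)"
    and l: "(\<lambda>n. (1 - \<alpha> n) ^ T n) \<longlonglongrightarrow> l"
  shows "whp_eq_oP \<mu> (\<lambda>n s. dyn_dist (V n) (d n) (\<alpha> n) s (T n)) l"
proof (rule whp_eq_oP_if_mean)
  let ?b = "\<lambda>n. comparison_error K n + \<bar>(1 - \<alpha> n) ^ T n - l\<bar>
    + (atypical_error K \<delta> n + real n powr (1 - \<delta>) * (1 / (c\<^sub>1 * real n)))"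
  show "\<forall>\<^sub>F n in sequentially. half_edge_graph (V n) (d n) \<and>
      measure_pmf.expectation (\<mu> n) (\<lambda>s. \<bar>dyn_dist (V n) (d n) (\<alpha> n) s (T n) - l\<bar>) \<le> ?b n"
    using eventually_sizes[OF K] T early
  proof eventually_elim
    case (elim n)
    interpret half_edge_graph "V n" "d n" using elim(1) by simp
    define \<tau> where "\<tau> = K * ln (real n)"
    define r where "r = 1 / (c\<^sub>1 * real n)"
    note facts = elim(1)[folded \<tau>_def r_def]
    have n: "1 < real n" using facts by simp
    have \<tau>: "0 \<le> \<tau>" "real (T n) \<le> \<tau>" using K n elim(2) by (auto simp: \<tau>_def)
    have N4: "4 * \<tau> + 2 \<le> num_H n" and N2: "2 * real (T n) + 1 < num_H n" using facts \<tau> by linarith+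
    have a: "0 < \<delta> * ln (real n)" using \<delta> n by simp
    have Delta: "d n v \<le> max_deg n" if "v \<in> V n" for v using facts that by blast
    have "\<alpha> n * real (T n) * rewiring_error (max_deg n) (T n)
        \<le> \<tau> * (2 * r + \<tau> * (4 * r + 4 * \<tau>\<^sup>2 * sqrt (real n) * r))"
      using facts by (intro rewiring_error_le \<tau>(2) N4 alpha) auto
    then have 1: "\<alpha> n * real (T n) * rewiring_error (max_deg n) (T n) \<le> comparison_error K n"
      by (simp add: comparison_error_def Let_def \<tau>_def r_def)
    have "bad_bound (max_deg n) (T n) (\<delta> * ln (real n))
        \<le> 2 * \<tau>\<^sup>2 * sqrt (real n) * r + 2 * (\<tau> * var_bound n / (\<delta> * ln (real n))\<^sup>2)"
      using facts by (intro bad_bound_le \<tau>(2) N4 a) auto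
    then have 2: "bad_bound (max_deg n) (T n) (\<delta> * ln (real n)) \<le> atypical_error K \<delta> n"
      by (simp add: atypical_error_def Let_def \<tau>_def r_def)
    have "real (T n) * lam1 (V n) (d n) + \<delta> * ln (real n) \<le> (1 - \<delta>) * ln (real n)"
      using elim(3) by (simp add: algebra_simps)
    then have "exp (real (T n) * lam1 (V n) (d n) + \<delta> * ln (real n)) \<le> real n powr (1 - \<delta>)"
      using n by (simp add: powr_def)
    then have 3: "exp (real (T n) * lam1 (V n) (d n) + \<delta> * ln (real n)) * (1 / num_H n) \<le> real n powr (1 - \<delta>) * r"
      using facts by (intro mult_mono) auto
    have "mean (\<lambda>s. \<bar>dyn_dist (V n) (d n) (\<alpha> n) s (T n) - l\<bar>)
        \<le> \<alpha> n * real (T n) * rewiring_error (max_deg n) (T n) + \<bar>(1 - \<alpha> n) ^ T n - l\<bar>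
        + (bad_bound (max_deg n) (T n) (\<delta> * ln (real n))
          + exp (real (T n) * lam1 (V n) (d n) + \<delta> * ln (real n)) / num_H n)"
      by (rule mean_dyn_dist_early[OF alpha Delta N2 a])
    also have "\<dots> \<le> ?b n" using 1 2 3 unfolding r_def by simp
    finally show ?case using elim(1) by blast
  qed
  have "(\<lambda>n. real n powr (1 - \<delta>) * (1 / (c\<^sub>1 * real n))) \<longlonglongrightarrow> 0"
    using \<delta> c\<^sub>1 by real_asymp
  then have "?b \<longlonglongrightarrow> 0 + \<bar>l - l\<bar> + (0 + 0)"
    by (intro tendsto_intros comparison_error_tendsto atypical_error_tendsto K \<delta> l)
  then show "?b \<longlonglongrightarrow> 0" by simp
qed

lemma late_distance:
  fixes T :: "nat \<Rightarrow> nat"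
  assumes K: "0 < K" and T: "\<forall>\<^sub>F n in sequentially. real (T n) \<le> K * ln (real n)"
    and \<delta>: "0 < \<delta>"
    and late: "\<forall>\<^sub>F n in sequentially. (1 + 2 * \<delta>) * ln (real n) \<le> real (T n) * lam1 (V n) (d n)"
  shows "whp_eq_oP \<mu> (\<lambda>n s. dyn_dist (V n) (d n) (\<alpha> n) s (T n)) 0"
proof (rule whp_eq_oP_if_mean)
  let ?s = "\<lambda>n. c\<^sub>2 * real n * real n powr (- (1 + \<delta>))
    + 2 * (4 * (K * ln (real n)) + 1) * (1 / (c\<^sub>1 * real n)) + 2 * atypical_error K \<delta> n"
  let ?b = "\<lambda>n. comparison_error K n + sqrt (?s n)"
  show "\<forall>\<^sub>F n in sequentially. half_edge_graph (V n) (d n) \<and>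
      measure_pmf.expectation (\<mu> n) (\<lambda>s. \<bar>dyn_dist (V n) (d n) (\<alpha> n) s (T n) - 0\<bar>) \<le> ?b n"
    using eventually_sizes[OF K] T late
  proof eventually_elim
    case (elim n)
    interpret half_edge_graph "V n" "d n" using elim(1) by simp
    define \<tau> where "\<tau> = K * ln (real n)"
    define r where "r = 1 / (c\<^sub>1 * real n)"
    note facts = elim(1)[folded \<tau>_def r_def]
    have n: "1 < real n" using facts by simp
    have \<tau>: "0 \<le> \<tau>" "real (T n) \<le> \<tau>" using K n elim(2) by (auto simp: \<tau>_def)
    have N4: "4 * \<tau> + 2 \<le> num_H n" and N4': "4 * real (T n) + 1 < num_H n" using facts \<tau> by linarith+
    have a: "0 < \<delta> * ln (real n)" using \<delta> n by simp
    have Delta: "d n v \<le> max_deg n" if "v \<in> V n" for v using facts that by blast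
    have "\<alpha> n * real (T n) * rewiring_error (max_deg n) (T n)
        \<le> \<tau> * (2 * r + \<tau> * (4 * r + 4 * \<tau>\<^sup>2 * sqrt (real n) * r))"
      using facts by (intro rewiring_error_le \<tau>(2) N4 alpha) auto
    then have 1: "\<alpha> n * real (T n) * rewiring_error (max_deg n) (T n) \<le> comparison_error K n"
      by (simp add: comparison_error_def Let_def \<tau>_def r_def)
    have "- (real (T n) * lam1 (V n) (d n) - \<delta> * ln (real n)) \<le> - (1 + \<delta>) * ln (real n)"
      using elim(3) by (simp add: algebra_simps)
    then have "exp (- (real (T n) * lam1 (V n) (d n) - \<delta> * ln (real n))) \<le> real n powr (- (1 + \<delta>))"
      using n by (simp add: powr_def)
    then have ex: "num_H n * exp (- (real (T n) * lam1 (V n) (d n) - \<delta> * ln (real n)))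
        \<le> c\<^sub>2 * real n * real n powr (- (1 + \<delta>))"
      using facts by (intro mult_mono) auto
    have "static_error (max_deg n) (T n) (\<delta> * ln (real n))
        \<le> num_H n * exp (- (real (T n) * lam1 (V n) (d n) - \<delta> * ln (real n))) + 2 * (4 * \<tau> + 1) * r
          + 2 * (2 * \<tau>\<^sup>2 * sqrt (real n) * r + 2 * (\<tau> * var_bound n / (\<delta> * ln (real n))\<^sup>2))"
      using facts by (intro static_error_le \<tau>(2) a) auto
    also have "\<dots> \<le> c\<^sub>2 * real n * real n powr (- (1 + \<delta>)) + 2 * (4 * \<tau> + 1) * r
          + 2 * (2 * \<tau>\<^sup>2 * sqrt (real n) * r + 2 * (\<tau> * var_bound n / (\<delta> * ln (real n))\<^sup>2))"
      using ex by (intro add_mono order_refl)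
    finally have 2: "static_error (max_deg n) (T n) (\<delta> * ln (real n)) \<le> ?s n"
      by (simp only: atypical_error_def Let_def \<tau>_def r_def)
    have "mean (\<lambda>s. \<bar>dyn_dist (V n) (d n) (\<alpha> n) s (T n) - 0\<bar>)
        \<le> \<alpha> n * real (T n) * rewiring_error (max_deg n) (T n)
          + sqrt (static_error (max_deg n) (T n) (\<delta> * ln (real n)))"
      by (rule mean_dyn_dist_late[OF alpha Delta N4' a])
    also have "\<dots> \<le> ?b n" using 1 2 by (intro add_mono real_sqrt_le_mono)
    finally show ?case using elim(1) by blast
  qed
  have "(\<lambda>n. c\<^sub>2 * real n * real n powr (- (1 + \<delta>))) \<longlonglongrightarrow> 0"
  proof -
    have "(\<lambda>n. real n * real n powr (- (1 + \<delta>))) \<longlonglongrightarrow> 0" using \<delta> by real_asymp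
    from tendsto_mult[OF tendsto_const[of c\<^sub>2] this] show ?thesis by (simp add: mult.assoc)
  qed
  moreover have "(\<lambda>n. 2 * (4 * (K * ln (real n)) + 1) * (1 / (c\<^sub>1 * real n))) \<longlonglongrightarrow> 0"
    using c\<^sub>1 K by real_asymp
  ultimately have "?b \<longlonglongrightarrow> 0 + sqrt (0 + 0 + 2 * 0)"
    by (intro tendsto_intros comparison_error_tendsto atypical_error_tendsto K \<delta>)
  then show "?b \<longlonglongrightarrow> 0" by simp
qed

end

section \<open>Mixing of the dynamic walk\<close>

theorem corollary1:
  fixes V :: "nat \<Rightarrow> 'v set" and d :: "nat \<Rightarrow> 'v \<Rightarrow> nat"
    and \<alpha> :: "nat \<Rightarrow> real" and c_star :: real
  defines "H \<equiv> (\<lambda>n. half_edges (V n) (d n))"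
  defines "lambda1 \<equiv> (\<lambda>n. lam1 (V n) (d n))"
  defines "lambda2 \<equiv> (\<lambda>n. lam 2 (V n) (d n))"
  defines "lambda3 \<equiv> (\<lambda>n. lam 3 (V n) (d n))"
  defines "\<mu> \<equiv> (\<lambda>n. unif_start (V n) (d n))"
  defines "D \<equiv> (\<lambda>n s t. dyn_dist (V n) (d n) (\<alpha> n) s t)"
  assumes V: "\<And>n. finite (V n)" "\<And>n. card (V n) = n"
    and H_even: "\<And>n. even (card (H n))"
    and \<alpha>_prob: "\<And>n. 0 \<le> \<alpha> n \<and> \<alpha> n \<le> 1"
    and \<alpha>_lim: "\<alpha> \<longlonglongrightarrow> 0"
    and H_theta: "(\<lambda>n. real (card (H n))) \<in> \<Theta>(\<lambda>n. real n)"
    and max_deg: "\<exists>\<epsilon>. \<epsilon> \<longlonglongrightarrow> 0 \<and>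
          (\<forall>\<^sub>F n in sequentially. real (Max (d n ` V n)) = real n powr \<epsilon> n)"
    and min_deg: "\<forall>\<^sub>F n in sequentially. \<forall>v\<in>V n. d n v \<ge> 3"
    and reg2: "(\<lambda>n. lambda2 n / lambda1 n ^ 3) \<in>
          \<omega>(\<lambda>n. (ln (ln (real (card (H n)))))\<^sup>2 / ln (real (card (H n))))"
    and reg3: "(\<lambda>n. lambda2 n powr (3/2) / (lambda3 n * sqrt (lambda1 n))) \<in>
          \<omega>(\<lambda>n. 1 / sqrt (ln (real (card (H n)))))"
    and c_star: "c_star > 0" "(\<lambda>n. c_stat (V n) (d n)) \<longlonglongrightarrow> c_star"
  shows
    "(filterlim (\<lambda>n. \<alpha> n * ln (real n)) at_top sequentially \<longrightarrow>
        (\<forall>c\<ge>0. whp_eq_oP \<mu> (\<lambda>n s. D n s (nat \<lfloor>c / \<alpha> n\<rfloor>)) (exp (- c)))) \<and>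
     (\<forall>\<gamma>>0. (\<lambda>n. \<alpha> n * ln (real n)) \<longlonglongrightarrow> \<gamma> \<longrightarrow>
        (\<forall>c\<ge>0. c \<noteq> c_star \<longrightarrow>
           whp_eq_oP \<mu> (\<lambda>n s. D n s (nat \<lfloor>c * ln (real n)\<rfloor>))
             (if c < c_star then exp (- \<gamma> * c) else 0))) \<and>
     ((\<lambda>n. \<alpha> n * ln (real n)) \<longlonglongrightarrow> 0 \<longrightarrow>
        (\<forall>c\<ge>0. c \<noteq> c_star \<longrightarrow>
           whp_eq_oP \<mu> (\<lambda>n s. D n s (nat \<lfloor>c * ln (real n)\<rfloor>))
             (if c < c_star then 1 else 0)))"
proof -
  obtain \<epsilon> where \<epsilon>: "\<epsilon> \<longlonglongrightarrow> 0"
    and max_deg': "\<forall>\<^sub>F n in sequentially. real (Max (d n ` V n)) = real n powr \<epsilon> n"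
    using max_deg by blast
  obtain c1 where c1: "0 < c1" "\<forall>\<^sub>F n in sequentially. c1 * real n \<le> real (card (half_edges (V n) (d n)))"
    using landau_omega.bigE[OF bigthetaD2[OF H_theta[unfolded H_def]]] by auto
  obtain c2 where c2: "\<forall>\<^sub>F n in sequentially. real (card (half_edges (V n) (d n))) \<le> c2 * real n"
    using landau_o.bigE[OF bigthetaD1[OF H_theta[unfolded H_def]]] by auto
  define \<Lambda> where "\<Lambda> = 1 / c_star"
  have \<Lambda>: "0 < \<Lambda>" using c_star(1) by (simp add: \<Lambda>_def)
  have lam1_lim: "(\<lambda>n. lam1 (V n) (d n)) \<longlonglongrightarrow> \<Lambda>"
    using tendsto_inverse[OF c_star(2)] c_star(1) by (simp add: c_stat_def \<Lambda>_def inverse_eq_divide)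
  interpret growing_graphs V d \<alpha> \<epsilon> \<Lambda> c1 c2
  proof
    show "\<forall>\<^sub>F n in sequentially. half_edge_graph (V n) (d n)"
      using min_deg eventually_gt_at_top[of 0]
    proof eventually_elim
      case (elim n)
      have "V n \<noteq> {}" using V(2)[of n] elim(2) by auto
      then show ?case using V(1) elim(1) H_even[of n] by unfold_locales (auto simp: H_def)
    qed
    show "\<forall>\<^sub>F n in sequentially. \<forall>v\<in>V n. real (d n v) \<le> real n powr \<epsilon> n"
      using max_deg'
    proof eventually_elim
      case (elim n)
      have "d n v \<le> Max (d n ` V n)" if "v \<in> V n" for v
        using that V(1) by (intro Max_ge) auto
      then show ?case unfolding elim[symmetric] by simp
    qed
  qed (use \<alpha>_prob c1 c2 \<epsilon> lam1_lim in auto)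
  have lam1_pos: "\<forall>\<^sub>F n in sequentially. 0 < lam1 (V n) (d n)"
    by (rule order_tendstoD(1)[OF lam1_lim \<Lambda>])
  have lam1_less: "\<forall>\<^sub>F n in sequentially. lam1 (V n) (d n) < \<Lambda> + 1"
    by (rule order_tendstoD(2)[OF lam1_lim]) simp
  have ln_inv: "(\<lambda>n. 1 / ln (real n)) \<longlonglongrightarrow> 0" by real_asymp

  have fast: "whp_eq_oP \<mu> (\<lambda>n s. D n s (nat \<lfloor>c / \<alpha> n\<rfloor>)) (exp (- c))"
    if lim: "filterlim (\<lambda>n. \<alpha> n * ln (real n)) at_top sequentially" and c: "0 \<le> c" for c
  proof -
    \<comment> \<open>Once \<open>\<alpha> n * ln n\<close> exceeds \<open>M\<close>, the time \<open>c / \<alpha> n\<close> is at most half the static cutoff time.\<close>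
    define M where "M = 4 * (c + 1) * (\<Lambda> + 1)"
    have M: "0 < M" "c / M \<le> 1" "c / M * (\<Lambda> + 1) \<le> 1 / 2"
    proof -
      show "0 < M" using c \<Lambda> by (simp add: M_def)
      have "4 * (c + 1) * 1 \<le> M" unfolding M_def using c \<Lambda> by (intro mult_left_mono) auto
      then have "4 * c + 4 \<le> M" by simp
      then have "c \<le> M" using c by linarith
      then show "c / M \<le> 1" using \<open>0 < M\<close> by simp
      have "c / M * (\<Lambda> + 1) = c / (4 * (c + 1))" using \<Lambda> by (simp add: M_def)
      also have "\<dots> \<le> 1 / 2" using c by (simp add: divide_le_eq)
      finally show "c / M * (\<Lambda> + 1) \<le> 1 / 2" .
    qed
    have ev: "\<forall>\<^sub>F n in sequentially. 0 < ln (real n) \<and> 0 < \<alpha> n \<and> c / \<alpha> n \<le> c / M * ln (real n)"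
      using filterlim_at_top_dense[THEN iffD1, OF lim, rule_format, of M] eventually_gt_at_top[of 1]
    proof eventually_elim
      case (elim n)
      have ln: "0 < ln (real n)" using elim(2) by simp
      have \<alpha>: "0 < \<alpha> n" using elim(1) M(1) ln by (smt (verit) mult_nonpos_nonneg)
      have "c * M \<le> c * (\<alpha> n * ln (real n))" using elim(1) c by (intro mult_left_mono) auto
      then have "c / \<alpha> n \<le> c / M * ln (real n)" using \<alpha> M(1) by (simp add: field_simps)
      with ln \<alpha> show ?case by blast
    qed
    have T: "\<forall>\<^sub>F n in sequentially. 0 < \<alpha> n \<and> 0 < ln (real n)
        \<and> real (nat \<lfloor>c / \<alpha> n\<rfloor>) \<le> c / M * ln (real n)
        \<and> c - \<alpha> n \<le> \<alpha> n * real (nat \<lfloor>c / \<alpha> n\<rfloor>) \<and> \<alpha> n * real (nat \<lfloor>c / \<alpha> n\<rfloor>) \<le> c"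
      using ev
    proof eventually_elim
      case (elim n)
      have "0 \<le> c / \<alpha> n" using c elim by simp
      then have fl: "real (nat \<lfloor>c / \<alpha> n\<rfloor>) \<le> c / \<alpha> n" "c / \<alpha> n - 1 \<le> real (nat \<lfloor>c / \<alpha> n\<rfloor>)" by linarith+
      have \<alpha>: "0 < \<alpha> n" and le: "c / \<alpha> n \<le> c / M * ln (real n)" using elim by blast+
      have "c - \<alpha> n = \<alpha> n * (c / \<alpha> n - 1)" using \<alpha> by (simp add: right_diff_distrib)
      also have "\<dots> \<le> \<alpha> n * real (nat \<lfloor>c / \<alpha> n\<rfloor>)"
        using fl(2) \<alpha> by (intro mult_left_mono) auto
      finally have lower: "c - \<alpha> n \<le> \<alpha> n * real (nat \<lfloor>c / \<alpha> n\<rfloor>)" .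
      have "\<alpha> n * real (nat \<lfloor>c / \<alpha> n\<rfloor>) \<le> \<alpha> n * (c / \<alpha> n)"
        using fl(1) \<alpha> by (intro mult_left_mono) auto
      also have "\<dots> = c" using \<alpha> by simp
      finally show ?case using elim lower order_trans[OF fl(1) le] by blast
    qed
    have lim_T: "(\<lambda>n. \<alpha> n * real (nat \<lfloor>c / \<alpha> n\<rfloor>)) \<longlonglongrightarrow> c"
    proof (rule tendsto_sandwich[where f = "\<lambda>n. c - \<alpha> n" and h = "\<lambda>_. c"])
      show "(\<lambda>n. c - \<alpha> n) \<longlonglongrightarrow> c" using tendsto_diff[OF tendsto_const \<alpha>_lim, of c] by simp
    qed (use T in \<open>auto elim: eventually_mono\<close>)
    show ?thesis
      unfolding D_def \<mu>_def
    proof (rule early_distance[where K = 1 and \<delta> = "1 / 4"])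
      show "\<forall>\<^sub>F n in sequentially. real (nat \<lfloor>c / \<alpha> n\<rfloor>) \<le> 1 * ln (real n)"
        using T
      proof eventually_elim
        case (elim n)
        then have "c / M * ln (real n) \<le> 1 * ln (real n)" using M(2) by (intro mult_right_mono) auto
        with elim show ?case using order_trans by blast
      qed
      show "\<forall>\<^sub>F n in sequentially.
          real (nat \<lfloor>c / \<alpha> n\<rfloor>) * lam1 (V n) (d n) \<le> (1 - 2 * (1 / 4)) * ln (real n)"
        using T lam1_pos lam1_less
      proof eventually_elim
        case (elim n)
        have t: "real (nat \<lfloor>c / \<alpha> n\<rfloor>) \<le> c / M * ln (real n)" and ln: "0 < ln (real n)"
          using elim by blast+
        have "real (nat \<lfloor>c / \<alpha> n\<rfloor>) * lam1 (V n) (d n) \<le> (c / M * ln (real n)) * (\<Lambda> + 1)"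
          by (rule mult_mono[OF t]) (use elim c M(1) ln in auto)
        also have "\<dots> = (c / M * (\<Lambda> + 1)) * ln (real n)" by simp
        also have "\<dots> \<le> 1 / 2 * ln (real n)" using elim by (intro mult_right_mono M(3)) auto
        finally show ?case by simp
      qed
      show "(\<lambda>n. (1 - \<alpha> n) ^ nat \<lfloor>c / \<alpha> n\<rfloor>) \<longlonglongrightarrow> exp (- c)"
        by (rule power_one_minus_tendsto_exp[OF alpha(1) \<alpha>_lim lim_T])
    qed simp_all
  qed

  have slow: "whp_eq_oP \<mu> (\<lambda>n s. D n s (nat \<lfloor>c * ln (real n)\<rfloor>)) (if c < c_star then exp (- \<gamma> * c) else 0)"
    if lim: "(\<lambda>n. \<alpha> n * ln (real n)) \<longlonglongrightarrow> \<gamma>" and c: "0 \<le> c" "c \<noteq> c_star" for c \<gamma>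
  proof -
    let ?T = "\<lambda>n. nat \<lfloor>c * ln (real n)\<rfloor>"
    have T: "\<forall>\<^sub>F n in sequentially. 0 < ln (real n) \<and> real (?T n) \<le> c * ln (real n)
        \<and> c * ln (real n) - 1 \<le> real (?T n)"
      using eventually_gt_at_top[of 1]
    proof eventually_elim
      case (elim n)
      have ln: "0 < ln (real n)" using elim by simp
      then have "0 \<le> c * ln (real n)" using c by simp
      then have "real (?T n) \<le> c * ln (real n)" "c * ln (real n) - 1 \<le> real (?T n)" by linarith+
      with ln show ?case by blast
    qed
    have K: "\<forall>\<^sub>F n in sequentially. real (?T n) \<le> (c + 1) * ln (real n)"
      using T
    proof eventually_elim
      case (elim n)
      then have "real (?T n) \<le> c * ln (real n)" "0 \<le> 1 * ln (real n)" by auto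
      then show ?case unfolding distrib_right by linarith
    qed
    have lim_T: "(\<lambda>n. \<alpha> n * real (?T n)) \<longlonglongrightarrow> \<gamma> * c"
    proof (rule tendsto_sandwich[where f = "\<lambda>n. (\<alpha> n * ln (real n)) * c - \<alpha> n" and h = "\<lambda>n. (\<alpha> n * ln (real n)) * c"])
      show "(\<lambda>n. (\<alpha> n * ln (real n)) * c - \<alpha> n) \<longlonglongrightarrow> \<gamma> * c"
        using tendsto_diff[OF tendsto_mult[OF lim tendsto_const] \<alpha>_lim, of c] by simp
      show "(\<lambda>n. (\<alpha> n * ln (real n)) * c) \<longlonglongrightarrow> \<gamma> * c"
        by (rule tendsto_mult[OF lim tendsto_const])
      show "\<forall>\<^sub>F n in sequentially. (\<alpha> n * ln (real n)) * c - \<alpha> n \<le> \<alpha> n * real (?T n)"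
        using T
      proof eventually_elim
        case (elim n)
        then have "\<alpha> n * (c * ln (real n) - 1) \<le> \<alpha> n * real (?T n)"
          using alpha(1) by (intro mult_left_mono) auto
        then show ?case by (simp add: right_diff_distrib mult_ac)
      qed
      show "\<forall>\<^sub>F n in sequentially. \<alpha> n * real (?T n) \<le> (\<alpha> n * ln (real n)) * c"
        using T
      proof eventually_elim
        case (elim n)
        then have "\<alpha> n * real (?T n) \<le> \<alpha> n * (c * ln (real n))"
          using alpha(1) by (intro mult_left_mono) auto
        then show ?case by (simp add: mult_ac)
      qed
    qed
    show ?thesis
    proof (cases "c < c_star")
      case True
      \<comment> \<open>The bound \<open>1 - 2 * \<delta>\<close> is halfway between \<open>c * \<Lambda>\<close> and 1.\<close>
      define \<delta> where "\<delta> = (1 - c * \<Lambda>) / 4"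
      have "c * \<Lambda> < 1" using True c_star(1) by (simp add: \<Lambda>_def)
      then have \<delta>: "0 < \<delta>" "c * \<Lambda> < 1 - 2 * \<delta>" by (simp_all add: \<delta>_def field_simps)
      have "whp_eq_oP \<mu> (\<lambda>n s. D n s (?T n)) (exp (- (\<gamma> * c)))"
        unfolding D_def \<mu>_def
      proof (rule early_distance[OF _ K \<delta>(1)])
        have "\<forall>\<^sub>F n in sequentially. c * lam1 (V n) (d n) < 1 - 2 * \<delta>"
          by (rule order_tendstoD(2)[OF tendsto_mult[OF tendsto_const lam1_lim] \<delta>(2)])
        then show "\<forall>\<^sub>F n in sequentially. real (?T n) * lam1 (V n) (d n) \<le> (1 - 2 * \<delta>) * ln (real n)"
          using T lam1_pos
        proof eventually_elim
          case (elim n)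
          have "real (?T n) * lam1 (V n) (d n) \<le> (c * ln (real n)) * lam1 (V n) (d n)"
            using elim by (intro mult_right_mono) auto
          also have "\<dots> = (c * lam1 (V n) (d n)) * ln (real n)" by simp
          also have "\<dots> \<le> (1 - 2 * \<delta>) * ln (real n)" using elim by (intro mult_right_mono) auto
          finally show ?case .
        qed
        show "(\<lambda>n. (1 - \<alpha> n) ^ ?T n) \<longlonglongrightarrow> exp (- (\<gamma> * c))"
          by (rule power_one_minus_tendsto_exp[OF alpha(1) \<alpha>_lim lim_T])
      qed (use c in simp)
      then show ?thesis using True by simp
    next
      case False
      define \<delta> where "\<delta> = (c * \<Lambda> - 1) / 4"
      have "1 < c * \<Lambda>" using False c c_star(1) by (simp add: \<Lambda>_def)
      then have \<delta>: "0 < \<delta>" "1 + 2 * \<delta> < c * \<Lambda>" by (simp_all add: \<delta>_def field_simps)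
      have "whp_eq_oP \<mu> (\<lambda>n s. D n s (?T n)) 0"
        unfolding D_def \<mu>_def
      proof (rule late_distance[OF _ K \<delta>(1)])
        have "(\<lambda>n. (c - 1 / ln (real n)) * lam1 (V n) (d n)) \<longlonglongrightarrow> (c - 0) * \<Lambda>"
          by (intro tendsto_intros ln_inv lam1_lim)
        then have "\<forall>\<^sub>F n in sequentially. 1 + 2 * \<delta> < (c - 1 / ln (real n)) * lam1 (V n) (d n)"
          using \<delta>(2) by (intro order_tendstoD(1)) auto
        then show "\<forall>\<^sub>F n in sequentially. (1 + 2 * \<delta>) * ln (real n) \<le> real (?T n) * lam1 (V n) (d n)"
          using T lam1_pos
        proof eventually_elim
          case (elim n)
          have "(1 + 2 * \<delta>) * ln (real n) \<le> ((c - 1 / ln (real n)) * lam1 (V n) (d n)) * ln (real n)"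
            using elim by (intro mult_right_mono) auto
          also have "\<dots> = (c * ln (real n) - 1) * lam1 (V n) (d n)" using elim by (simp add: field_simps)
          also have "\<dots> \<le> real (?T n) * lam1 (V n) (d n)" using elim by (intro mult_right_mono) auto
          finally show ?case .
        qed
      qed (use c in simp)
      then show ?thesis using False by simp
    qed
  qed

  show ?thesis
  proof (intro conjI impI allI)
    fix c :: real assume "filterlim (\<lambda>n. \<alpha> n * ln (real n)) at_top sequentially" "0 \<le> c"
    then show "whp_eq_oP \<mu> (\<lambda>n s. D n s (nat \<lfloor>c / \<alpha> n\<rfloor>)) (exp (- c))" by (rule fast)
  next
    fix \<gamma> c :: real assume "(\<lambda>n. \<alpha> n * ln (real n)) \<longlonglongrightarrow> \<gamma>" "0 \<le> c" "c \<noteq> c_star"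
    then show "whp_eq_oP \<mu> (\<lambda>n s. D n s (nat \<lfloor>c * ln (real n)\<rfloor>))
        (if c < c_star then exp (- \<gamma> * c) else 0)" by (rule slow)
  next
    fix c :: real assume "(\<lambda>n. \<alpha> n * ln (real n)) \<longlonglongrightarrow> 0" "0 \<le> c" "c \<noteq> c_star"
    from slow[OF this] show "whp_eq_oP \<mu> (\<lambda>n s. D n s (nat \<lfloor>c * ln (real n)\<rfloor>))
        (if c < c_star then 1 else 0)" by (cases "c < c_star") simp_all
  qed
qed

end
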